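(* Fix $\alpha\in\mathcal A$. Assume (A1) and 1) the matrix measures $\mu_T(dx;\alpha)$ converge weakly, as $T\to\infty$, to a positive definite matrix measure $\mu(dx;\alpha)$ (i.e. each entry $\mu^{jl}$ is a complex measure of bounded variation, $\mu(A)$ is nonnegative definite for every Lebesgue measurable $A\subset\mathbb R$, and $\mu(\mathbb R)$ is positive definite); 2) $\sup_{t\in[0,T]}|b_{iT}(t,\alpha)|\le c_iT^{-1/2}$, $i=1,\dots,q$, for some constants $c_i$. Then the vector $\zeta_T=\big(\int_0^T\varepsilon(t)b_{iT}(t,\alpha)dt\big)_{i=1}^q=d_T^{-1}(\alpha)\int_0^T\varepsilon(t)\nabla_\alpha g(t,\alpha)dt$ converges in distribution, as $T\to\infty$, to $N(0,\Sigma)$ with $\Sigma=2\pi\int_{\mathbb R}f(\lambda)\mu(d\lambda;\alpha)=d_2\int_{\mathbb R}|a(\lambda)|^2\mu(d\lambda;\alpha)$.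
   Context: $L(t)$, $t\in\mathbb R$, is a two-sided Lévy process (Lévy process with triplet $(a,b,\Pi)$ on $t\ge0$; for $t<0$ an independent copy of $-L(-t)$); $\varepsilon(t)=\int_{\mathbb R}\hat a(t-s)dL(s)$, $\hat a$ measurable real. (A1): $\hat a(t)=0$ for $t<0$, $\hat a\in L_1\cap L_2(\mathbb R)$, $\mathbb EL(1)=0$, $\int_{|u|\ge1}e^{pu}\Pi(du)<\infty$ for some $p>0$. $d_2=\mathbb EL^2(1)$, $a(\lambda)=\int\hat a(t)e^{-i\lambda t}dt$, $f(\lambda)=(2\pi)^{-1}d_2|a(\lambda)|^2$. $g(t,\alpha)$, $t\ge0$, $\alpha\in\mathcal A\subset\mathbb R^q$ ($\mathcal A$ open convex), is continuously differentiable in $\alpha$ with $g_i=\partial g/\partial\alpha_i$ locally square integrable in $t$; $d_{iT}^2(\alpha)=\int_0^Tg_i^2(t,\alpha)dt>0$, $d_T(\alpha)=\mathrm{diag}(d_{iT}(\alpha))$, $b_{iT}(t,\alpha)=d_{iT}^{-1}(\alpha)g_i(t,\alpha)$. With $g_T^j(x,\alpha)=\int_0^Te^{ixt}g_j(t,\alpha)dt$, $\mu_T(dx;\alpha)=(\mu_T^{jl}(dx;\alpha))_{j,l=1}^q$ is the matrix measure with densities $\mu_T^{jl}(x;\alpha)=g_T^j(x,\alpha)\overline{g_T^l(x,\alpha)}\big(\int_{\mathbb R}|g_T^j(x,\alpha)|^2dx\int_{\mathbb R}|g_T^l(x,\alpha)|^2dx\big)^{-1/2}$, $x\in\mathbb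 R$. *)

theory Defs
  imports "HOL-Probability.Probability"
begin

definition levy_exponent :: "real \<Rightarrow> real \<Rightarrow> real measure \<Rightarrow> real \<Rightarrow> complex" where
  "levy_exponent a b Lm u =
     \<i> * complex_of_real (a * u) - complex_of_real (b * u\<^sup>2 / 2)
     + (\<integral>x. (cis (u * x) - 1 - \<i> * complex_of_real (u * x * indicator {-1..1} x)) \<partial>Lm)"

definition levy_triplet :: "real \<Rightarrow> real \<Rightarrow> real measure \<Rightarrow> bool" where
  "levy_triplet a b Lm \<longleftrightarrow> b \<ge> 0 \<and> sets Lm = sets borel \<and> emeasure Lm {0} = 0
     \<and> (\<integral>\<^sup>+x. ennreal (min 1 (x\<^sup>2)) \<partial>Lm) < \<infinity>"

definition levy_process ::
    "'w measure \<Rightarrow> real \<Rightarrow> real \<Rightarrow> real measure \<Rightarrow> (real \<Rightarrow> 'w \<Rightarrow> real) \<Rightarrow> bool" where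
  "levy_process M a b Lm X \<longleftrightarrow>
     levy_triplet a b Lm
   \<and> (\<forall>t\<ge>0. X t \<in> borel_measurable M)
   \<and> (AE \<omega> in M. X 0 \<omega> = 0)
   \<and> (\<forall>(n::nat) (ts::nat \<Rightarrow> real). 0 \<le> ts 0 \<longrightarrow> (\<forall>k<n. ts k < ts (Suc k)) \<longrightarrow>
        prob_space.indep_vars M (\<lambda>_. borel) (\<lambda>k \<omega>. X (ts (Suc k)) \<omega> - X (ts k) \<omega>) {..<n})
   \<and> (\<forall>s t u. 0 \<le> s \<longrightarrow> s \<le> t \<longrightarrow>
        (\<integral>\<omega>. cis (u * (X t \<omega> - X s \<omega>)) \<partial>M) = exp (complex_of_real (t - s) * levy_exponent a b Lm u))
   \<and> (AE \<omega> in M. \<forall>t\<ge>0. continuous (at_right t) (\<lambda>s. X s \<omega>)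
        \<and> (t > 0 \<longrightarrow> (\<exists>l. ((\<lambda>s. X s \<omega>) \<longlongrightarrow> l) (at_left t))))"

definition proc_sigma :: "'w measure \<Rightarrow> (real \<Rightarrow> 'w \<Rightarrow> real) \<Rightarrow> real set \<Rightarrow> 'w set set" where
  "proc_sigma M X I = sigma_sets (space M) (\<Union>t\<in>I. {X t -` B \<inter> space M | B. B \<in> sets borel})"

definition two_sided :: "(real \<Rightarrow> 'w \<Rightarrow> real) \<Rightarrow> (real \<Rightarrow> 'w \<Rightarrow> real) \<Rightarrow> real \<Rightarrow> 'w \<Rightarrow> real" where
  "two_sided L0 L1 t \<omega> = (if t \<ge> 0 then L0 t \<omega> else - L1 (- t) \<omega>)"

definition two_sided_levy ::
    "'w measure \<Rightarrow> real \<Rightarrow> real \<Rightarrow> real measure \<Rightarrow> (real \<Rightarrow> 'w \<Rightarrow> real) \<Rightarrow> (real \<Rightarrow> 'w \<Rightarrow> real) \<Rightarrow> bool" where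
  "two_sided_levy M a b Lm L0 L1 \<longleftrightarrow>
     levy_process M a b Lm L0 \<and> levy_process M a b Lm L1
   \<and> prob_space.indep_set M (proc_sigma M L0 {0..}) (proc_sigma M L1 {0..})"

definition step_fun :: "(nat \<Rightarrow> real) \<Rightarrow> (nat \<Rightarrow> real) \<Rightarrow> (nat \<Rightarrow> real) \<Rightarrow> nat \<Rightarrow> real \<Rightarrow> real" where
  "step_fun c s t n x = (\<Sum>k<n. c k * indicator {s k<..t k} x)"

definition step_int ::
    "(real \<Rightarrow> 'w \<Rightarrow> real) \<Rightarrow> (nat \<Rightarrow> real) \<Rightarrow> (nat \<Rightarrow> real) \<Rightarrow> (nat \<Rightarrow> real) \<Rightarrow> nat \<Rightarrow> 'w \<Rightarrow> real" where
  "step_int L c s t n \<omega> = (\<Sum>k<n. c k * (L (t k) \<omega> - L (s k) \<omega>))"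

definition is_stoch_integral ::
    "'w measure \<Rightarrow> (real \<Rightarrow> 'w \<Rightarrow> real) \<Rightarrow> (real \<Rightarrow> real) \<Rightarrow> ('w \<Rightarrow> real) \<Rightarrow> bool" where
  "is_stoch_integral M L f X \<longleftrightarrow> X \<in> borel_measurable M \<and>
     (\<exists>(C::nat \<Rightarrow> nat \<Rightarrow> real) S T N.
        (\<forall>m k. S m k \<le> T m k)
      \<and> (\<lambda>m. \<integral>\<^sup>+x. ennreal ((f x - step_fun (C m) (S m) (T m) (N m) x)\<^sup>2) \<partial>lborel) \<longlonglongrightarrow> 0
      \<and> (\<lambda>m. \<integral>\<^sup>+\<omega>. ennreal ((X \<omega> - step_int L (C m) (S m) (T m) (N m) \<omega>)\<^sup>2) \<partial>M) \<longlonglongrightarrow> 0)"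

text \<open>A complex measure of bounded variation on the Lebesgue sets is represented by four finite
  measures N 0, N 1, N 2, N 3 (Jordan decomposition): mu = (N0 - N1) + i (N2 - N3).\<close>
definition cmeasure_rep :: "(nat \<Rightarrow> real measure) \<Rightarrow> bool" where
  "cmeasure_rep N \<longleftrightarrow> (\<forall>k<4. finite_measure (N k) \<and> sets (N k) = sets lebesgue)"

definition cm_val :: "(nat \<Rightarrow> real measure) \<Rightarrow> real set \<Rightarrow> complex" where
  "cm_val N A = Complex (measure (N 0) A - measure (N 1) A) (measure (N 2) A - measure (N 3) A)"

definition cm_int :: "(nat \<Rightarrow> real measure) \<Rightarrow> (real \<Rightarrow> real) \<Rightarrow> complex" where
  "cm_int N h = Complex ((\<integral>x. h x \<partial>N 0) - (\<integral>x. h x \<partial>N 1)) ((\<integral>x. h x \<partial>N 2) - (\<integral>x. h x \<partial>N 3))"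

definition dT :: "('q \<Rightarrow> real \<Rightarrow> 'a \<Rightarrow> real) \<Rightarrow> 'q \<Rightarrow> real \<Rightarrow> 'a \<Rightarrow> real" where
  "dT gd i T \<alpha> = sqrt (LINT t:{0..T}|lborel. (gd i t \<alpha>)\<^sup>2)"

definition bT :: "('q \<Rightarrow> real \<Rightarrow> 'a \<Rightarrow> real) \<Rightarrow> 'q \<Rightarrow> real \<Rightarrow> real \<Rightarrow> 'a \<Rightarrow> real" where
  "bT gd i T t \<alpha> = gd i t \<alpha> / dT gd i T \<alpha>"

definition gT :: "('q \<Rightarrow> real \<Rightarrow> 'a \<Rightarrow> real) \<Rightarrow> 'q \<Rightarrow> real \<Rightarrow> 'a \<Rightarrow> real \<Rightarrow> complex" where
  "gT gd j T \<alpha> x = (LINT t:{0..T}|lborel. cis (x * t) * complex_of_real (gd j t \<alpha>))"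

definition muT_dens :: "('q \<Rightarrow> real \<Rightarrow> 'a \<Rightarrow> real) \<Rightarrow> 'q \<Rightarrow> 'q \<Rightarrow> real \<Rightarrow> 'a \<Rightarrow> real \<Rightarrow> complex" where
  "muT_dens gd j l T \<alpha> x = gT gd j T \<alpha> x * cnj (gT gd l T \<alpha> x) /
     complex_of_real (sqrt ((LINT y|lborel. (cmod (gT gd j T \<alpha> y))\<^sup>2) * (LINT y|lborel. (cmod (gT gd l T \<alpha> y))\<^sup>2)))"

definition fourier :: "(real \<Rightarrow> real) \<Rightarrow> real \<Rightarrow> complex" where
  "fourier ah lam = (LINT t|lborel. complex_of_real (ah t) * cis (- lam * t))"

definition spec_dens :: "real \<Rightarrow> (real \<Rightarrow> real) \<Rightarrow> real \<Rightarrow> real" where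
  "spec_dens d2 ah lam = d2 * (cmod (fourier ah lam))\<^sup>2 / (2 * pi)"

definition gaussian_law :: "('q::finite \<Rightarrow> 'q \<Rightarrow> complex) \<Rightarrow> (real ^ 'q) measure \<Rightarrow> bool" where
  "gaussian_law Sig N \<longleftrightarrow> prob_space N \<and> sets N = sets borel \<and>
     (\<forall>u::real ^ 'q. (\<integral>x. cis (u \<bullet> x) \<partial>N) =
        exp (- (1/2) * (\<Sum>j\<in>UNIV. \<Sum>l\<in>UNIV. complex_of_real (u $ j * u $ l) * Sig j l)))"

definition conv_in_distr :: "'w measure \<Rightarrow> (real \<Rightarrow> 'w \<Rightarrow> real ^ 'q) \<Rightarrow> (real ^ 'q) measure \<Rightarrow> bool" where
  "conv_in_distr M Z N \<longleftrightarrow>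
     (\<forall>h :: real ^ 'q \<Rightarrow> real. continuous_on UNIV h \<and> bounded (range h) \<longrightarrow>
        ((\<lambda>T. \<integral>\<omega>. h (Z T \<omega>) \<partial>M) \<longlongrightarrow> (\<integral>x. h x \<partial>N)) at_top)"

definition zeta :: "(real \<Rightarrow> 'w \<Rightarrow> real) \<Rightarrow> ('q::finite \<Rightarrow> real \<Rightarrow> real ^ 'q \<Rightarrow> real)
                    \<Rightarrow> real ^ 'q \<Rightarrow> real \<Rightarrow> 'w \<Rightarrow> real ^ 'q" where
  "zeta eps gd \<alpha> T \<omega> = (\<chi> i. LINT t:{0..T}|lborel. eps t \<omega> * bT gd i T t \<alpha>)"

end

theory Submission
  imports Defs
begin

text \<open>
  For a vector u, the variable u . zeta_T equals the stochastic integral of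
  h_T(s) = int_0^T (sum_i u_i b_iT(t)) ahat(t - s) dt against L (stochastic Fubini). Its
  characteristic function is exp (int psi(h_T(s)) ds), where psi is the Levy exponent, and
  psi(x) = - d2 x^2 / 2 + o(x^2) because L(1) is centred and square integrable. Since
  sup |h_T| = O(T^(-1/2)), the exponent is asymptotically - d2 |h_T|^2 / 2 in terms of the
  L2 norm. By Plancherel |h_T|^2 is the integral of |a|^2 against the quadratic form
  of mu_T at u, which converges by the weak convergence of mu_T. The second moments of zeta_T
  are bounded, hence convergence of characteristic functions gives convergence in distribution.
\<close>

section \<open>Square-integrable functions\<close>

text \<open>The integral against L is given only as an L2 limit of step integrals, and
  \<open>eps\<close> is tied to L one time at a time; the obstacle is to control the law of a
  pathwise time integral of \<open>eps\<close>. What is used is its L2 distance to step integrals on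
  a uniform grid: by comparison of Gram functions this is \<open>sqrt d2\<close> times the distance
  of the integrands. On a grid the characteristic function is an explicit finite product, and
  comparison with a Gaussian costs at most eta times the squared norm of the grid function. This
  inequality survives the L2 limit and stands in for the formula with the integral of psi. Moments
  are another obstacle, being available only for L(1). They give the expansion of psi at 0, and this
  expansion in turn gives the moments of every other increment, hence the isometry on step
  functions. That h_T is continuous and bounded serves the grid: continuity lets h_T be approximated
  by sampling, and samples obey the same bound, so psi is evaluated only near 0.\<close>

definition sq_integrable :: "'a measure \<Rightarrow> ('a \<Rightarrow> real) \<Rightarrow> bool" where
  "sq_integrable M f \<longleftrightarrow> f \<in> borel_measurable M \<and> integrable M (\<lambda>x. (f x)\<^sup>2)"

lemma sq_integrableI: "f \<in> borel_measurable M \<Longrightarrow> integrable M (\<lambda>x. (f x)\<^sup>2) \<Longrightarrow> sq_integrable M f"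
  by (simp add: sq_integrable_def)

lemma sq_integrable_measurable [measurable_dest]: "sq_integrable M f \<Longrightarrow> f \<in> borel_measurable M"
  by (simp add: sq_integrable_def)

lemma sq_integrable_square: "sq_integrable M f \<Longrightarrow> integrable M (\<lambda>x. (f x)\<^sup>2)"
  by (simp add: sq_integrable_def)

lemma sq_integrable_mult:
  assumes "sq_integrable M f" "sq_integrable M g"
  shows "integrable M (\<lambda>x. f x * g x)"
proof (rule Bochner_Integration.integrable_bound)
  show "integrable M (\<lambda>x. (f x)\<^sup>2 + (g x)\<^sup>2)"
    using assms by (intro Bochner_Integration.integrable_add sq_integrable_square)
  show "(\<lambda>x. f x * g x) \<in> borel_measurable M" using assms by measurable
  have "norm (p * q) \<le> norm (p\<^sup>2 + q\<^sup>2)" for p q :: real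
  proof -
    have "2 * (\<bar>p\<bar> * \<bar>q\<bar>) \<le> p\<^sup>2 + q\<^sup>2"
      using sum_squares_bound[of "\<bar>p\<bar>" "\<bar>q\<bar>"] by simp
    moreover have "0 \<le> \<bar>p\<bar> * \<bar>q\<bar>" by simp
    ultimately have "\<bar>p\<bar> * \<bar>q\<bar> \<le> p\<^sup>2 + q\<^sup>2" by linarith
    then show ?thesis by (simp add: abs_mult)
  qed
  then show "AE x in M. norm (f x * g x) \<le> norm ((f x)\<^sup>2 + (g x)\<^sup>2)" by blast
qed

lemma sq_integrable_cmult:
  "sq_integrable M f \<Longrightarrow> sq_integrable M (\<lambda>x. c * f x)"
  by (auto simp: sq_integrable_def power_mult_distrib)

lemma sq_integrable_add:
  assumes "sq_integrable M f" "sq_integrable M g"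
  shows "sq_integrable M (\<lambda>x. f x + g x)"
proof (rule sq_integrableI)
  show "(\<lambda>x. f x + g x) \<in> borel_measurable M" using assms by measurable
  have "integrable M (\<lambda>x. (f x)\<^sup>2 + (g x)\<^sup>2 + 2 * (f x * g x))"
    using assms by (intro Bochner_Integration.integrable_add integrable_mult_right
      sq_integrable_square sq_integrable_mult)
  then show "integrable M (\<lambda>x. (f x + g x)\<^sup>2)"
    by (simp add: power2_sum mult.assoc)
qed

lemma sq_integrable_diff:
  assumes "sq_integrable M f" "sq_integrable M g"
  shows "sq_integrable M (\<lambda>x. f x - g x)"
  using sq_integrable_add[OF assms(1) sq_integrable_cmult[OF assms(2), of "-1"]] by simp

lemma sq_integrable_sum:
  "(\<And>i. i \<in> I \<Longrightarrow> sq_integrable M (f i)) \<Longrightarrow> sq_integrable M (\<lambda>x. \<Sum>i\<in>I. f i x)"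
  by (induction I rule: infinite_finite_induct) (auto intro!: sq_integrable_add simp: sq_integrable_def[of _ "\<lambda>_. 0"])

lemma sq_integrable_Cauchy_Schwarz:
  assumes f: "sq_integrable M f" and g: "sq_integrable M g"
  shows "\<bar>\<integral>x. f x * g x \<partial>M\<bar> \<le> sqrt (\<integral>x. (f x)\<^sup>2 \<partial>M) * sqrt (\<integral>x. (g x)\<^sup>2 \<partial>M)"
proof -
  have [measurable]: "f \<in> borel_measurable M" "g \<in> borel_measurable M"
    using f g by auto
  let ?I = "\<integral>x. \<bar>f x\<bar> * \<bar>g x\<bar> \<partial>M"
  have i: "integrable M (\<lambda>x. \<bar>f x\<bar> * \<bar>g x\<bar>)"
    using integrable_abs[OF sq_integrable_mult[OF f g]] by (simp add: abs_mult)
  have sq: "ennreal \<bar>r\<bar> ^ 2 = ennreal (r\<^sup>2)" for r :: real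
    by (simp add: ennreal_power)
  have "(\<integral>\<^sup>+x. ennreal \<bar>f x\<bar> * ennreal \<bar>g x\<bar> \<partial>M)\<^sup>2 \<le>
      (\<integral>\<^sup>+x. ennreal \<bar>f x\<bar> ^ 2 \<partial>M) * (\<integral>\<^sup>+x. ennreal \<bar>g x\<bar> ^ 2 \<partial>M)"
    by (intro Cauchy_Schwarz_nn_integral) measurable
  also have "(\<integral>\<^sup>+x. ennreal \<bar>f x\<bar> * ennreal \<bar>g x\<bar> \<partial>M) = ennreal ?I"
    using i by (simp add: ennreal_mult[symmetric] nn_integral_eq_integral)
  also have "(\<integral>\<^sup>+x. ennreal \<bar>f x\<bar> ^ 2 \<partial>M) = ennreal (\<integral>x. (f x)\<^sup>2 \<partial>M)"
    unfolding sq using sq_integrable_square[OF f] by (intro nn_integral_eq_integral) auto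
  also have "(\<integral>\<^sup>+x. ennreal \<bar>g x\<bar> ^ 2 \<partial>M) = ennreal (\<integral>x. (g x)\<^sup>2 \<partial>M)"
    unfolding sq using sq_integrable_square[OF g] by (intro nn_integral_eq_integral) auto
  finally have "?I\<^sup>2 \<le> (\<integral>x. (f x)\<^sup>2 \<partial>M) * (\<integral>x. (g x)\<^sup>2 \<partial>M)"
    by (simp add: ennreal_power ennreal_mult[symmetric] integral_nonneg_AE)
  then have "?I \<le> sqrt ((\<integral>x. (f x)\<^sup>2 \<partial>M) * (\<integral>x. (g x)\<^sup>2 \<partial>M))"
    by (rule real_le_rsqrt)
  moreover have "\<bar>\<integral>x. f x * g x \<partial>M\<bar> \<le> ?I"
    using integral_abs_bound[of M "\<lambda>x. f x * g x"] by (simp add: abs_mult)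
  ultimately show ?thesis by (simp add: real_sqrt_mult)
qed

text \<open>Continuity of the L2 inner product. It carries the isometry from step functions to their
  limits; with equal factors it gives convergence of squared norms.\<close>

lemma tendsto_integral_mult:
  assumes X: "\<And>n. sq_integrable M (X n)" "sq_integrable M X'"
    and Y: "\<And>n. sq_integrable M (Y n)" "sq_integrable M Y'"
    and limX: "(\<lambda>n. \<integral>x. (X' x - X n x)\<^sup>2 \<partial>M) \<longlonglongrightarrow> 0"
    and limY: "(\<lambda>n. \<integral>x. (Y' x - Y n x)\<^sup>2 \<partial>M) \<longlonglongrightarrow> 0"
  shows "(\<lambda>n. \<integral>x. X n x * Y n x \<partial>M) \<longlonglongrightarrow> (\<integral>x. X' x * Y' x \<partial>M)"
proof -
  let ?N = "\<lambda>f. sqrt (\<integral>x. (f x)\<^sup>2 \<partial>M)"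
  have dX: "sq_integrable M (\<lambda>x. X' x - X n x)" and dY: "sq_integrable M (\<lambda>x. Y' x - Y n x)" for n
    using X Y by (auto intro: sq_integrable_diff)
  have lX: "(\<lambda>n. ?N (\<lambda>x. X' x - X n x)) \<longlonglongrightarrow> 0" and lY: "(\<lambda>n. ?N (\<lambda>x. Y' x - Y n x)) \<longlonglongrightarrow> 0"
    using tendsto_real_sqrt[OF limX] tendsto_real_sqrt[OF limY] by simp_all
  have 1: "(\<lambda>n. \<integral>x. (X' x - X n x) * (Y' x - Y n x) \<partial>M) \<longlonglongrightarrow> 0"
  proof (rule Lim_null_comparison)
    show "\<forall>\<^sub>F n in sequentially. norm (\<integral>x. (X' x - X n x) * (Y' x - Y n x) \<partial>M) \<le>
      ?N (\<lambda>x. X' x - X n x) * ?N (\<lambda>x. Y' x - Y n x)"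
      using sq_integrable_Cauchy_Schwarz[OF dX dY] by simp
    show "(\<lambda>n. ?N (\<lambda>x. X' x - X n x) * ?N (\<lambda>x. Y' x - Y n x)) \<longlonglongrightarrow> 0"
      using tendsto_mult[OF lX lY] by simp
  qed
  have 2: "(\<lambda>n. \<integral>x. X' x * (Y' x - Y n x) \<partial>M) \<longlonglongrightarrow> 0"
  proof (rule Lim_null_comparison)
    show "\<forall>\<^sub>F n in sequentially. norm (\<integral>x. X' x * (Y' x - Y n x) \<partial>M) \<le> ?N X' * ?N (\<lambda>x. Y' x - Y n x)"
      using sq_integrable_Cauchy_Schwarz[OF X(2) dY] by simp
    show "(\<lambda>n. ?N X' * ?N (\<lambda>x. Y' x - Y n x)) \<longlonglongrightarrow> 0"
      using tendsto_mult[OF tendsto_const lY] by simp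
  qed
  have 3: "(\<lambda>n. \<integral>x. (X' x - X n x) * Y' x \<partial>M) \<longlonglongrightarrow> 0"
  proof (rule Lim_null_comparison)
    show "\<forall>\<^sub>F n in sequentially. norm (\<integral>x. (X' x - X n x) * Y' x \<partial>M) \<le> ?N (\<lambda>x. X' x - X n x) * ?N Y'"
      using sq_integrable_Cauchy_Schwarz[OF dX Y(2)] by simp
    show "(\<lambda>n. ?N (\<lambda>x. X' x - X n x) * ?N Y') \<longlonglongrightarrow> 0"
      using tendsto_mult[OF lX tendsto_const] by simp
  qed
  \<comment> \<open>Every term except the last contains a difference and is therefore controlled by
    Cauchy-Schwarz.\<close>
  have eq: "(\<integral>x. X n x * Y n x \<partial>M) = (\<integral>x. (X' x - X n x) * (Y' x - Y n x) \<partial>M)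
     - (\<integral>x. X' x * (Y' x - Y n x) \<partial>M) - (\<integral>x. (X' x - X n x) * Y' x \<partial>M) + (\<integral>x. X' x * Y' x \<partial>M)" for n
  proof -
    note i = sq_integrable_mult[OF dX dY, of n n] sq_integrable_mult[OF X(2) dY, of n]
      sq_integrable_mult[OF dX Y(2), of n] sq_integrable_mult[OF X(2) Y(2)]
    have "(\<integral>x. X n x * Y n x \<partial>M) = (\<integral>x. (X' x - X n x) * (Y' x - Y n x)
        - X' x * (Y' x - Y n x) - (X' x - X n x) * Y' x + X' x * Y' x \<partial>M)"
      by (intro Bochner_Integration.integral_cong) (auto simp: algebra_simps)
    also have "\<dots> = (\<integral>x. (X' x - X n x) * (Y' x - Y n x) \<partial>M)
     - (\<integral>x. X' x * (Y' x - Y n x) \<partial>M) - (\<integral>x. (X' x - X n x) * Y' x \<partial>M) + (\<integral>x. X' x * Y' x \<partial>M)"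
      using i by (simp only: Bochner_Integration.integral_add Bochner_Integration.integral_diff
        Bochner_Integration.integrable_add Bochner_Integration.integrable_diff)
    finally show ?thesis .
  qed
  show ?thesis unfolding eq
    using tendsto_add[OF tendsto_diff[OF tendsto_diff[OF 1 2] 3] tendsto_const[of "\<integral>x. X' x * Y' x \<partial>M"]]
    by simp
qed

text \<open>\<open>is_stoch_integral\<close> states its limits with nonnegative integrals, which may
  be infinite. One approximant at squared distance below 1 shows that the limit is square
  integrable; from then on the limits can be read as real ones.\<close>

lemma sq_integrable_nn_limit:
  assumes X: "\<And>n. sq_integrable M (X n)" and [measurable]: "X' \<in> borel_measurable M"
    and lim: "(\<lambda>n. \<integral>\<^sup>+x. ennreal ((X' x - X n x)\<^sup>2) \<partial>M) \<longlonglongrightarrow> 0"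
  shows "sq_integrable M X'" "(\<lambda>n. \<integral>x. (X' x - X n x)\<^sup>2 \<partial>M) \<longlonglongrightarrow> 0"
proof -
  have [measurable]: "X n \<in> borel_measurable M" for n using X by auto
  have "\<forall>\<^sub>F n in sequentially. (\<integral>\<^sup>+x. ennreal ((X' x - X n x)\<^sup>2) \<partial>M) < 1"
    using lim by (rule order_tendstoD) simp
  then obtain n where "(\<integral>\<^sup>+x. ennreal ((X' x - X n x)\<^sup>2) \<partial>M) < 1"
    by (auto simp: eventually_sequentially)
  then have "integrable M (\<lambda>x. (X' x - X n x)\<^sup>2)"
    by (intro integrableI_nonneg) (auto intro: order.strict_trans simp: less_top[symmetric])
  then have "sq_integrable M (\<lambda>x. X' x - X n x)"
    by (intro sq_integrableI) auto
  from sq_integrable_add[OF this X[of n]] have "sq_integrable M (\<lambda>x. (X' x - X n x) + X n x)" .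
  then show *: "sq_integrable M X'" by simp
  have "(\<integral>\<^sup>+x. ennreal ((X' x - X n x)\<^sup>2) \<partial>M) = ennreal (\<integral>x. (X' x - X n x)\<^sup>2 \<partial>M)" for n
    using sq_integrable_square[OF sq_integrable_diff[OF * X]] by (intro nn_integral_eq_integral) auto
  with lim show "(\<lambda>n. \<integral>x. (X' x - X n x)\<^sup>2 \<partial>M) \<longlonglongrightarrow> 0"
    by (simp add: ennreal_tendsto_0_iff integral_nonneg_AE)
qed

text \<open>True without integrability, because the integral of a non-integrable function is 0 by
  convention. This bounds \<open>Y\<close> pointwise before its integrand is known to be
  integrable.\<close>

lemma abs_integral_le_nn_integral:
  fixes f :: "'a \<Rightarrow> real"
  shows "ennreal \<bar>\<integral>x. f x \<partial>M\<bar> \<le> (\<integral>\<^sup>+x. ennreal \<bar>f x\<bar> \<partial>M)"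
proof (cases "integrable M f")
  case True
  then show ?thesis using integral_norm_bound_ennreal[of M f] by simp
qed (simp add: not_integrable_integral_eq)

text \<open>
  Used for the kernels eps on the probability space and (t, s) \<mapsto> ahat (t - s) on the line. Their
  Gram matrices agree up to the factor d2, so that the integrated kernels have proportional
  norms and inner products: this is all of stochastic Fubini that is needed.
\<close>

locale bounded_kernel = sigma_finite_measure P for P :: "'b measure" +
  fixes k :: "real \<Rightarrow> 'b \<Rightarrow> real" and C B T :: real and w :: "real \<Rightarrow> real"
  assumes k_meas [measurable]: "(\<lambda>(t, x). k t x) \<in> borel_measurable (lborel \<Otimes>\<^sub>M P)"
    and k_sq: "\<And>t. sq_integrable P (k t)"
    and k_bound: "\<And>t. (\<integral>x. (k t x)\<^sup>2 \<partial>P) \<le> C"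
    and w_meas [measurable]: "w \<in> borel_measurable borel"
    and w_bound: "\<And>t. \<bar>w t\<bar> \<le> B * indicator {0..T} t"
begin

definition Y where "Y x = (LINT t|lborel. w t * k t x)"

lemma C_nonneg: "0 \<le> C"
  by (rule order.trans[OF _ k_bound[of 0]]) simp

lemma w_abs_le: "\<bar>w t\<bar> \<le> \<bar>B\<bar>"
  using w_bound[of t] by (cases "t \<in> {0..T}") auto

sublocale pair_sigma_finite lborel P ..

lemma Y_measurable [measurable]: "Y \<in> borel_measurable P"
  unfolding Y_def by measurable

lemma integrable_w: "integrable lborel w"
proof (rule Bochner_Integration.integrable_bound)
  show "integrable lborel (\<lambda>t. B * indicator {0..T} t)"
    by (intro integrable_mult_right integrable_real_indicator) (auto simp: emeasure_lborel_Icc_eq)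
  show "AE t in lborel. norm (w t) \<le> norm (B * indicator {0..T} t)"
    using w_bound by (auto intro!: AE_I2 order.trans[OF w_bound])
qed simp

lemma integrable_w_square: "integrable lborel (\<lambda>t. (w t)\<^sup>2)"
proof (rule Bochner_Integration.integrable_bound)
  show "integrable lborel (\<lambda>t. B * indicator {0..T} t * B)"
    by (intro integrable_mult_right integrable_mult_left integrable_real_indicator)
      (auto simp: emeasure_lborel_Icc_eq)
  have "(w t)\<^sup>2 \<le> \<bar>B * indicator {0..T} t * B\<bar>" for t
  proof -
    have "(w t)\<^sup>2 \<le> (B * indicator {0..T} t)\<^sup>2"
      using power_mono[OF w_bound[of t], of 2] by simp
    then show ?thesis by (auto simp: power2_eq_square indicator_def abs_mult)
  qed
  then show "AE t in lborel. norm ((w t)\<^sup>2) \<le> norm (B * indicator {0..T} t * B)"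
    by auto
qed simp

text \<open>Cauchy-Schwarz in x bounds the inner integral uniformly in t through \<open>C\<close>,
  and the integrable weight handles t.\<close>

lemma integrable_w_k_mult:
  assumes J: "sq_integrable P J"
  shows "integrable (lborel \<Otimes>\<^sub>M P) (\<lambda>(t, x). w t * (k t x * J x))"
proof -
  have [measurable]: "J \<in> borel_measurable P" using J by auto
  show ?thesis
  proof (rule Fubini_integrable)
    show "(\<lambda>(t, x). w t * (k t x * J x)) \<in> borel_measurable (lborel \<Otimes>\<^sub>M P)" by measurable
    have i: "integrable P (\<lambda>x. w t * (k t x * J x))" for t
      using sq_integrable_mult[OF k_sq J] by simp
    then show "AE t in lborel. integrable P (\<lambda>x. case (t, x) of (t, x) \<Rightarrow> w t * (k t x * J x))"
      by simp
    show "integrable lborel (\<lambda>t. LINT x|P. norm (case (t, x) of (t, x) \<Rightarrow> w t * (k t x * J x)))"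
    proof (rule Bochner_Integration.integrable_bound)
      let ?c = "sqrt C * sqrt (\<integral>x. (J x)\<^sup>2 \<partial>P)"
      show "integrable lborel (\<lambda>t. w t * ?c)"
        using integrable_w by simp
      show "(\<lambda>t. LINT x|P. norm (case (t, x) of (t, x) \<Rightarrow> w t * (k t x * J x))) \<in> borel_measurable lborel"
        by measurable
      have "norm (LINT x|P. norm (w t * (k t x * J x))) \<le> norm (w t * ?c)" for t
      proof -
        have "(\<integral>x. \<bar>k t x\<bar> * \<bar>J x\<bar> \<partial>P) \<le> sqrt (\<integral>x. (k t x)\<^sup>2 \<partial>P) * sqrt (\<integral>x. (J x)\<^sup>2 \<partial>P)"
          using sq_integrable_Cauchy_Schwarz[of P "\<lambda>x. \<bar>k t x\<bar>" "\<lambda>x. \<bar>J x\<bar>"] k_sq[of t] J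
          by (simp add: sq_integrable_def)
        also have "\<dots> \<le> ?c" using k_bound[of t] by (intro mult_right_mono) auto
        finally have "(\<integral>x. \<bar>k t x\<bar> * \<bar>J x\<bar> \<partial>P) \<le> ?c" .
        then show ?thesis
          by (auto simp: abs_mult C_nonneg intro!: mult_left_mono)
      qed
      then show "AE t in lborel. norm (LINT x|P. norm (case (t, x) of (t, x) \<Rightarrow> w t * (k t x * J x)))
        \<le> norm (w t * ?c)"
        by simp
    qed
  qed
qed

lemma integral_Y_mult:
  assumes J: "sq_integrable P J"
  shows "(\<integral>x. Y x * J x \<partial>P) = (LINT t|lborel. w t * (\<integral>x. k t x * J x \<partial>P))"
proof -
  have "(\<integral>x. Y x * J x \<partial>P) = (\<integral>x. (LINT t|lborel. w t * (k t x * J x)) \<partial>P)"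
    unfolding Y_def by (intro Bochner_Integration.integral_cong refl) (simp add: mult.assoc[symmetric])
  also have "\<dots> = (LINT t|lborel. (\<integral>x. w t * (k t x * J x) \<partial>P))"
    using Fubini_integral[OF integrable_w_k_mult[OF J]] by simp
  finally show ?thesis by simp
qed

lemma sq_integrable_Y: "sq_integrable P Y"
proof (rule sq_integrableI)
  show "integrable P (\<lambda>x. (Y x)\<^sup>2)"
  proof (rule integrableI_nonneg)
    have [measurable]: "k t \<in> borel_measurable P" for t using k_sq by auto
    \<comment> \<open>Cauchy-Schwarz in t for fixed x. Since \<open>w\<close> vanishes off
      \<open>{0..T}\<close>, the indicator may be attached to \<open>k\<close>; it makes the
      integral of the bound \<open>C\<close> over t finite.\<close>
    have le: "ennreal ((Y x)\<^sup>2) \<le> (\<integral>\<^sup>+t. ennreal ((w t)\<^sup>2) \<partial>lborel) *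
        (\<integral>\<^sup>+t. ennreal ((k t x)\<^sup>2) * indicator {0..T} t \<partial>lborel)" if [measurable]: "x \<in> space P" for x
    proof -
      have "ennreal ((Y x)\<^sup>2) = (ennreal \<bar>Y x\<bar>)\<^sup>2"
        by (simp add: ennreal_power)
      also have "ennreal \<bar>Y x\<bar> \<le> (\<integral>\<^sup>+t. ennreal \<bar>w t * k t x\<bar> \<partial>lborel)"
        unfolding Y_def by (rule abs_integral_le_nn_integral)
      also have "\<dots> = (\<integral>\<^sup>+t. ennreal \<bar>w t\<bar> * (ennreal \<bar>k t x\<bar> * indicator {0..T} t) \<partial>lborel)"
      proof (intro nn_integral_cong)
        fix t
        have "t \<notin> {0..T} \<Longrightarrow> w t = 0" using w_bound[of t] by simp
        then show "ennreal \<bar>w t * k t x\<bar> = ennreal \<bar>w t\<bar> * (ennreal \<bar>k t x\<bar> * indicator {0..T} t)"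
          by (cases "t \<in> {0..T}") (auto simp: abs_mult ennreal_mult)
      qed
      finally have "ennreal ((Y x)\<^sup>2) \<le> (\<integral>\<^sup>+t. ennreal \<bar>w t\<bar> * (ennreal \<bar>k t x\<bar> * indicator {0..T} t) \<partial>lborel)\<^sup>2"
        by (simp add: power_mono)
      also have "\<dots> \<le> (\<integral>\<^sup>+t. (ennreal \<bar>w t\<bar>)\<^sup>2 \<partial>lborel) * (\<integral>\<^sup>+t. (ennreal \<bar>k t x\<bar> * indicator {0..T} t)\<^sup>2 \<partial>lborel)"
        by (intro Cauchy_Schwarz_nn_integral) measurable
      also have "(\<integral>\<^sup>+t. (ennreal \<bar>w t\<bar>)\<^sup>2 \<partial>lborel) = (\<integral>\<^sup>+t. ennreal ((w t)\<^sup>2) \<partial>lborel)"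
        by (simp add: ennreal_power)
      also have "(\<integral>\<^sup>+t. (ennreal \<bar>k t x\<bar> * indicator {0..T} t)\<^sup>2 \<partial>lborel) =
          (\<integral>\<^sup>+t. ennreal ((k t x)\<^sup>2) * indicator {0..T} t \<partial>lborel)"
        by (intro nn_integral_cong) (auto simp: power_mult_distrib ennreal_power indicator_def)
      finally show ?thesis .
    qed
    have "(\<integral>\<^sup>+x. ennreal ((Y x)\<^sup>2) \<partial>P) \<le> (\<integral>\<^sup>+x. (\<integral>\<^sup>+t. ennreal ((w t)\<^sup>2) \<partial>lborel) *
        (\<integral>\<^sup>+t. ennreal ((k t x)\<^sup>2) * indicator {0..T} t \<partial>lborel) \<partial>P)"
      by (intro nn_integral_mono le)
    also have "\<dots> = (\<integral>\<^sup>+t. ennreal ((w t)\<^sup>2) \<partial>lborel) *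
        (\<integral>\<^sup>+x. (\<integral>\<^sup>+t. ennreal ((k t x)\<^sup>2) * indicator {0..T} t \<partial>lborel) \<partial>P)"
      by (intro nn_integral_cmult) measurable
    also have "(\<integral>\<^sup>+x. (\<integral>\<^sup>+t. ennreal ((k t x)\<^sup>2) * indicator {0..T} t \<partial>lborel) \<partial>P) =
       (\<integral>\<^sup>+t. (\<integral>\<^sup>+x. ennreal ((k t x)\<^sup>2) * indicator {0..T} t \<partial>P) \<partial>lborel)"
      by (intro Fubini') measurable
    also have "\<dots> = (\<integral>\<^sup>+t. (\<integral>\<^sup>+x. ennreal ((k t x)\<^sup>2) \<partial>P) * indicator {0..T} t \<partial>lborel)"
      by (intro nn_integral_cong nn_integral_multc) measurable
    also have "\<dots> \<le> (\<integral>\<^sup>+t. ennreal C * indicator {0..T} t \<partial>lborel)"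
    proof (intro nn_integral_mono mult_right_mono)
      fix t
      have "(\<integral>\<^sup>+x. ennreal ((k t x)\<^sup>2) \<partial>P) = ennreal (\<integral>x. (k t x)\<^sup>2 \<partial>P)"
        using sq_integrable_square[OF k_sq] by (intro nn_integral_eq_integral) auto
      then show "(\<integral>\<^sup>+x. ennreal ((k t x)\<^sup>2) \<partial>P) \<le> ennreal C"
        using k_bound[of t] by (simp add: ennreal_leI)
    qed simp
    finally have "(\<integral>\<^sup>+x. ennreal ((Y x)\<^sup>2) \<partial>P) \<le> (\<integral>\<^sup>+t. ennreal ((w t)\<^sup>2) \<partial>lborel) * (\<integral>\<^sup>+t. ennreal C * indicator {0..T} t \<partial>lborel)"
      by (simp add: mult_left_mono)
    also have "\<dots> < \<infinity>"
      using integrable_w_square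
      by (subst nn_integral_eq_integral)
        (auto simp: nn_integral_cmult_indicator ennreal_mult_less_top emeasure_lborel_Icc_eq)
    finally show "(\<integral>\<^sup>+x. ennreal ((Y x)\<^sup>2) \<partial>P) < \<infinity>" .
  qed auto
qed auto

text \<open>\<open>integral_Y_mult\<close> is used twice, the second time with
  \<open>J = k t\<close>. The norm of \<open>Y\<close> thus depends on the kernel only through its
  Gram function.\<close>

lemma integral_Y_square:
  "(\<integral>x. (Y x)\<^sup>2 \<partial>P) = (LINT t|lborel. w t * (LINT t'|lborel. w t' * (\<integral>x. k t' x * k t x \<partial>P)))"
proof -
  have "(\<integral>x. (Y x)\<^sup>2 \<partial>P) = (LINT t|lborel. w t * (\<integral>x. Y x * k t x \<partial>P))"
    using integral_Y_mult[OF sq_integrable_Y] by (simp add: power2_eq_square mult.commute)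
  then show ?thesis by (simp add: integral_Y_mult[OF k_sq])
qed

end

section \<open>Continuity of translations in the mean\<close>

lemma lborel_integral_shift:
  fixes f :: "real \<Rightarrow> 'a :: {banach, second_countable_topology}"
  shows "(LINT s|lborel. f (s + x)) = (LINT s|lborel. f s)"
  using lborel_integral_real_affine[of 1 f x] by (simp add: add.commute)

lemma lborel_integrable_shift:
  fixes f :: "real \<Rightarrow> 'a :: {banach, second_countable_topology}"
  shows "integrable lborel (\<lambda>s. f (s + x)) \<longleftrightarrow> integrable lborel f"
  using lborel_integrable_real_affine_iff[of 1 f x] by (simp add: add.commute)

text \<open>\<open>H\<close> may depend on \<open>e\<close>: this is how approximation by simpler
  functions is combined with a limit known for those only.\<close>

lemma tendsto_zero_approx:
  fixes G :: "'a \<Rightarrow> real"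
  assumes "\<And>e. e > 0 \<Longrightarrow> \<exists>H. (H \<longlongrightarrow> 0) F \<and> (\<forall>x. 0 \<le> G x \<and> G x \<le> H x + e)"
  shows "(G \<longlongrightarrow> 0) F"
proof (rule tendstoI)
  fix e :: real assume "e > 0"
  then obtain H where H: "(H \<longlongrightarrow> 0) F" "\<And>x. 0 \<le> G x \<and> G x \<le> H x + e / 2"
    using assms[of "e / 2"] by auto
  have "\<forall>\<^sub>F x in F. dist (H x) 0 < e / 2"
    using H(1) \<open>e > 0\<close> by (intro tendstoD) auto
  then show "\<forall>\<^sub>F x in F. dist (G x) 0 < e"
  proof eventually_elim
    case (elim x)
    then show ?case using H(2)[of x] by (auto simp: dist_real_def)
  qed
qed

text \<open>Small translates of a point of an open set stay inside, so the overlap of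
  \<open>U\<close> with its translate tends to the measure of \<open>U\<close> by dominated
  convergence; outside \<open>U\<close> the product is 0 anyway. The symmetric difference is twice
  the measure of \<open>U\<close> minus twice the overlap.\<close>

lemma L1_translation_open:
  fixes U :: "real set" and X :: "nat \<Rightarrow> real"
  assumes U: "open U" "emeasure lborel U < \<infinity>" and X: "X \<longlonglongrightarrow> 0"
  shows "(\<lambda>n. LINT s|lborel. \<bar>indicator U (s + X n) - indicator U s :: real\<bar>) \<longlonglongrightarrow> 0"
proof -
  have [measurable]: "U \<in> sets borel" using U by auto
  have i: "integrable lborel (indicator U :: real \<Rightarrow> real)" using U by (intro integrable_real_indicator) auto
  have ix: "integrable lborel (\<lambda>s. indicator U (s + x) :: real)" for x
    using i by (simp add: lborel_integrable_shift)
  have ixx: "integrable lborel (\<lambda>s. indicator U (s + x) * indicator U s :: real)" for x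
    by (rule Bochner_Integration.integrable_bound[OF i]) (auto simp: indicator_def)
  have "(\<lambda>n. LINT s|lborel. (indicator U (s + X n) * indicator U s :: real)) \<longlonglongrightarrow> (LINT s|lborel. indicator U s)"
  proof (rule integral_dominated_convergence[where w="indicator U"])
    show "AE s in lborel. (\<lambda>n. indicator U (s + X n) * indicator U s) \<longlonglongrightarrow> (indicator U s :: real)"
    proof (rule AE_I2)
      fix s :: real
      show "(\<lambda>n. indicator U (s + X n) * indicator U s) \<longlonglongrightarrow> (indicator U s :: real)"
      proof (cases "s \<in> U")
        case True
        have "(\<lambda>n. s + X n) \<longlonglongrightarrow> s + 0" by (intro tendsto_intros X)
        then have "\<forall>\<^sub>F n in sequentially. s + X n \<in> U"
          using True U(1) by (simp add: topological_tendstoD)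
        then have "\<forall>\<^sub>F n in sequentially. indicator U (s + X n) * indicator U s = (indicator U s :: real)"
          by eventually_elim simp
        then show ?thesis by (rule tendsto_eventually)
      qed simp
    qed
  qed (use i in \<open>auto simp: indicator_def\<close>)
  moreover have "(LINT s|lborel. \<bar>indicator U (s + x) - indicator U s :: real\<bar>) =
     2 * (LINT s|lborel. indicator U s) - 2 * (LINT s|lborel. indicator U (s + x) * indicator U s)" for x
  proof -
    have "(LINT s|lborel. \<bar>indicator U (s + x) - indicator U s :: real\<bar>) =
      (LINT s|lborel. indicator U (s + x) + indicator U s - 2 * (indicator U (s + x) * indicator U s))"
      by (intro Bochner_Integration.integral_cong) (auto simp: indicator_def)
    also have "\<dots> = (LINT s|lborel. indicator U (s + x)) + (LINT s|lborel. indicator U s)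
        - 2 * (LINT s|lborel. indicator U (s + x) * indicator U s)"
      using i ix ixx by simp
    finally show ?thesis using lborel_integral_shift[of "indicator U :: real \<Rightarrow> real" x] by simp
  qed
  ultimately show ?thesis
    by (auto intro!: tendsto_eq_intros)
qed

text \<open>Induction over integrable functions: a Borel set is replaced by an open superset from
  outer regularity, sums use the triangle inequality, and limits use that translation preserves the
  L1 norm of the error.\<close>

lemma L1_translation:
  fixes f :: "real \<Rightarrow> real" and X :: "nat \<Rightarrow> real"
  assumes "integrable lborel f" and X: "X \<longlonglongrightarrow> 0"
  shows "(\<lambda>n. LINT s|lborel. \<bar>f (s + X n) - f s\<bar>) \<longlonglongrightarrow> 0"
  using assms(1)
proof (induction rule: integrable_induct)
  case (base A c)
  have [measurable]: "A \<in> sets borel" using base by simp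
  show ?case
  proof (rule tendsto_zero_approx)
    fix e :: real assume "e > 0"
    \<comment> \<open>The set \<open>U - A\<close> enters twice, once itself and once translated,
      each time with factor |c|; the added 1 covers c = 0.\<close>
    define d where "d = e / (2 * (\<bar>c\<bar> + 1))"
    have d: "d > 0" "2 * \<bar>c\<bar> * d \<le> e" using \<open>e > 0\<close> by (auto simp: d_def field_simps)
    obtain U where U: "open U" "A \<subseteq> U" "emeasure lborel (U - A) < ennreal d"
      using outer_regular_lborel[of A d] d(1) by auto
    have [measurable]: "U \<in> sets borel" using U by auto
    have "emeasure lborel U = emeasure lborel A + emeasure lborel (U - A)"
      using U(2) by (subst plus_emeasure) (auto simp: Un_absorb1 intro!: arg_cong[where f="emeasure lborel"])
    also have "\<dots> < \<infinity>" using base U(3) by (simp add: order.strict_trans)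
    finally have fU: "emeasure lborel U < \<infinity>" .
    have iD: "integrable lborel (indicator (U - A) :: real \<Rightarrow> real)"
      using U(3) by (intro integrable_real_indicator) (auto intro: order.strict_trans)
    have mD: "(LINT s|lborel. indicator (U - A) s :: real) \<le> d"
      using U(3) d(1) by (auto simp: measure_def enn2real_leI)
    have iU: "integrable lborel (indicator U :: real \<Rightarrow> real)"
      using fU by (intro integrable_real_indicator) auto
    have iA: "integrable lborel (indicator A :: real \<Rightarrow> real)"
      using base by (intro integrable_real_indicator) auto
    let ?H = "\<lambda>n. \<bar>c\<bar> * (LINT s|lborel. \<bar>indicator U (s + X n) - indicator U s :: real\<bar>)"
    have "?H \<longlonglongrightarrow> 0"
      using tendsto_mult[OF tendsto_const L1_translation_open[OF U(1) fU X]] by simp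
    moreover have "(LINT s|lborel. \<bar>indicator A (s + X n) *\<^sub>R c - indicator A s *\<^sub>R c\<bar>) \<le> ?H n + e" for n
    proof -
      note int = iU[THEN lborel_integrable_shift[THEN iffD2], of "X n"] iU
        iD[THEN lborel_integrable_shift[THEN iffD2], of "X n"] iD
        iA[THEN lborel_integrable_shift[THEN iffD2], of "X n"] iA
      have "(LINT s|lborel. \<bar>indicator A (s + X n) *\<^sub>R c - indicator A s *\<^sub>R c\<bar>) \<le>
        (LINT s|lborel. \<bar>c\<bar> * (\<bar>indicator U (s + X n) - indicator U s\<bar> + indicator (U - A) (s + X n)
          + indicator (U - A) s))"
      proof (intro integral_mono)
        fix s
        show "\<bar>indicator A (s + X n) *\<^sub>R c - indicator A s *\<^sub>R c\<bar> \<le>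
          \<bar>c\<bar> * (\<bar>indicator U (s + X n) - indicator U s\<bar> + indicator (U - A) (s + X n) + indicator (U - A) s)"
          using U(2) by (auto simp: indicator_def)
      qed (use int in auto)
      also have "\<dots> = \<bar>c\<bar> * ((LINT s|lborel. \<bar>indicator U (s + X n) - indicator U s\<bar>) +
         (LINT s|lborel. indicator (U - A) (s + X n)) + (LINT s|lborel. indicator (U - A) s))"
        using int by simp
      also have "\<dots> = ?H n + 2 * \<bar>c\<bar> * (LINT s|lborel. indicator (U - A) s)"
        using lborel_integral_shift[of "indicator (U - A) :: real \<Rightarrow> real" "X n"]
        by (simp add: algebra_simps)
      also have "\<dots> \<le> ?H n + 2 * \<bar>c\<bar> * d" using mD by (intro add_left_mono mult_left_mono) auto
      also have "\<dots> \<le> ?H n + e" using d(2) by simp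
      finally show ?thesis .
    qed
    ultimately show "\<exists>H. H \<longlonglongrightarrow> 0 \<and> (\<forall>n. 0 \<le> (LINT s|lborel. \<bar>indicator A (s + X n) *\<^sub>R c - indicator A s *\<^sub>R c\<bar>) \<and>
       (LINT s|lborel. \<bar>indicator A (s + X n) *\<^sub>R c - indicator A s *\<^sub>R c\<bar>) \<le> H n + e)"
      by (intro exI[of _ ?H]) auto
  qed
next
  case (add f g)
  show ?case
  proof (rule tendsto_sandwich[OF _ _ tendsto_const])
    show "\<forall>\<^sub>F n in sequentially. (LINT s|lborel. \<bar>f (s + X n) + g (s + X n) - (f s + g s)\<bar>) \<le>
       (LINT s|lborel. \<bar>f (s + X n) - f s\<bar>) + (LINT s|lborel. \<bar>g (s + X n) - g s\<bar>)"
    proof (intro always_eventually allI)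
      fix n
      note int = add.hyps(1)[THEN lborel_integrable_shift[THEN iffD2], of "X n"] add.hyps(1)
        add.hyps(2)[THEN lborel_integrable_shift[THEN iffD2], of "X n"] add.hyps(2)
      have "(LINT s|lborel. \<bar>f (s + X n) + g (s + X n) - (f s + g s)\<bar>) \<le>
       (LINT s|lborel. \<bar>f (s + X n) - f s\<bar> + \<bar>g (s + X n) - g s\<bar>)"
        using int by (intro integral_mono) auto
      then show "(LINT s|lborel. \<bar>f (s + X n) + g (s + X n) - (f s + g s)\<bar>) \<le>
       (LINT s|lborel. \<bar>f (s + X n) - f s\<bar>) + (LINT s|lborel. \<bar>g (s + X n) - g s\<bar>)"
        using int by simp
    qed
    show "(\<lambda>n. (LINT s|lborel. \<bar>f (s + X n) - f s\<bar>) + (LINT s|lborel. \<bar>g (s + X n) - g s\<bar>)) \<longlonglongrightarrow> 0"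
      using tendsto_add[OF add.IH] by simp
  qed simp
next
  case (lim f S)
  \<comment> \<open>The dominating function is 3 |f|, because the approximants of the induction rule
    satisfy |S i s| <= 2 |f s|.\<close>
  have lim0: "(\<lambda>i. LINT s|lborel. \<bar>f s - S i s\<bar>) \<longlonglongrightarrow> (LINT s|(lborel::real measure). 0)"
  proof (rule integral_dominated_convergence[where w="\<lambda>s. 3 * \<bar>f s\<bar>"])
    show "AE s in lborel. (\<lambda>i. \<bar>f s - S i s\<bar>) \<longlonglongrightarrow> 0"
    proof (rule AE_I2)
      fix s :: real
      have "(\<lambda>i. S i s) \<longlonglongrightarrow> f s" using lim.hyps(2)[of s] by simp
      from tendsto_rabs[OF tendsto_diff[OF tendsto_const[of "f s"] this]]
      show "(\<lambda>i. \<bar>f s - S i s\<bar>) \<longlonglongrightarrow> 0" by simp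
    qed
    show "AE s in lborel. norm \<bar>f s - S i s\<bar> \<le> 3 * \<bar>f s\<bar>" for i
    proof (rule AE_I2)
      fix s :: real
      have "\<bar>S i s\<bar> \<le> 2 * \<bar>f s\<bar>" using lim.hyps(3)[of s i] by simp
      then show "norm \<bar>f s - S i s\<bar> \<le> 3 * \<bar>f s\<bar>" by simp
    qed
  qed (use lim.hyps(1,4) in auto)
  show ?case
  proof (rule tendsto_zero_approx)
    fix e :: real assume "e > 0"
    have "\<forall>\<^sub>F i in sequentially. (LINT s|lborel. \<bar>f s - S i s\<bar>) < e / 2"
      using order_tendstoD(2)[OF lim0, of "e / 2"] \<open>e > 0\<close> by simp
    then obtain i where i: "(LINT s|lborel. \<bar>f s - S i s\<bar>) < e / 2"
      by (auto simp: eventually_sequentially)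
    have "(LINT s|lborel. \<bar>f (s + X n) - f s\<bar>) \<le> (LINT s|lborel. \<bar>S i (s + X n) - S i s\<bar>) + e" for n
    proof -
      note int = lim.hyps(1)[of i, THEN lborel_integrable_shift[THEN iffD2], of "X n"] lim.hyps(1)[of i]
         lim.hyps(4)[THEN lborel_integrable_shift[THEN iffD2], of "X n"] lim.hyps(4)
      have "(LINT s|lborel. \<bar>f (s + X n) - f s\<bar>) \<le>
        (LINT s|lborel. \<bar>f (s + X n) - S i (s + X n)\<bar> + \<bar>S i (s + X n) - S i s\<bar> + \<bar>f s - S i s\<bar>)"
        using int by (intro integral_mono) auto
      also have "\<dots> = (LINT s|lborel. \<bar>f (s + X n) - S i (s + X n)\<bar>) + (LINT s|lborel. \<bar>S i (s + X n) - S i s\<bar>)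
         + (LINT s|lborel. \<bar>f s - S i s\<bar>)"
        using int by simp
      also have "(LINT s|lborel. \<bar>f (s + X n) - S i (s + X n)\<bar>) = (LINT s|lborel. \<bar>f s - S i s\<bar>)"
        by (rule lborel_integral_shift)
      finally show ?thesis using i by simp
    qed
    then show "\<exists>H. H \<longlonglongrightarrow> 0 \<and> (\<forall>n. 0 \<le> (LINT s|lborel. \<bar>f (s + X n) - f s\<bar>) \<and>
       (LINT s|lborel. \<bar>f (s + X n) - f s\<bar>) \<le> H n + e)"
      using lim.IH[of i] by (intro exI[of _ "\<lambda>n. LINT s|lborel. \<bar>S i (s + X n) - S i s\<bar>"]) auto
  qed
qed

text \<open>Truncation at height k turns squares into first powers: two values of \<open>g k\<close>
  differ by at most 2k, so the square of the difference is at most 2k times its modulus, and the L1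
  case applies. The truncation error is small in L2 by dominated convergence.\<close>

lemma L2_translation:
  fixes f :: "real \<Rightarrow> real" and X :: "nat \<Rightarrow> real"
  assumes f: "integrable lborel f" and f2: "integrable lborel (\<lambda>t. (f t)\<^sup>2)" and X: "X \<longlonglongrightarrow> 0"
  shows "(\<lambda>n. LINT s|lborel. (f (s + X n) - f s)\<^sup>2) \<longlonglongrightarrow> 0"
proof -
  have [measurable]: "f \<in> borel_measurable borel" using f by auto
  define g where "g k s = max (- real k) (min (real k) (f s))" for k :: nat and s
  have g_le: "\<bar>g k s\<bar> \<le> \<bar>f s\<bar>" "\<bar>g k s\<bar> \<le> k" "\<bar>f s - g k s\<bar> \<le> \<bar>f s\<bar>" for k s
    by (auto simp: g_def)
  have [measurable]: "g k \<in> borel_measurable borel" for k unfolding g_def by measurable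
  have gi: "integrable lborel (g k)" for k
    by (rule Bochner_Integration.integrable_bound[OF f]) (use g_le(1) in auto)
  have di: "integrable lborel (\<lambda>s. (f s - g k s)\<^sup>2)" for k
    by (rule Bochner_Integration.integrable_bound[OF f2]) (use g_le(3) in \<open>auto simp: abs_le_square_iff\<close>)
  have lim0: "(\<lambda>k. LINT s|lborel. (f s - g k s)\<^sup>2) \<longlonglongrightarrow> (LINT s|(lborel::real measure). 0)"
  proof (rule integral_dominated_convergence[where w="\<lambda>s. (f s)\<^sup>2"])
    show "AE s in lborel. (\<lambda>k. (f s - g k s)\<^sup>2) \<longlonglongrightarrow> 0"
    proof (rule AE_I2)
      fix s
      obtain N :: nat where N: "\<bar>f s\<bar> \<le> N" using real_arch_simple by blast
      have "\<forall>\<^sub>F k in sequentially. (f s - g k s)\<^sup>2 = 0"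
        using eventually_ge_at_top[of N] by eventually_elim (use N in \<open>auto simp: g_def\<close>)
      then show "(\<lambda>k. (f s - g k s)\<^sup>2) \<longlonglongrightarrow> 0" by (rule tendsto_eventually)
    qed
    show "AE s in lborel. norm ((f s - g k s)\<^sup>2) \<le> (f s)\<^sup>2" for k
      using g_le(3) by (auto simp: abs_le_square_iff)
  qed (use f2 in auto)
  show ?thesis
  proof (rule tendsto_zero_approx)
    fix e :: real assume "e > 0"
    have "\<forall>\<^sub>F k in sequentially. (LINT s|lborel. (f s - g k s)\<^sup>2) < e / 6"
      using order_tendstoD(2)[OF lim0, of "e / 6"] \<open>e > 0\<close> by simp
    then obtain k where k: "(LINT s|lborel. (f s - g k s)\<^sup>2) < e / 6"
      by (auto simp: eventually_sequentially)
    \<comment> \<open>The factor 6k is 2k times the 3 from (p + q - r)^2 <= 3 (p^2 + q^2 + r^2). The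
      truncation error occurs twice with that factor 3, and translation does not change its
      integral, which explains \<open>e / 6\<close> above.\<close>
    let ?H = "\<lambda>n. 6 * k * (LINT s|lborel. \<bar>g k (s + X n) - g k s\<bar>)"
    have "?H \<longlonglongrightarrow> 0"
      using tendsto_mult[OF tendsto_const L1_translation[OF gi X]] by simp
    moreover have "(LINT s|lborel. (f (s + X n) - f s)\<^sup>2) \<le> ?H n + e" for n
    proof -
      have int: "integrable lborel (\<lambda>s. (f (s + X n) - g k (s + X n))\<^sup>2)"
         "integrable lborel (\<lambda>s. (f s - g k s)\<^sup>2)"
         "integrable lborel (\<lambda>s. 2 * real k * \<bar>g k (s + X n) - g k s\<bar>)"
        using lborel_integrable_shift[of "\<lambda>s. (f s - g k s)\<^sup>2" "X n"] lborel_integrable_shift[of "g k" "X n"]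
          di gi[of k]
        by auto
      have "(LINT s|lborel. (f (s + X n) - f s)\<^sup>2) \<le>
        (LINT s|lborel. 3 * ((f (s + X n) - g k (s + X n))\<^sup>2 + 2 * real k * \<bar>g k (s + X n) - g k s\<bar>
           + (f s - g k s)\<^sup>2))"
      proof (rule integral_mono')
        show "integrable lborel (\<lambda>s. 3 * ((f (s + X n) - g k (s + X n))\<^sup>2 + 2 * real k * \<bar>g k (s + X n) - g k s\<bar>
           + (f s - g k s)\<^sup>2))"
          using int by auto
        fix s
        have *: "(p + q - r)\<^sup>2 \<le> 3 * (p\<^sup>2 + q\<^sup>2 + r\<^sup>2)" for p q r :: real
          using sum_squares_bound[of p q] sum_squares_bound[of p "-r"] sum_squares_bound[of q "-r"]
          by (simp add: power2_eq_square algebra_simps)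
        have "(g k (s + X n) - g k s)\<^sup>2 = \<bar>g k (s + X n) - g k s\<bar> * \<bar>g k (s + X n) - g k s\<bar>"
          by (simp add: power2_eq_square)
        also have "\<dots> \<le> (2 * real k) * \<bar>g k (s + X n) - g k s\<bar>"
          using g_le(2)[of k s] g_le(2)[of k "s + X n"] by (intro mult_right_mono) auto
        finally have **: "(g k (s + X n) - g k s)\<^sup>2 \<le> 2 * real k * \<bar>g k (s + X n) - g k s\<bar>" .
        have "(f (s + X n) - f s)\<^sup>2 = ((f (s + X n) - g k (s + X n)) + (g k (s + X n) - g k s) - (f s - g k s))\<^sup>2"
          by simp
        also have "\<dots> \<le> 3 * ((f (s + X n) - g k (s + X n))\<^sup>2 + (g k (s + X n) - g k s)\<^sup>2 + (f s - g k s)\<^sup>2)"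
          by (rule *)
        finally show "(f (s + X n) - f s)\<^sup>2 \<le>
          3 * ((f (s + X n) - g k (s + X n))\<^sup>2 + 2 * real k * \<bar>g k (s + X n) - g k s\<bar> + (f s - g k s)\<^sup>2)"
          using ** by (smt (verit))
      qed simp
      also have "\<dots> = 3 * ((LINT s|lborel. (f (s + X n) - g k (s + X n))\<^sup>2) + (LINT s|lborel. 2 * real k * \<bar>g k (s + X n) - g k s\<bar>)
           + (LINT s|lborel. (f s - g k s)\<^sup>2))"
        using int by (simp only: integral_mult_right_zero Bochner_Integration.integral_add
          Bochner_Integration.integrable_add)
      also have "\<dots> = ?H n + 6 * (LINT s|lborel. (f s - g k s)\<^sup>2)"
        using lborel_integral_shift[of "\<lambda>s. (f s - g k s)\<^sup>2" "X n"] by simp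
      finally show ?thesis using k by simp
    qed
    ultimately show "\<exists>H. H \<longlonglongrightarrow> 0 \<and> (\<forall>n. 0 \<le> (LINT s|lborel. (f (s + X n) - f s)\<^sup>2) \<and>
       (LINT s|lborel. (f (s + X n) - f s)\<^sup>2) \<le> H n + e)"
      by (intro exI[of _ ?H]) auto
  qed
qed

section \<open>Plancherel's identity\<close>

text \<open>The exponent has the sign of \<open>gT\<close>, opposite to that of
  \<open>fourier\<close>. There is no normalizing constant, hence the factor \<open>2 * pi\<close>
  in \<open>Plancherel\<close>.\<close>

definition ft :: "(real \<Rightarrow> real) \<Rightarrow> real \<Rightarrow> complex" where
  "ft f l = (LINT t|lborel. cis (l * t) * complex_of_real (f t))"

text \<open>Convolution of \<open>f\<close> with its reflection: its transform is the squared
  modulus of \<open>ft f\<close>, and its value at 0 is the squared norm of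
  \<open>f\<close>.\<close>

definition autocor :: "(real \<Rightarrow> real) \<Rightarrow> real \<Rightarrow> real" where
  "autocor f x = (LINT s|lborel. f s * f (s + x))"

lemma cis_measurable [measurable]: "cis \<in> borel_measurable borel"
  by (intro borel_measurable_continuous_onI continuous_intros)

lemma integrable_cis_mult:
  assumes f: "integrable lborel f"
  shows "integrable lborel (\<lambda>t. cis (l * t) * complex_of_real (f t))"
proof (rule Bochner_Integration.integrable_bound[OF f])
  have [measurable]: "f \<in> borel_measurable borel" using f by auto
  show "(\<lambda>t. cis (l * t) * complex_of_real (f t)) \<in> borel_measurable lborel" by measurable
qed (auto simp: norm_mult)

lemma ft_measurable [measurable]:
  assumes [measurable]: "f \<in> borel_measurable borel"
  shows "ft f \<in> borel_measurable borel"
  unfolding ft_def[abs_def] by measurable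

lemma cnj_ft: "cnj (ft f l) = (LINT t|lborel. cis (- (l * t)) * complex_of_real (f t))"
  unfolding ft_def by (subst Bochner_Integration.integral_cnj[symmetric]) (simp add: cis_cnj)

context
  fixes f :: "real \<Rightarrow> real"
  assumes f: "integrable lborel f" and f2: "integrable lborel (\<lambda>t. (f t)\<^sup>2)"
begin

private lemma f_meas: "f \<in> borel_measurable borel"
  using f by auto

private lemma sqf: "sq_integrable lborel f" "sq_integrable lborel (\<lambda>s. f (s + x))"
  using f2 lborel_integrable_shift[of "\<lambda>s. (f s)\<^sup>2" x] f_meas by (auto simp: sq_integrable_def)

lemma autocor_measurable: "autocor f \<in> borel_measurable borel"
  unfolding autocor_def[abs_def] using f_meas by measurable

lemma autocor_bound: "\<bar>autocor f x\<bar> \<le> (LINT s|lborel. (f s)\<^sup>2)"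
proof -
  have "\<bar>autocor f x\<bar> \<le> sqrt (LINT s|lborel. (f s)\<^sup>2) * sqrt (LINT s|lborel. (f (s + x))\<^sup>2)"
    unfolding autocor_def by (rule sq_integrable_Cauchy_Schwarz[OF sqf])
  also have "(LINT s|lborel. (f (s + x))\<^sup>2) = (LINT s|lborel. (f s)\<^sup>2)"
    by (rule lborel_integral_shift)
  finally show ?thesis by simp
qed

lemma integrable_autocor_kernel:
  "integrable (lborel \<Otimes>\<^sub>M lborel) (\<lambda>(s, x). cis (l * x) * complex_of_real (f s * f (s + x)))"
proof (rule lborel_pair.Fubini_integrable)
  note [measurable] = f_meas
  show "(\<lambda>(s, x). cis (l * x) * complex_of_real (f s * f (s + x))) \<in> borel_measurable (lborel \<Otimes>\<^sub>M lborel)"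
    by measurable
  have i: "integrable lborel (\<lambda>x. f (s + x))" for s
    using lborel_integrable_shift[of f s] f by (simp add: add.commute)
  have "(LINT x|lborel. norm (cis (l * x) * complex_of_real (f s * f (s + x)))) = \<bar>f s\<bar> * (LINT x|lborel. \<bar>f x\<bar>)" for s
    using lborel_integral_shift[of "\<lambda>x. \<bar>f x\<bar>" s] by (simp add: norm_mult abs_mult add.commute)
  then show "integrable lborel (\<lambda>s. LINT x|lborel. norm (case (s, x) of (s, x) \<Rightarrow> cis (l * x) * complex_of_real (f s * f (s + x))))"
    using f by simp
  show "AE s in lborel. integrable lborel (\<lambda>x. case (s, x) of (s, x) \<Rightarrow> cis (l * x) * complex_of_real (f s * f (s + x)))"
    using i by (auto intro!: AE_I2 integrable_cis_mult simp del: of_real_mult)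
qed

lemma integrable_autocor: "integrable lborel (autocor f)"
proof -
  have "integrable lborel (\<lambda>x. LINT s|lborel. complex_of_real (f s * f (s + x)))"
    using lborel_pair.integrable_snd[OF integrable_autocor_kernel[of 0]] by simp
  then have "integrable lborel (\<lambda>x. complex_of_real (autocor f x))"
    by (simp add: autocor_def[abs_def] del: of_real_mult)
  then show ?thesis by (simp only: complex_of_real_integrable_eq)
qed

lemma ft_mult_cnj: "ft f l * cnj (ft f l) = ft (autocor f) l"
proof -
  have "ft f l * cnj (ft f l) = (LINT s|lborel. cis (- (l * s)) * complex_of_real (f s) * ft f l)"
    unfolding cnj_ft using integrable_cis_mult[OF f, of "-l"] by (simp add: mult.commute)
  also have "\<dots> = (LINT s|lborel. (LINT x|lborel. cis (l * x) * complex_of_real (f s * f (s + x))))"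
  proof (intro Bochner_Integration.integral_cong refl)
    fix s
    have "ft f l = (LINT x|lborel. cis (l * (x + s)) * complex_of_real (f (x + s)))"
      unfolding ft_def by (rule lborel_integral_shift[symmetric])
    also have "cis (- (l * s)) * complex_of_real (f s) * \<dots> =
       (LINT x|lborel. cis (- (l * s)) * complex_of_real (f s) * (cis (l * (x + s)) * complex_of_real (f (x + s))))"
      by (rule integral_mult_right_zero[symmetric])
    also have "\<dots> = (LINT x|lborel. cis (l * x) * complex_of_real (f s * f (s + x)))"
    proof (intro Bochner_Integration.integral_cong refl)
      fix x
      have "cis (- (l * s)) * cis (l * (x + s)) = cis (l * x)"
        by (simp add: cis_mult algebra_simps)
      then show "cis (- (l * s)) * complex_of_real (f s) * (cis (l * (x + s)) * complex_of_real (f (x + s))) =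
         cis (l * x) * complex_of_real (f s * f (s + x))"
        by (simp add: algebra_simps)
    qed
    finally show "cis (- (l * s)) * complex_of_real (f s) * ft f l = (LINT x|lborel. cis (l * x) * complex_of_real (f s * f (s + x)))" .
  qed
  also have "\<dots> = (LINT x|lborel. (LINT s|lborel. cis (l * x) * complex_of_real (f s * f (s + x))))"
    using lborel_pair.Fubini_integral[OF integrable_autocor_kernel[of l]] by simp
  also have "\<dots> = ft (autocor f) l"
    by (simp add: ft_def autocor_def del: of_real_mult)
  finally show ?thesis .
qed

text \<open>The autocorrelation at x falls short of the squared norm by half the squared L2 distance
  between \<open>f\<close> and its translate, so continuity at 0 is
  \<open>L2_translation\<close>.\<close>

lemma autocor_tendsto:
  assumes X: "X \<longlonglongrightarrow> 0"
  shows "(\<lambda>n. autocor f (X n)) \<longlonglongrightarrow> (LINT s|lborel. (f s)\<^sup>2)"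
proof -
  have "autocor f x = (LINT s|lborel. (f s)\<^sup>2) - (LINT s|lborel. (f (s + x) - f s)\<^sup>2) / 2" for x
  proof -
    have "(LINT s|lborel. (f (s + x) - f s)\<^sup>2) = (LINT s|lborel. (f (s + x))\<^sup>2 + (f s)\<^sup>2 - 2 * (f s * f (s + x)))"
      by (intro Bochner_Integration.integral_cong) (auto simp: power2_eq_square algebra_simps)
    also have "\<dots> = (LINT s|lborel. (f (s + x))\<^sup>2) + (LINT s|lborel. (f s)\<^sup>2) - 2 * autocor f x"
      using sq_integrable_square[OF sqf(1)] sq_integrable_square[OF sqf(2)[of x]] sq_integrable_mult[OF sqf(1) sqf(2)[of x]]
      by (simp add: autocor_def)
    also have "(LINT s|lborel. (f (s + x))\<^sup>2) = (LINT s|lborel. (f s)\<^sup>2)"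
      by (rule lborel_integral_shift)
    finally show ?thesis by (simp add: field_simps)
  qed
  then show ?thesis
    using tendsto_diff[OF tendsto_const[of "LINT s|lborel. (f s)\<^sup>2"] tendsto_divide[OF L2_translation[OF f f2 X] tendsto_const[of 2]]]
    by simp
qed

text \<open>Gaussian cutoff: by \<open>wt_eq\<close> it increases to 1 with n, and its transform is
  2 pi times the normal density with standard deviation 1 / (n + 1), which concentrates at 0.
  Writing it as a density gives access to the characteristic function of the normal law.\<close>

private definition wt :: "nat \<Rightarrow> real \<Rightarrow> real" where
  "wt n l = sqrt (2 * pi) * std_normal_density (l / real (Suc n))"

private lemma wt_eq: "wt n l = exp (- (l / real (Suc n))\<^sup>2 / 2)"
  by (simp add: wt_def std_normal_density_def)

private lemma wt_measurable [measurable]: "wt n \<in> borel_measurable borel"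
  unfolding wt_def[abs_def] by measurable

private lemma integrable_wt: "integrable lborel (wt n)"
  unfolding wt_def[abs_def]
  using lborel_integrable_real_affine[of std_normal_density "1 / real (Suc n)" 0]
  by (intro integrable_mult_right) (simp add: integrable_normal_density)

private lemma wt_ft: "(LINT l|lborel. cis (l * x) * complex_of_real (wt n l)) =
   complex_of_real (2 * pi * real (Suc n) * std_normal_density (real (Suc n) * x))"
proof -
  let ?m = "real (Suc n)"
  have "(LINT l|lborel. cis (l * x) * complex_of_real (wt n l)) =
     ?m *\<^sub>R (LINT y|lborel. cis (?m * y * x) * complex_of_real (wt n (?m * y)))"
    using lborel_integral_real_affine[of ?m "\<lambda>l. cis (l * x) * complex_of_real (wt n l)" 0] by simp
  also have "(LINT y|lborel. cis (?m * y * x) * complex_of_real (wt n (?m * y))) =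
     complex_of_real (sqrt (2 * pi)) * (LINT y|lborel. std_normal_density y *\<^sub>R iexp ((?m * x) * y))"
    by (subst integral_mult_right_zero[symmetric], intro Bochner_Integration.integral_cong)
      (simp_all add: wt_def cis_conv_exp scaleR_conv_of_real mult_ac del: of_nat_Suc)
  also have "(LINT y|lborel. std_normal_density y *\<^sub>R iexp ((?m * x) * y)) = char std_normal_distribution (?m * x)"
    unfolding char_def by (subst integral_density) auto
  also have "\<dots> = complex_of_real (exp (- (?m * x)\<^sup>2 / 2))"
    by (simp add: char_std_normal_distribution)
  also have "exp (- (?m * x)\<^sup>2 / 2) = sqrt (2 * pi) * std_normal_density (?m * x)"
    by (simp add: std_normal_density_def)
  finally have "(LINT l|lborel. cis (l * x) * complex_of_real (wt n l)) =
     complex_of_real (?m * (sqrt (2 * pi) * sqrt (2 * pi)) * std_normal_density (?m * x))"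
    by (simp only: scaleR_conv_of_real of_real_mult[symmetric] mult.assoc)
  also have "sqrt (2 * pi) * sqrt (2 * pi) = 2 * pi" by simp
  finally show ?thesis by (simp only: mult_ac)
qed

text \<open>Fubini moves the transform from \<open>autocor f\<close> to the weight, and x = y / (n +
  1) makes the normal density standard.\<close>

private lemma wt_integral:
  "(LINT l|lborel. (cmod (ft f l))\<^sup>2 * wt n l) =
    2 * pi * (LINT y|lborel. autocor f (y / real (Suc n)) * std_normal_density y)"
  and wt_integrable: "integrable lborel (\<lambda>l. (cmod (ft f l))\<^sup>2 * wt n l)"
proof -
  let ?m = "real (Suc n)"
  note [measurable] = f_meas autocor_measurable
  let ?k = "\<lambda>(l, x). cis (l * x) * complex_of_real (autocor f x * wt n l)"
  have eq: "complex_of_real ((cmod (ft f l))\<^sup>2 * wt n l) = (LINT x|lborel. ?k (l, x))" for l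
  proof -
    have "complex_of_real ((cmod (ft f l))\<^sup>2 * wt n l) = ft (autocor f) l * complex_of_real (wt n l)"
      by (simp only: of_real_mult complex_norm_square ft_mult_cnj)
    also have "\<dots> = (LINT x|lborel. cis (l * x) * complex_of_real (autocor f x) * complex_of_real (wt n l))"
      unfolding ft_def by (rule integral_mult_left_zero[symmetric])
    finally show ?thesis by (simp add: mult.assoc)
  qed
  have kint: "integrable (lborel \<Otimes>\<^sub>M lborel) ?k"
  proof (rule lborel_pair.Fubini_integrable)
    show "?k \<in> borel_measurable (lborel \<Otimes>\<^sub>M lborel)" by measurable
    have "(LINT x|lborel. norm (?k (l, x))) = wt n l * (LINT x|lborel. \<bar>autocor f x\<bar>)" for l
    proof -
      have "(LINT x|lborel. norm (?k (l, x))) = (LINT x|lborel. wt n l * \<bar>autocor f x\<bar>)"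
        by (intro Bochner_Integration.integral_cong) (auto simp: norm_mult abs_mult wt_eq)
      then show ?thesis by simp
    qed
    then show "integrable lborel (\<lambda>l. LINT x|lborel. norm (?k (l, x)))"
      using integrable_wt by simp
    show "AE l in lborel. integrable lborel (\<lambda>x. ?k (l, x))"
      using integrable_autocor by (auto intro!: AE_I2 integrable_cis_mult simp del: of_real_mult)
  qed
  have "integrable lborel (\<lambda>l. LINT x|lborel. ?k (l, x))"
    by (rule lborel_pair.integrable_fst'[OF kint])
  then have "integrable lborel (\<lambda>l. complex_of_real ((cmod (ft f l))\<^sup>2 * wt n l))"
    by (simp only: eq)
  then show i: "integrable lborel (\<lambda>l. (cmod (ft f l))\<^sup>2 * wt n l)"
    by (simp only: complex_of_real_integrable_eq)
  have "complex_of_real (LINT l|lborel. (cmod (ft f l))\<^sup>2 * wt n l) = (LINT l|lborel. (LINT x|lborel. ?k (l, x)))"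
    by (simp only: eq[symmetric] integral_complex_of_real)
  also have "\<dots> = (LINT x|lborel. (LINT l|lborel. ?k (l, x)))"
    using lborel_pair.Fubini_integral[of "\<lambda>l x. ?k (l, x)"] kint by (simp add: case_prod_beta)
  also have "\<dots> = (LINT x|lborel. complex_of_real (autocor f x) * (LINT l|lborel. cis (l * x) * complex_of_real (wt n l)))"
    by (intro Bochner_Integration.integral_cong refl)
      (simp only: integral_mult_right_zero[symmetric] case_prod_conv of_real_mult mult_ac)
  also have "\<dots> = (LINT x|lborel. complex_of_real (2 * pi * (autocor f x * (?m * std_normal_density (?m * x)))))"
    unfolding wt_ft by (intro Bochner_Integration.integral_cong refl) simp
  finally have "(LINT l|lborel. (cmod (ft f l))\<^sup>2 * wt n l) =
     2 * pi * (LINT x|lborel. autocor f x * (?m * std_normal_density (?m * x)))"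
    unfolding integral_complex_of_real of_real_eq_iff by simp
  also have "(LINT x|lborel. autocor f x * (?m * std_normal_density (?m * x))) =
     (LINT y|lborel. autocor f (y / ?m) * std_normal_density y)"
    using lborel_integral_real_affine[of "1 / ?m" "\<lambda>x. autocor f x * (?m * std_normal_density (?m * x))" 0]
    by (simp add: mult.assoc[symmetric] del: of_nat_Suc) (simp add: mult.commute mult.left_commute del: of_nat_Suc)
  finally show "(LINT l|lborel. (cmod (ft f l))\<^sup>2 * wt n l) =
    2 * pi * (LINT y|lborel. autocor f (y / ?m) * std_normal_density y)" .
qed

text \<open>\<open>wt_integral\<close> is taken to the limit on both sides: on the right by
  dominated convergence, since \<open>autocor f\<close> is continuous at 0 and bounded by its value
  there; on the left by monotone convergence, which yields integrability at the same time.\<close>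

theorem Plancherel:
  "integrable lborel (\<lambda>l. (cmod (ft f l))\<^sup>2)" "(LINT l|lborel. (cmod (ft f l))\<^sup>2) = 2 * pi * (LINT s|lborel. (f s)\<^sup>2)"
proof -
  note [measurable] = f_meas autocor_measurable
  have std: "integrable lborel std_normal_density" by (simp add: integrable_normal_density)
  have "(\<lambda>n. LINT y|lborel. autocor f (y / real (Suc n)) * std_normal_density y) \<longlonglongrightarrow>
     (LINT y|lborel. (LINT s|lborel. (f s)\<^sup>2) * std_normal_density y)"
  proof (rule integral_dominated_convergence[where w="\<lambda>y. (LINT s|lborel. (f s)\<^sup>2) * std_normal_density y"])
    show "AE y in lborel. (\<lambda>n. autocor f (y / real (Suc n)) * std_normal_density y) \<longlonglongrightarrow>
       (LINT s|lborel. (f s)\<^sup>2) * std_normal_density y"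
    proof (rule AE_I2)
      fix y :: real
      have "(\<lambda>n. y / real (Suc n)) \<longlonglongrightarrow> 0"
        using tendsto_mult[OF tendsto_const[of y] LIMSEQ_inverse_real_of_nat] by (simp add: divide_inverse)
      then show "(\<lambda>n. autocor f (y / real (Suc n)) * std_normal_density y) \<longlonglongrightarrow>
       (LINT s|lborel. (f s)\<^sup>2) * std_normal_density y"
        by (intro tendsto_mult autocor_tendsto tendsto_const)
    qed
    show "AE y in lborel. norm (autocor f (y / real (Suc n)) * std_normal_density y) \<le>
       (LINT s|lborel. (f s)\<^sup>2) * std_normal_density y" for n
      using autocor_bound by (auto simp: abs_mult intro!: AE_I2 mult_right_mono)
  qed (use std in auto)
  also have "(LINT y|lborel. (LINT s|lborel. (f s)\<^sup>2) * std_normal_density y) = (LINT s|lborel. (f s)\<^sup>2)"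
    by (simp add: integral_normal_density)
  finally have lim: "(\<lambda>n. LINT l|lborel. (cmod (ft f l))\<^sup>2 * wt n l) \<longlonglongrightarrow> 2 * pi * (LINT s|lborel. (f s)\<^sup>2)"
    unfolding wt_integral by (intro tendsto_mult tendsto_const)
  have mono: "mono (\<lambda>n. (cmod (ft f l))\<^sup>2 * wt n l)" for l
  proof (intro monoI mult_left_mono)
    fix m n :: nat assume mn: "m \<le> n"
    have "\<bar>l / real (Suc n)\<bar> \<le> \<bar>l / real (Suc m)\<bar>"
      using mn by (auto simp: abs_divide intro!: divide_left_mono)
    then have "(l / real (Suc n))\<^sup>2 \<le> (l / real (Suc m))\<^sup>2"
      by (simp only: abs_le_square_iff)
    then show "wt m l \<le> wt n l" by (simp add: wt_eq)
  qed simp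
  have pt: "(\<lambda>n. (cmod (ft f l))\<^sup>2 * wt n l) \<longlonglongrightarrow> (cmod (ft f l))\<^sup>2" for l
  proof -
    have "(\<lambda>n. l / real (Suc n)) \<longlonglongrightarrow> 0"
      using tendsto_mult[OF tendsto_const[of l] LIMSEQ_inverse_real_of_nat] by (simp add: divide_inverse)
    then have "(\<lambda>n. exp (- (l / real (Suc n))\<^sup>2 / 2)) \<longlonglongrightarrow> exp (- (0\<^sup>2) / 2)"
      by (intro tendsto_intros) auto
    then show ?thesis
      using tendsto_mult[OF tendsto_const[of "(cmod (ft f l))\<^sup>2"]] by (fastforce simp: wt_eq)
  qed
  note res = integral_monotone_convergence_nonneg[OF wt_integrable _ _ _ lim]
  show "integrable lborel (\<lambda>l. (cmod (ft f l))\<^sup>2)"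
    by (rule res(1)) (use mono pt in \<open>auto simp: wt_eq\<close>)
  show "(LINT l|lborel. (cmod (ft f l))\<^sup>2) = 2 * pi * (LINT s|lborel. (f s)\<^sup>2)"
    by (rule res(2)) (use mono pt in \<open>auto simp: wt_eq\<close>)
qed

end

section \<open>Gaussian laws and the continuity theorem in several dimensions\<close>

text \<open>Completing the square in one coordinate \<open>i\<close>: what remains on
  \<open>S\<close> is the form of a Schur complement, again nonnegative, to which the induction
  hypothesis applies. A zero diagonal entry is a separate case, with nothing to divide by.\<close>

lemma nonneg_quadratic_form_sum_squares:
  fixes \<sigma> :: "'q \<Rightarrow> 'q \<Rightarrow> real"
  assumes "finite S" and "\<And>j l. \<sigma> j l = \<sigma> l j"
    and "\<And>u. 0 \<le> (\<Sum>j\<in>S. \<Sum>l\<in>S. \<sigma> j l * u j * u l)"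
  shows "\<exists>v. \<forall>u. (\<Sum>j\<in>S. \<Sum>l\<in>S. \<sigma> j l * u j * u l) = (\<Sum>k\<in>S. (\<Sum>j\<in>S. v k j * u j)\<^sup>2)"
  using assms
proof (induction S arbitrary: \<sigma> rule: finite_induct)
  case (insert i S)
  define m where "m u = (\<Sum>j\<in>S. \<sigma> i j * u j)" for u
  have Q: "(\<Sum>j\<in>insert i S. \<Sum>l\<in>insert i S. \<sigma> j l * u j * u l) =
      \<sigma> i i * (u i)\<^sup>2 + 2 * u i * m u + (\<Sum>j\<in>S. \<Sum>l\<in>S. \<sigma> j l * u j * u l)" for u
  proof -
    have "(\<Sum>j\<in>insert i S. \<Sum>l\<in>insert i S. \<sigma> j l * u j * u l) =
      \<sigma> i i * u i * u i + (\<Sum>l\<in>S. \<sigma> i l * u i * u l) + ((\<Sum>j\<in>S. \<sigma> j i * u j * u i) + (\<Sum>j\<in>S. \<Sum>l\<in>S. \<sigma> j l * u j * u l))"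
      using insert.hyps by (simp add: sum.distrib)
    also have "(\<Sum>l\<in>S. \<sigma> i l * u i * u l) = u i * m u"
      by (simp add: m_def sum_distrib_left mult_ac)
    also have "(\<Sum>j\<in>S. \<sigma> j i * u j * u i) = u i * m u"
      by (simp add: m_def sum_distrib_left mult_ac insert.prems(1)[of _ i])
    finally show ?thesis by (simp add: power2_eq_square)
  qed
  have upd: "m (u(i := c)) = m u"
     "(\<Sum>j\<in>S. \<Sum>l\<in>S. \<sigma> j l * (u(i := c)) j * (u(i := c)) l) = (\<Sum>j\<in>S. \<Sum>l\<in>S. \<sigma> j l * u j * u l)" for u c
    using insert.hyps by (auto simp: m_def intro!: sum.cong)
  have pos: "0 \<le> \<sigma> i i * c\<^sup>2 + 2 * c * m u + (\<Sum>j\<in>S. \<Sum>l\<in>S. \<sigma> j l * u j * u l)" for c u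
    using insert.prems(2)[of "u(i := c)"] unfolding Q upd by simp
  have "0 \<le> \<sigma> i i" using pos[of 1 "\<lambda>_. 0"] by (simp add: m_def)
  then consider "\<sigma> i i = 0" | "\<sigma> i i > 0" by linarith
  then show ?case
  proof cases
    case 1
    have m0: "m u = 0" for u
    proof (rule ccontr)
      assume "m u \<noteq> 0"
      \<comment> \<open>At c = - (?q + 1) / (2 * m u) the form would be -1; hence with a zero
        diagonal entry the mixed terms vanish.\<close>
      let ?q = "\<Sum>j\<in>S. \<Sum>l\<in>S. \<sigma> j l * u j * u l"
      have "0 \<le> 2 * (- (?q + 1) / (2 * m u)) * m u + ?q"
        using pos[of "- (?q + 1) / (2 * m u)" u] 1 by simp
      also have "2 * (- (?q + 1) / (2 * m u)) * m u = - (?q + 1)"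
        using \<open>m u \<noteq> 0\<close> by simp
      finally show False by simp
    qed
    have "\<exists>v. \<forall>u. (\<Sum>j\<in>S. \<Sum>l\<in>S. \<sigma> j l * u j * u l) = (\<Sum>k\<in>S. (\<Sum>j\<in>S. v k j * u j)\<^sup>2)"
      using pos[of 0] by (intro insert.IH insert.prems(1)) simp
    then obtain v where v: "\<And>u. (\<Sum>j\<in>S. \<Sum>l\<in>S. \<sigma> j l * u j * u l) = (\<Sum>k\<in>S. (\<Sum>j\<in>S. v k j * u j)\<^sup>2)" by blast
    define v' where "v' k j = (if k = i \<or> j = i then 0 else v k j)" for k j
    have "(\<Sum>k\<in>insert i S. (\<Sum>j\<in>insert i S. v' k j * u j)\<^sup>2) = (\<Sum>k\<in>S. (\<Sum>j\<in>S. v k j * u j)\<^sup>2)" for u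
      using insert.hyps by (simp add: v'_def) (intro sum.cong refl arg_cong[where f="\<lambda>x. x\<^sup>2"], auto)
    then show ?thesis using Q v m0 1 by (intro exI[of _ v']) simp
  next
    case 2
    define \<tau> where "\<tau> j l = \<sigma> j l - \<sigma> i j * \<sigma> i l / \<sigma> i i" for j l
    have \<tau>: "(\<Sum>j\<in>S. \<Sum>l\<in>S. \<tau> j l * u j * u l) = (\<Sum>j\<in>S. \<Sum>l\<in>S. \<sigma> j l * u j * u l) - (m u)\<^sup>2 / \<sigma> i i" for u
    proof -
      have "(\<Sum>j\<in>S. \<Sum>l\<in>S. \<tau> j l * u j * u l) = (\<Sum>j\<in>S. \<Sum>l\<in>S. \<sigma> j l * u j * u l) -
          (\<Sum>j\<in>S. \<Sum>l\<in>S. (\<sigma> i j * u j) * (\<sigma> i l * u l)) / \<sigma> i i"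
        by (simp add: \<tau>_def algebra_simps sum_subtractf sum_divide_distrib)
      also have "(\<Sum>j\<in>S. \<Sum>l\<in>S. (\<sigma> i j * u j) * (\<sigma> i l * u l)) = (m u)\<^sup>2"
        by (simp add: m_def power2_eq_square sum_product)
      finally show ?thesis .
    qed
    have "\<exists>v. \<forall>u. (\<Sum>j\<in>S. \<Sum>l\<in>S. \<tau> j l * u j * u l) = (\<Sum>k\<in>S. (\<Sum>j\<in>S. v k j * u j)\<^sup>2)"
    proof (rule insert.IH)
      show "\<tau> j l = \<tau> l j" for j l using insert.prems(1)[of j l] by (simp add: \<tau>_def mult.commute)
      \<comment> \<open>The value c = - m u / \<sigma> i i minimizes the form over coordinate
        \<open>i\<close>, and the minimum is the form of \<open>\<tau>\<close>.\<close>
      show "0 \<le> (\<Sum>j\<in>S. \<Sum>l\<in>S. \<tau> j l * u j * u l)" for u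
        using pos[of "- m u / \<sigma> i i" u] 2 unfolding \<tau> by (simp add: power2_eq_square field_simps)
    qed
    then obtain v where v: "\<And>u. (\<Sum>j\<in>S. \<Sum>l\<in>S. \<tau> j l * u j * u l) = (\<Sum>k\<in>S. (\<Sum>j\<in>S. v k j * u j)\<^sup>2)" by blast
    define v' where "v' k j = (if k = i then \<sigma> i j / sqrt (\<sigma> i i) else if j = i then 0 else v k j)" for k j
    have "(\<Sum>k\<in>insert i S. (\<Sum>j\<in>insert i S. v' k j * u j)\<^sup>2) =
       (\<sigma> i i * u i + m u)\<^sup>2 / \<sigma> i i + (\<Sum>k\<in>S. (\<Sum>j\<in>S. v k j * u j)\<^sup>2)" for u
    proof -
      have "(\<Sum>j\<in>insert i S. v' i j * u j) = (\<sigma> i i * u i + m u) / sqrt (\<sigma> i i)"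
        using insert.hyps by (simp add: v'_def m_def sum_divide_distrib add_divide_distrib)
      then have "(\<Sum>j\<in>insert i S. v' i j * u j)\<^sup>2 = (\<sigma> i i * u i + m u)\<^sup>2 / \<sigma> i i"
        using 2 by (simp add: power_divide)
      moreover have "(\<Sum>k\<in>S. (\<Sum>j\<in>insert i S. v' k j * u j)\<^sup>2) = (\<Sum>k\<in>S. (\<Sum>j\<in>S. v k j * u j)\<^sup>2)"
      proof (rule sum.cong[OF refl], rule arg_cong[where f="\<lambda>x. x\<^sup>2"])
        fix k assume "k \<in> S"
        then show "(\<Sum>j\<in>insert i S. v' k j * u j) = (\<Sum>j\<in>S. v k j * u j)"
          using insert.hyps by (auto simp: v'_def intro!: sum.cong)
      qed
      ultimately show ?thesis using insert.hyps by simp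
    qed
    moreover have "\<sigma> i i * (u i)\<^sup>2 + 2 * u i * m u + q = (\<sigma> i i * u i + m u)\<^sup>2 / \<sigma> i i + (q - (m u)\<^sup>2 / \<sigma> i i)" for u q
      using 2 by (simp add: power2_eq_square field_simps)
    ultimately show ?thesis unfolding Q using v \<tau> by (intro exI[of _ v']) simp
  qed
qed simp

lemma integral_cis_std_normal:
  "(\<integral>x. cis (x * c) \<partial>std_normal_distribution) = complex_of_real (exp (- c\<^sup>2 / 2))"
  using fun_cong[OF char_std_normal_distribution, of c] by (simp add: char_def cis_conv_exp mult.commute)

text \<open>\<open>Sig\<close> is a complex matrix of which only the quadratic form at real vectors
  is prescribed. The symmetrized real part has the same form there. Written as a sum of squares of
  linear forms u . w_k, it is the variance of u . x for x the combination of the vectors w_k with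
  independent standard normal coefficients.\<close>

lemma gaussian_law_exists:
  fixes Sig :: "'q::finite \<Rightarrow> 'q \<Rightarrow> complex"
  assumes sig: "\<And>u::real ^ 'q. \<exists>r::real. 0 \<le> r \<and>
     (\<Sum>j\<in>UNIV. \<Sum>l\<in>UNIV. complex_of_real (u $ j * u $ l) * Sig j l) = complex_of_real r"
  shows "\<exists>N. gaussian_law Sig N"
proof -
  define \<sigma> where "\<sigma> j l = (Re (Sig j l) + Re (Sig l j)) / 2" for j l
  have q: "(\<Sum>j\<in>UNIV. \<Sum>l\<in>UNIV. \<sigma> j l * u j * u l) = Re (\<Sum>j\<in>UNIV. \<Sum>l\<in>UNIV. complex_of_real (u j * u l) * Sig j l)" for u
  proof -
    have "(\<Sum>j\<in>UNIV. \<Sum>l\<in>UNIV. \<sigma> j l * u j * u l) =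
      ((\<Sum>j\<in>UNIV. \<Sum>l\<in>UNIV. u j * u l * Re (Sig j l)) + (\<Sum>j\<in>UNIV. \<Sum>l\<in>UNIV. u j * u l * Re (Sig l j))) / 2"
      unfolding \<sigma>_def sum.distrib[symmetric] sum_divide_distrib by (intro sum.cong refl) (simp add: field_simps)
    also have "(\<Sum>j\<in>UNIV. \<Sum>l\<in>UNIV. u j * u l * Re (Sig l j)) = (\<Sum>l\<in>UNIV. \<Sum>j\<in>UNIV. u j * u l * Re (Sig l j))"
      by (rule sum.swap)
    finally show ?thesis by (simp add: mult.commute)
  qed
  have "\<exists>v. \<forall>u. (\<Sum>j\<in>UNIV. \<Sum>l\<in>UNIV. \<sigma> j l * u j * u l) = (\<Sum>k\<in>(UNIV::'q set). (\<Sum>j\<in>UNIV. v k j * u j)\<^sup>2)"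
  proof (rule nonneg_quadratic_form_sum_squares)
    show "\<sigma> j l = \<sigma> l j" for j l by (simp add: \<sigma>_def)
    show "0 \<le> (\<Sum>j\<in>UNIV. \<Sum>l\<in>UNIV. \<sigma> j l * u j * u l)" for u
    proof -
      obtain r where r: "0 \<le> r" "(\<Sum>j\<in>UNIV. \<Sum>l\<in>UNIV. complex_of_real (u j * u l) * Sig j l) = complex_of_real r"
        using sig[of "\<chi> i. u i"] unfolding vec_lambda_beta by blast
      show ?thesis unfolding q r(2) using r(1) by simp
    qed
  qed simp
  then obtain v where v: "\<And>u. (\<Sum>j\<in>UNIV. \<Sum>l\<in>UNIV. \<sigma> j l * u j * u l) = (\<Sum>k\<in>(UNIV::'q set). (\<Sum>j\<in>UNIV. v k j * u j)\<^sup>2)"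
    by blast
  define w :: "'q \<Rightarrow> real ^ 'q" where "w k = (\<chi> j. v k j)" for k
  have w: "(\<Sum>j\<in>UNIV. \<Sum>l\<in>UNIV. complex_of_real (u $ j * u $ l) * Sig j l) = complex_of_real (\<Sum>k\<in>UNIV. (u \<bullet> w k)\<^sup>2)" for u :: "real ^ 'q"
  proof -
    obtain r where r: "(\<Sum>j\<in>UNIV. \<Sum>l\<in>UNIV. complex_of_real (u $ j * u $ l) * Sig j l) = complex_of_real r"
      using sig by blast
    then have "r = (\<Sum>j\<in>UNIV. \<Sum>l\<in>UNIV. \<sigma> j l * u $ j * u $ l)" unfolding q by simp
    also have "\<dots> = (\<Sum>k\<in>UNIV. (u \<bullet> w k)\<^sup>2)"
      unfolding v by (simp add: inner_vec_def w_def mult.commute)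
    finally show ?thesis using r by simp
  qed
  let ?P = "Pi\<^sub>M (UNIV :: 'q set) (\<lambda>_. std_normal_distribution)"
  interpret S: prob_space std_normal_distribution using real_dist_normal_dist by (simp add: real_distribution_def)
  interpret P: product_prob_space "\<lambda>_::'q. std_normal_distribution" UNIV ..
  interpret P': finite_product_prob_space "\<lambda>_::'q. std_normal_distribution" UNIV by standard simp
  define \<phi> :: "('q \<Rightarrow> real) \<Rightarrow> real ^ 'q" where "\<phi> x = (\<Sum>k\<in>UNIV. x k *\<^sub>R w k)" for x
  have "(\<lambda>x. x k) \<in> ?P \<rightarrow>\<^sub>M std_normal_distribution" for k
    by (rule measurable_component_singleton) simp
  then have "(\<lambda>x. x k) \<in> borel_measurable ?P" for k
    by (simp cong: measurable_cong_sets)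
  then have [measurable]: "\<phi> \<in> borel_measurable ?P"
    unfolding \<phi>_def[abs_def] by (intro borel_measurable_sum borel_measurable_scaleR) auto
  define N where "N = distr ?P borel \<phi>"
  have "prob_space N" unfolding N_def by (rule P.prob_space_distr) measurable
  moreover have "(\<integral>x. cis (u \<bullet> x) \<partial>N) = exp (- (1/2) * (\<Sum>j\<in>UNIV. \<Sum>l\<in>UNIV. complex_of_real (u $ j * u $ l) * Sig j l))" for u
  proof -
    have "(\<integral>x. cis (u \<bullet> x) \<partial>N) = (\<integral>x. cis (u \<bullet> \<phi> x) \<partial>?P)"
      unfolding N_def by (subst integral_distr) auto
    also have "\<dots> = (\<integral>x. (\<Prod>k\<in>UNIV. cis (x k * (u \<bullet> w k))) \<partial>?P)"
    proof (intro Bochner_Integration.integral_cong refl)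
      have "cis (\<Sum>k\<in>K. f k) = (\<Prod>k\<in>K. cis (f k))" if "finite K" for f and K :: "'q set"
        using that by (induction K) (auto simp: cis_mult[symmetric])
      then show "cis (u \<bullet> \<phi> x) = (\<Prod>k\<in>UNIV. cis (x k * (u \<bullet> w k)))" for x
        by (simp add: \<phi>_def inner_sum_right)
    qed
    also have "\<dots> = (\<Prod>k\<in>UNIV. (\<integral>x. cis (x * (u \<bullet> w k)) \<partial>std_normal_distribution))"
      by (rule P.product_integral_prod) (auto intro!: S.integrable_const_bound[where B=1])
    also have "\<dots> = (\<Prod>k\<in>UNIV. complex_of_real (exp (- (u \<bullet> w k)\<^sup>2 / 2)))"
      by (simp only: integral_cis_std_normal)
    also have "\<dots> = complex_of_real (exp (\<Sum>k\<in>UNIV. - (u \<bullet> w k)\<^sup>2 / 2))"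
      by (simp only: exp_sum[OF finite] of_real_prod)
    also have "(\<Sum>k\<in>UNIV. - (u \<bullet> w k)\<^sup>2 / 2) = - (1/2) * (\<Sum>k\<in>UNIV. (u \<bullet> w k)\<^sup>2)"
      by (simp add: sum_negf sum_divide_distrib)
    finally show ?thesis unfolding w by (simp add: exp_of_real[symmetric])
  qed
  moreover have "sets N = sets borel" by (simp add: N_def)
  ultimately show ?thesis unfolding gaussian_law_def by blast
qed

section \<open>Trigonometric polynomials and convergence in distribution\<close>

inductive trig_poly :: "('a::real_inner \<Rightarrow> complex) \<Rightarrow> bool" where
  monom: "trig_poly (\<lambda>x. c * cis (v \<bullet> x))"
| add: "trig_poly f \<Longrightarrow> trig_poly g \<Longrightarrow> trig_poly (\<lambda>x. f x + g x)"

lemma trig_poly_const: "trig_poly (\<lambda>x. c)"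
  using trig_poly.monom[of c 0] by simp

lemma trig_poly_sum: "(\<And>i. i \<in> I \<Longrightarrow> trig_poly (f i)) \<Longrightarrow> trig_poly (\<lambda>x. \<Sum>i\<in>I. f i x)"
  by (induction I rule: infinite_finite_induct) (auto intro: trig_poly_const trig_poly.add)

lemma trig_poly_mult:
  assumes "trig_poly f" "trig_poly g" shows "trig_poly (\<lambda>x. f x * g x)"
  using assms
proof (induction f)
  case (monom c v)
  from monom show ?case
  proof (induction g)
    case (monom c' v')
    have "c * cis (v \<bullet> x) * (c' * cis (v' \<bullet> x)) = (c * c') * cis ((v + v') \<bullet> x)" for x
      by (simp add: cis_mult[symmetric] inner_add_left)
    then show ?case using trig_poly.monom[of "c * c'" "v + v'"] by presburger
  qed (simp add: trig_poly.add distrib_left)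
qed (simp add: trig_poly.add distrib_right)

lemma trig_poly_sin: "trig_poly (\<lambda>x. complex_of_real (sin (v \<bullet> x)))"
proof -
  have "complex_of_real (sin (v \<bullet> x)) = (- \<i> / 2) * cis (v \<bullet> x) + (\<i> / 2) * cis ((- v) \<bullet> x)" for x
    by (simp add: complex_eq_iff)
  then show ?thesis by (simp only: trig_poly.add trig_poly.monom)
qed

text \<open>A linear functional of the vector of sines is a combination of single sines, each a
  combination of two characters; sums and products stay in the class.\<close>

lemma trig_poly_real_polynomial_sin:
  fixes p :: "real ^ 'q \<Rightarrow> real" and K :: real
  assumes "real_polynomial_function p"
  shows "trig_poly (\<lambda>x. complex_of_real (p (\<chi> i. sin (x $ i / K))))"
  using assms
proof (induction p)
  case (linear f)
  then interpret f: bounded_linear f .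
  have "f (\<chi> i. sin (x $ i / K)) = (\<Sum>i\<in>UNIV. f (axis i 1) * sin (axis i (1 / K) \<bullet> x))" for x
  proof -
    have "(\<chi> i. sin (x $ i / K)) = (\<Sum>i\<in>UNIV. sin (x $ i / K) *\<^sub>R axis i 1)"
      by (simp add: vec_eq_iff axis_def if_distrib[where f="\<lambda>y. _ * y"] cong: if_cong)
    then show ?thesis by (simp add: f.sum f.scaleR inner_axis' mult.commute)
  qed
  then show ?case
    by (auto intro!: trig_poly_sum trig_poly_mult trig_poly_const trig_poly_sin)
qed (auto intro: trig_poly_const trig_poly.add trig_poly_mult)

text \<open>Measurability and boundedness are carried through the induction because the case of a
  sum has to split integrals under \<open>M\<close> and under \<open>N\<close>.\<close>

lemma trig_poly_tendsto:
  fixes Z :: "real \<Rightarrow> 'w \<Rightarrow> 'a::euclidean_space"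
  assumes f: "trig_poly f" and M: "prob_space M" and N: "prob_space N" "sets N = sets borel"
    and Z: "\<And>T. Z T \<in> borel_measurable M"
    and char: "\<And>u. ((\<lambda>T. \<integral>\<omega>. cis (u \<bullet> Z T \<omega>) \<partial>M) \<longlongrightarrow> (\<integral>x. cis (u \<bullet> x) \<partial>N)) at_top"
  shows "f \<in> borel_measurable borel \<and> (\<exists>B. \<forall>x. cmod (f x) \<le> B) \<and>
    ((\<lambda>T. \<integral>\<omega>. f (Z T \<omega>) \<partial>M) \<longlongrightarrow> (\<integral>x. f x \<partial>N)) at_top"
  using f
proof (induction f)
  case (monom c v)
  show ?case
  proof (intro conjI exI allI)
    show "((\<lambda>T. \<integral>\<omega>. c * cis (v \<bullet> Z T \<omega>) \<partial>M) \<longlongrightarrow> (\<integral>x. c * cis (v \<bullet> x) \<partial>N)) at_top"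
      using tendsto_mult[OF tendsto_const[of c] char[of v]] by simp
    show "cmod (c * cis (v \<bullet> x)) \<le> cmod c" for x by (simp add: norm_mult)
  qed measurable
next
  case (add f g)
  interpret M: prob_space M by fact
  interpret N: prob_space N by fact
  have [measurable]: "f \<in> borel_measurable borel" "g \<in> borel_measurable borel" using add by auto
  have [measurable]: "f \<in> borel_measurable N" "g \<in> borel_measurable N"
    by (simp_all add: measurable_cong_sets[OF N(2) refl])
  note [measurable] = Z
  obtain B where B: "\<And>x. cmod (f x) \<le> B" using add by auto
  obtain B' where B': "\<And>x. cmod (g x) \<le> B'" using add by auto
  have iM: "integrable M (\<lambda>\<omega>. f (Z T \<omega>))" "integrable M (\<lambda>\<omega>. g (Z T \<omega>))" for T
    by (rule M.integrable_const_bound[where B=B], use B in auto)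
      (rule M.integrable_const_bound[where B=B'], use B' in auto)
  have iN: "integrable N f" "integrable N g"
    by (rule N.integrable_const_bound[where B=B], use B in auto)
      (rule N.integrable_const_bound[where B=B'], use B' in auto)
  show ?case
  proof (intro conjI exI allI)
    show "cmod (f x + g x) \<le> B + B'" for x
      using B[of x] B'[of x] norm_triangle_ineq[of "f x" "g x"] by linarith
    show "((\<lambda>T. \<integral>\<omega>. f (Z T \<omega>) + g (Z T \<omega>) \<partial>M) \<longlongrightarrow> (\<integral>x. f x + g x \<partial>N)) at_top"
      using add iM iN by (auto intro!: tendsto_add)
  qed measurable
qed

text \<open>
  The test function is first replaced by its composition with x \<mapsto> K arcsin (sin (x / K)) in each
  coordinate. This changes nothing on the ball of radius K and keeps the bound, and by
  Stone-Weierstrass the result is a uniform limit of trigonometric polynomials on the whole space.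
\<close>

theorem Levy_continuity_vec:
  fixes Z :: "real \<Rightarrow> 'w \<Rightarrow> real ^ 'q::finite"
  assumes M: "prob_space M" and N: "prob_space N" "sets N = sets borel"
    and Z: "\<And>T. Z T \<in> borel_measurable M"
    and char: "\<And>u. ((\<lambda>T. \<integral>\<omega>. cis (u \<bullet> Z T \<omega>) \<partial>M) \<longlongrightarrow> (\<integral>x. cis (u \<bullet> x) \<partial>N)) at_top"
    and tight: "\<forall>\<^sub>F T in at_top. integrable M (\<lambda>\<omega>. (norm (Z T \<omega>))\<^sup>2) \<and> (\<integral>\<omega>. (norm (Z T \<omega>))\<^sup>2 \<partial>M) \<le> C"
  shows "conv_in_distr M Z N"
  unfolding conv_in_distr_def
proof (intro allI impI)
  fix h :: "real ^ 'q \<Rightarrow> real" assume h: "continuous_on UNIV h \<and> bounded (range h)"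
  interpret M: prob_space M by fact
  interpret N: prob_space N by fact
  have [measurable]: "h \<in> borel_measurable borel" using h by (intro borel_measurable_continuous_onI) auto
  have [measurable]: "h \<in> borel_measurable N" by (simp add: measurable_cong_sets[OF N(2) refl])
  have spN: "space N = UNIV" using sets_eq_imp_space_eq[OF N(2)] by simp
  note [measurable] = Z
  have setsN: "{x. norm x > r} \<in> sets N" for r
    unfolding N(2) by measurable
  obtain B where B: "B > 0" "\<And>x. \<bar>h x\<bar> \<le> B" using h by (auto simp: bounded_pos)
  show "((\<lambda>T. \<integral>\<omega>. h (Z T \<omega>) \<partial>M) \<longlongrightarrow> (\<integral>x. h x \<partial>N)) at_top"
  proof (rule tendstoI)
    fix e' :: real assume "e' > 0"
    \<comment> \<open>Five parts: 2e for replacing \<open>h\<close> by \<open>P\<close> under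
      \<open>M\<close>, 2e for the same under \<open>N\<close>, and e for the convergence of the
      integrals of \<open>P\<close>.\<close>
    define e where "e = e' / 5"
    have e: "e > 0" using \<open>e' > 0\<close> by (simp add: e_def)
    have "(\<lambda>n. measure N {x. norm x > real n}) \<longlonglongrightarrow> measure N (\<Inter>n. {x. norm x > real n})"
      using setsN by (intro N.finite_Lim_measure_decseq) (auto simp: decseq_def)
    moreover have "(\<Inter>n. {x :: real ^ 'q. norm x > real n}) = {}"
      by (auto simp: set_eq_iff not_less intro: real_arch_simple)
    ultimately have tailN: "(\<lambda>n. measure N {x. norm x > real n}) \<longlonglongrightarrow> 0" by simp
    have "\<forall>\<^sub>F n in sequentially. measure N {x. norm x > real n} < e / (2 * B)"
      using order_tendstoD(2)[OF tailN, of "e / (2 * B)"] e B by simp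
    \<comment> \<open>Chebyshev: beyond radius n the replacement costs up to 2B more, on an event of
      probability at most C / n^2 under \<open>M\<close> for large T.\<close>
    moreover have "\<forall>\<^sub>F n in sequentially. 2 * B * \<bar>C\<bar> / (real n)\<^sup>2 < e"
    proof -
      have "(\<lambda>n. 2 * B * \<bar>C\<bar> / (real n)\<^sup>2) \<longlonglongrightarrow> 0" 
        by (rule tendsto_divide_0[OF tendsto_const filterlim_at_top_imp_at_infinity[OF filterlim_pow_at_top[OF _ filterlim_real_sequentially]]]) simp
      then show ?thesis using e by (rule order_tendstoD)
    qed
    moreover have "\<forall>\<^sub>F n in sequentially. n \<ge> (1::nat)" by (rule eventually_ge_at_top)
    ultimately have "\<forall>\<^sub>F n in sequentially. measure N {x. norm x > real n} < e / (2 * B) \<and>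
        2 * B * \<bar>C\<bar> / (real n)\<^sup>2 < e \<and> n \<ge> 1"
      by eventually_elim auto
    then obtain n where n: "measure N {x. norm x > real n} < e / (2 * B)" "2 * B * \<bar>C\<bar> / (real n)\<^sup>2 < e" "n \<ge> 1"
      by (auto simp: eventually_sequentially)
    define K where "K = real n"
    have K: "K \<ge> 1" using n by (simp add: K_def)
    define cube where "cube = (cbox (\<chi> i. -1) (\<chi> i. 1) :: (real ^ 'q) set)"
    define S where "S x = (\<chi> i. sin (x $ i / K))" for x :: "real ^ 'q"
    define F where "F s = h (\<chi> i. K * arcsin (s $ i))" for s :: "real ^ 'q"
    have S_cube: "S x \<in> cube" for x by (auto simp: S_def cube_def mem_box_cart)
    have "continuous_on cube (\<lambda>s. \<chi> i. K * arcsin (s $ i))"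
      by (intro continuous_on_vec_lambda continuous_on_mult continuous_on_const continuous_on_arcsin
        continuous_on_component) (auto simp: mem_box_cart cube_def)
    then have "continuous_on cube F"
      unfolding F_def using h by (intro continuous_on_compose2[of UNIV h cube]) auto
    moreover have "compact cube" by (simp add: cube_def compact_cbox)
    ultimately obtain p where p: "real_polynomial_function p" "\<And>s. s \<in> cube \<Longrightarrow> \<bar>F s - p s\<bar> < e"
      using Stone_Weierstrass_real_polynomial_function[of cube F e] e by blast
    have FS: "F (S x) = h x" if "norm x \<le> K" for x
    proof -
      have "arcsin (sin (x $ i / K)) = x $ i / K" for i
      proof (rule arcsin_sin)
        \<comment> \<open>The coordinates of x / K lie in [-1, 1], inside [-pi/2, pi/2], where
          \<open>arcsin\<close> inverts \<open>sin\<close>.\<close>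
        have "\<bar>x $ i\<bar> \<le> K" using that component_le_norm_cart[of x i] by linarith
        then have "\<bar>x $ i / K\<bar> \<le> 1" using K by simp
        then show "- (pi / 2) \<le> x $ i / K" "x $ i / K \<le> pi / 2"
          using pi_ge_two by linarith+
      qed
      then show ?thesis using K by (simp add: F_def S_def)
    qed
    have key: "\<bar>h x - p (S x)\<bar> \<le> e + 2 * B * indicator {x. norm x > K} x" for x
    proof (cases "norm x \<le> K")
      case True
      then show ?thesis using p(2)[OF S_cube, of x] FS[OF True] by simp
    next
      case False
      \<comment> \<open>Every value of \<open>F\<close> is a value of \<open>h\<close>, so the bound
        \<open>B\<close> holds off the ball as well.\<close>
      have "\<bar>F (S x)\<bar> \<le> B" unfolding F_def by (rule B(2))
      then show ?thesis using False p(2)[OF S_cube, of x] B(2)[of x] by simp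
    qed
    define P where "P x = p (S x)" for x
    have tp: "trig_poly (\<lambda>x. complex_of_real (P x))"
      unfolding P_def S_def by (rule trig_poly_real_polynomial_sin[OF p(1)])
    note tp' = trig_poly_tendsto[OF tp M N Z char]
    have [measurable]: "P \<in> borel_measurable borel" using tp'
      by (simp add: borel_measurable_complex_iff)
    have [measurable]: "P \<in> borel_measurable N" by (simp add: measurable_cong_sets[OF N(2) refl])
    obtain B' where B': "\<And>x. \<bar>P x\<bar> \<le> B'" using tp' by auto
    have iM: "integrable M (\<lambda>\<omega>. h (Z T \<omega>))" "integrable M (\<lambda>\<omega>. P (Z T \<omega>))" for T
      by (rule M.integrable_const_bound[where B=B], use B in auto)
        (rule M.integrable_const_bound[where B=B'], use B' in auto)
    have iN: "integrable N h" "integrable N P"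
      by (rule N.integrable_const_bound[where B=B], use B in auto)
        (rule N.integrable_const_bound[where B=B'], use B' in auto)
    have "((\<lambda>T. complex_of_real (\<integral>\<omega>. P (Z T \<omega>) \<partial>M)) \<longlongrightarrow> complex_of_real (\<integral>x. P x \<partial>N)) at_top"
      using tp' by simp
    then have lim: "((\<lambda>T. \<integral>\<omega>. P (Z T \<omega>) \<partial>M) \<longlongrightarrow> (\<integral>x. P x \<partial>N)) at_top"
      by (simp only: tendsto_of_real_iff)
    have closeN: "\<bar>(\<integral>x. h x \<partial>N) - (\<integral>x. P x \<partial>N)\<bar> \<le> 2 * e"
    proof -
      have "\<bar>(\<integral>x. h x \<partial>N) - (\<integral>x. P x \<partial>N)\<bar> = \<bar>\<integral>x. h x - P x \<partial>N\<bar>"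
        using iN by simp
      also have "\<dots> \<le> (\<integral>x. \<bar>h x - P x\<bar> \<partial>N)" by (rule integral_abs_bound)
      also have "\<dots> \<le> (\<integral>x. e + 2 * B * indicator {x. norm x > K} x \<partial>N)"
      proof (rule integral_mono)
        show "integrable N (\<lambda>x. e + 2 * B * indicator {x. norm x > K} x)"
          using setsN by (intro Bochner_Integration.integrable_add integrable_mult_right integrable_real_indicator)
            (auto simp: less_top[symmetric])
      qed (use iN key[folded P_def] in auto)
      also have "\<dots> = e + 2 * B * measure N {x. norm x > K}"
        using setsN spN by (subst Bochner_Integration.integral_add)
          (auto intro!: integrable_mult_right integrable_real_indicator simp: less_top[symmetric] N.prob_space[unfolded spN])
      also have "2 * B * measure N {x. norm x > K} \<le> 2 * B * (e / (2 * B))"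
        using n(1) B(1) by (intro mult_left_mono) (auto simp: K_def)
      finally show ?thesis using B(1) by simp
    qed
    have closeM: "\<forall>\<^sub>F T in at_top. \<bar>(\<integral>\<omega>. h (Z T \<omega>) \<partial>M) - (\<integral>\<omega>. P (Z T \<omega>) \<partial>M)\<bar> \<le> 2 * e"
      using tight
    proof eventually_elim
      case (elim T)
      have "\<bar>(\<integral>\<omega>. h (Z T \<omega>) \<partial>M) - (\<integral>\<omega>. P (Z T \<omega>) \<partial>M)\<bar> = \<bar>\<integral>\<omega>. h (Z T \<omega>) - P (Z T \<omega>) \<partial>M\<bar>"
        using iM by simp
      also have "\<dots> \<le> (\<integral>\<omega>. \<bar>h (Z T \<omega>) - P (Z T \<omega>)\<bar> \<partial>M)" by (rule integral_abs_bound)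
      also have "\<dots> \<le> (\<integral>\<omega>. e + 2 * B / K\<^sup>2 * (norm (Z T \<omega>))\<^sup>2 \<partial>M)"
      proof (rule integral_mono)
        fix \<omega>
        have "\<bar>h (Z T \<omega>) - P (Z T \<omega>)\<bar> \<le> e + 2 * B * indicator {x. norm x > K} (Z T \<omega>)"
          using key[of "Z T \<omega>"] by (simp add: P_def)
        also have "\<dots> \<le> e + 2 * B * ((norm (Z T \<omega>))\<^sup>2 / K\<^sup>2)"
        proof (intro add_left_mono mult_left_mono)
          show "indicator {x. norm x > K} (Z T \<omega>) \<le> (norm (Z T \<omega>))\<^sup>2 / K\<^sup>2"
            using K by (auto simp: indicator_def intro!: power_mono)
        qed (use B in auto)
        finally show "\<bar>h (Z T \<omega>) - P (Z T \<omega>)\<bar> \<le> e + 2 * B / K\<^sup>2 * (norm (Z T \<omega>))\<^sup>2" by simp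
      qed (use iM elim in auto)
      also have "\<dots> = e + 2 * B / K\<^sup>2 * (\<integral>\<omega>. (norm (Z T \<omega>))\<^sup>2 \<partial>M)"
        using elim by (simp add: M.prob_space)
      also have "\<dots> \<le> e + 2 * B / K\<^sup>2 * \<bar>C\<bar>"
        using elim B by (intro add_left_mono mult_left_mono) auto
      also have "\<dots> \<le> 2 * e" using n(2) by (simp add: K_def)
      finally show ?case .
    qed
    have "\<forall>\<^sub>F T in at_top. dist (\<integral>\<omega>. P (Z T \<omega>) \<partial>M) (\<integral>x. P x \<partial>N) < e"
      using lim e by (rule tendstoD)
    with closeM show "\<forall>\<^sub>F T in at_top. dist (\<integral>\<omega>. h (Z T \<omega>) \<partial>M) (\<integral>x. h x \<partial>N) < e'"
    proof eventually_elim
      case (elim T)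
      then show ?case using closeN e_def unfolding dist_real_def by linarith
    qed
  qed
qed

section \<open>The Levy exponent near zero\<close>

lemma levy_exponent_0 [simp]: "levy_exponent a b Lm 0 = 0"
  by (simp add: levy_exponent_def)

text \<open>Dominated convergence along a sequence bounded by K. For |x| <= 1 the compensated
  integrand is a second-order Taylor remainder, at most K^2 x^2 / 2; for |x| > 1 the compensator
  vanishes and the integrand is at most 2. Both are below (2 + K^2) min(1, x^2), which is integrable
  for a Levy measure.\<close>

lemma levy_exponent_tendsto_0:
  assumes "levy_triplet a b Lm" and X: "X \<longlonglongrightarrow> 0"
  shows "(\<lambda>n. levy_exponent a b Lm (X n)) \<longlonglongrightarrow> 0"
proof -
  have sets [measurable_cong]: "sets Lm = sets borel" and
    fin: "(\<integral>\<^sup>+x. ennreal (min 1 (x\<^sup>2)) \<partial>Lm) < \<infinity>"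
    using assms(1) by (auto simp: levy_triplet_def)
  let ?F = "\<lambda>u x. cis (u * x) - 1 - \<i> * complex_of_real (u * x * indicator {-1..1} x)"
  have imin: "integrable Lm (\<lambda>x. min 1 (x\<^sup>2))"
  proof (rule integrableI_nonneg)
    have "(\<lambda>x::real. min 1 (x\<^sup>2)) \<in> borel_measurable borel" by measurable
    then show "(\<lambda>x. min 1 (x\<^sup>2)) \<in> borel_measurable Lm"
      by (simp add: measurable_cong_sets[OF sets refl])
  qed (use fin in auto)
  obtain K where K: "\<And>n. \<bar>X n\<bar> \<le> K"
    using convergent_imp_Bseq[of X] X by (auto simp: convergent_def Bseq_def)
  have K0: "0 \<le> K" using order.trans[OF abs_ge_zero K[of 0]] .
  have "(\<lambda>n. \<integral>x. ?F (X n) x \<partial>Lm) \<longlonglongrightarrow> (\<integral>x. 0 \<partial>Lm)"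
  proof (rule integral_dominated_convergence[where w="\<lambda>x. (2 + K\<^sup>2) * min 1 (x\<^sup>2)"])
    show "integrable Lm (\<lambda>x. (2 + K\<^sup>2) * min 1 (x\<^sup>2))" using imin by simp
    show "AE x in Lm. (\<lambda>n. ?F (X n) x) \<longlonglongrightarrow> 0"
    proof (rule AE_I2)
      fix x
      have "(\<lambda>n. ?F (X n) x) \<longlonglongrightarrow> ?F 0 x"
        unfolding cis_conv_exp by (intro tendsto_intros X)
      then show "(\<lambda>n. ?F (X n) x) \<longlonglongrightarrow> 0" by simp
    qed
    show "AE x in Lm. norm (?F (X n) x) \<le> (2 + K\<^sup>2) * min 1 (x\<^sup>2)" for n
    proof (rule AE_I2)
      fix x
      show "norm (?F (X n) x) \<le> (2 + K\<^sup>2) * min 1 (x\<^sup>2)"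
      proof (cases "\<bar>x\<bar> \<le> 1")
        case True
        then have x2: "x\<^sup>2 \<le> 1" using abs_le_square_iff[of x 1] by simp
        have "norm (?F (X n) x) = cmod (iexp (X n * x) - (\<Sum>k\<le>1. (\<i> * complex_of_real (X n * x)) ^ k / fact k))"
          using True by (simp add: cis_conv_exp abs_le_iff algebra_simps)
        also have "\<dots> \<le> \<bar>X n * x\<bar> ^ Suc 1 / fact (Suc 1)" by (rule iexp_approx1)
        also have "\<dots> = (\<bar>X n\<bar>)\<^sup>2 * x\<^sup>2 / 2" by (simp add: power2_eq_square abs_mult algebra_simps)
        also have "\<dots> \<le> K\<^sup>2 * x\<^sup>2 / 2"
          using K[of n] by (intro divide_right_mono mult_right_mono power_mono) auto
        also have "\<dots> \<le> (2 + K\<^sup>2) * x\<^sup>2" by (simp add: algebra_simps)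
        finally show ?thesis using x2 by simp
      next
        case False
        then have x2: "1 \<le> x\<^sup>2" using abs_le_square_iff[of 1 x] by simp
        have "x \<notin> {-1..1}" using False by auto
        then have "norm (?F (X n) x) = norm (cis (X n * x) - 1)" by simp
        also have "\<dots> \<le> norm (cis (X n * x)) + norm (1::complex)" by (rule norm_triangle_ineq4)
        also have "\<dots> \<le> (2 + K\<^sup>2)" by simp
        finally show ?thesis using x2 by simp
      qed
    qed
  qed measurable
  then have "(\<lambda>n. \<i> * complex_of_real (a * X n) - complex_of_real (b * (X n)\<^sup>2 / 2) + (\<integral>x. ?F (X n) x \<partial>Lm)) \<longlonglongrightarrow>
    \<i> * complex_of_real (a * 0) - complex_of_real (b * 0\<^sup>2 / 2) + (\<integral>x. 0 \<partial>Lm)"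
    by (intro tendsto_intros X) auto
  then show ?thesis unfolding levy_exponent_def by simp
qed

text \<open>
  Writing exp z - 1 = z * expm1_quot z relates the asymptotics of the exponent at 0 to those of the
  characteristic function without taking complex logarithms.
\<close>

definition expm1_quot :: "complex \<Rightarrow> complex" where
  "expm1_quot z = (if z = 0 then 1 else (exp z - 1) / z)"

lemma expm1_quot: "exp z - 1 = z * expm1_quot z"
  by (simp add: expm1_quot_def)

lemma isCont_expm1_quot: "isCont expm1_quot 0"
proof -
  have "((\<lambda>h. (exp (0 + h) - exp 0) / h) \<longlongrightarrow> (1::complex)) (at 0)"
    using DERIV_exp[of "0::complex"] unfolding DERIV_def by simp
  then have "(expm1_quot \<longlongrightarrow> 1) (at 0)"
    by (rule Lim_transform_eventually) (auto simp: expm1_quot_def eventually_at_filter)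
  then show ?thesis by (simp add: isCont_def expm1_quot_def)
qed

lemma expm1_quot_tendsto: "(f \<longlongrightarrow> 0) F \<Longrightarrow> ((\<lambda>x. expm1_quot (f x)) \<longlongrightarrow> 1) F"
  using isCont_tendsto_compose[OF isCont_expm1_quot, of f F] by (simp add: expm1_quot_def)

context prob_space
begin

lemma integrable_cis [simp]:
  assumes [measurable]: "X \<in> borel_measurable M" shows "integrable M (\<lambda>\<omega>. cis (u * X \<omega>))"
  by (rule integrable_const_bound[where B=1]) auto

text \<open>With only second moments at hand, the remainder is taken in the form min(6 X^2, |u|
  |X|^3): it is dominated by 6 X^2 and tends to 0 pointwise, so its expectation tends to 0.\<close>

lemma char_second_order:
  assumes X: "sq_integrable M X" and mean: "expectation X = 0"
    and u: "u \<longlonglongrightarrow> 0" "\<And>n. u n \<noteq> 0"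
  shows "(\<lambda>n. ((\<integral>\<omega>. cis (u n * X \<omega>) \<partial>M) - 1) / complex_of_real ((u n)\<^sup>2)) \<longlonglongrightarrow>
     complex_of_real (- expectation (\<lambda>\<omega>. (X \<omega>)\<^sup>2) / 2)"
proof -
  have [measurable]: "X \<in> borel_measurable M" using X by auto
  let ?s = "expectation (\<lambda>\<omega>. (X \<omega>)\<^sup>2)"
  have iX: "integrable M X" using sq_integrable_mult[OF X, of "\<lambda>_. 1"] by (simp add: sq_integrable_def)
  have var: "variance X = ?s" using mean by simp
  let ?\<phi> = "\<lambda>n. \<integral>\<omega>. cis (u n * X \<omega>) \<partial>M"
  let ?R = "\<lambda>n. expectation (\<lambda>\<omega>. min (6 * (X \<omega>)\<^sup>2) (\<bar>u n\<bar> * \<bar>X \<omega>\<bar> ^ 3))"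
  have bound: "cmod (?\<phi> n - (1 - (u n)\<^sup>2 * ?s / 2)) \<le> (u n)\<^sup>2 / 6 * ?R n" for n
  proof -
    have "char (distr M borel X) (u n) = ?\<phi> n"
      by (simp add: char_def integral_distr cis_conv_exp)
    then show ?thesis
      using char_approx3'[OF _ iX sq_integrable_square[OF X] mean var refl, of "u n"] by simp
  qed
  have "?R \<longlonglongrightarrow> expectation (\<lambda>\<omega>. 0)"
  proof (rule integral_dominated_convergence[where w="\<lambda>\<omega>. 6 * (X \<omega>)\<^sup>2"])
    show "AE \<omega> in M. (\<lambda>n. min (6 * (X \<omega>)\<^sup>2) (\<bar>u n\<bar> * \<bar>X \<omega>\<bar> ^ 3)) \<longlonglongrightarrow> 0"
    proof (rule AE_I2)
      fix \<omega>
      have "(\<lambda>n. min (6 * (X \<omega>)\<^sup>2) (\<bar>u n\<bar> * \<bar>X \<omega>\<bar> ^ 3)) \<longlonglongrightarrow> min (6 * (X \<omega>)\<^sup>2) (\<bar>0\<bar> * \<bar>X \<omega>\<bar> ^ 3)"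
        by (intro tendsto_intros u)
      then show "(\<lambda>n. min (6 * (X \<omega>)\<^sup>2) (\<bar>u n\<bar> * \<bar>X \<omega>\<bar> ^ 3)) \<longlonglongrightarrow> 0" by simp
    qed
  qed (use sq_integrable_square[OF X] in auto)
  then have R: "(\<lambda>n. ?R n / 6) \<longlonglongrightarrow> 0" by (auto intro!: tendsto_eq_intros)
  have "(\<lambda>n. (?\<phi> n - 1) / complex_of_real ((u n)\<^sup>2) - complex_of_real (- ?s / 2)) \<longlonglongrightarrow> 0"
  proof (rule Lim_null_comparison[OF _ R], intro always_eventually allI)
    fix n
    have u2: "(u n)\<^sup>2 > 0" using u(2) by simp
    have "(?\<phi> n - 1) / complex_of_real ((u n)\<^sup>2) - complex_of_real (- ?s / 2) =
       (?\<phi> n - (1 - (u n)\<^sup>2 * ?s / 2)) / complex_of_real ((u n)\<^sup>2)"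
      using u(2)[of n] by (simp add: field_simps)
    also have "cmod \<dots> = cmod (?\<phi> n - (1 - (u n)\<^sup>2 * ?s / 2)) / (u n)\<^sup>2"
      by (simp add: norm_divide norm_power)
    also have "\<dots> \<le> ((u n)\<^sup>2 / 6 * ?R n) / (u n)\<^sup>2"
      using bound[of n] u2 by (intro divide_right_mono) auto
    also have "\<dots> = ?R n / 6" using u2 by simp
    finally show "cmod ((?\<phi> n - 1) / complex_of_real ((u n)\<^sup>2) - complex_of_real (- ?s / 2)) \<le> ?R n / 6" .
  qed
  then show ?thesis by (simp only: LIM_zero_iff)
qed

text \<open>
  Fatou applied to 2 (1 - cos (u X)) / u^2 gives the second moment; the first then follows by dominated
  convergence.
\<close>

lemma moments_from_char:
  assumes X [measurable]: "X \<in> borel_measurable M"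
    and lim: "(\<lambda>n. ((\<integral>\<omega>. cis (inverse (real (Suc n)) * X \<omega>) \<partial>M) - 1) / complex_of_real ((inverse (real (Suc n)))\<^sup>2)) \<longlonglongrightarrow>
       complex_of_real (- s / 2)"
  shows "sq_integrable M X" "expectation X = 0" "expectation (\<lambda>\<omega>. (X \<omega>)\<^sup>2) = s"
proof -
  define u where "u n = inverse (real (Suc n))" for n
  have u: "u \<longlonglongrightarrow> 0" "\<And>n. u n \<noteq> 0" "\<And>n. u n > 0"
    using LIMSEQ_inverse_real_of_nat by (auto simp: u_def[abs_def])
  have u': "filterlim u (at 0) sequentially" using u by (auto simp: filterlim_at)
  define \<phi> where "\<phi> n = (\<integral>\<omega>. cis (u n * X \<omega>) \<partial>M)" for n
  have lim: "(\<lambda>n. (\<phi> n - 1) / complex_of_real ((u n)\<^sup>2)) \<longlonglongrightarrow> complex_of_real (- s / 2)"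
    using lim by (simp only: \<phi>_def u_def)
  \<comment> \<open>By the half-angle formula \<open>?g n\<close> is the square of 2 sin(u X / 2) /
    u, a difference quotient at 0 of a function with derivative \<open>X\<close>. Its expectation is
    -2 times the real part of the quotient in \<open>lim\<close>.\<close>
  let ?g = "\<lambda>n \<omega>. 2 * (1 - cos (u n * X \<omega>)) / (u n)\<^sup>2"
  have g_lim: "(\<lambda>n. ?g n \<omega>) \<longlonglongrightarrow> (X \<omega>)\<^sup>2" for \<omega>
  proof -
    have "((\<lambda>h. 2 * sin (h * (X \<omega> / 2))) has_real_derivative X \<omega>) (at 0)"
      by (auto intro!: derivative_eq_intros)
    then have "((\<lambda>h. 2 * sin (h * (X \<omega> / 2)) / h) \<longlongrightarrow> X \<omega>) (at 0)"
      by (simp add: DERIV_def)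
    from filterlim_compose[OF this u'] have "(\<lambda>n. (2 * sin (u n * (X \<omega> / 2)) / u n)\<^sup>2) \<longlonglongrightarrow> (X \<omega>)\<^sup>2"
      by (intro tendsto_power) (simp add: o_def)
    moreover have "(2 * sin (u n * (X \<omega> / 2)) / u n)\<^sup>2 = ?g n \<omega>" for n
    proof -
      have "cos (u n * X \<omega>) = 1 - 2 * (sin (u n * (X \<omega> / 2)))\<^sup>2"
        using cos_double_sin[of "u n * (X \<omega> / 2)"] by simp
      then show ?thesis by (simp add: power_divide power_mult_distrib)
    qed
    ultimately show ?thesis by simp
  qed
  have g_int: "integrable M (?g n)" for n
    by (intro integrable_const_bound[where B="4 / (u n)\<^sup>2"])
      (auto simp: abs_mult intro!: AE_I2 divide_right_mono, smt (verit) cos_ge_minus_one cos_le_one)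
  have "(\<integral>\<^sup>+\<omega>. liminf (\<lambda>n. ennreal (?g n \<omega>)) \<partial>M) \<le> liminf (\<lambda>n. (\<integral>\<^sup>+\<omega>. ennreal (?g n \<omega>) \<partial>M))"
    by (rule nn_integral_liminf) measurable
  also have "(\<integral>\<^sup>+\<omega>. liminf (\<lambda>n. ennreal (?g n \<omega>)) \<partial>M) = (\<integral>\<^sup>+\<omega>. ennreal ((X \<omega>)\<^sup>2) \<partial>M)"
    by (intro nn_integral_cong lim_imp_Liminf tendsto_ennrealI g_lim) simp
  also have "(\<lambda>n. (\<integral>\<^sup>+\<omega>. ennreal (?g n \<omega>) \<partial>M)) = (\<lambda>n. ennreal (expectation (?g n)))"
    using g_int by (intro ext nn_integral_eq_integral) auto
  also have "liminf \<dots> = ennreal s"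
  proof (intro lim_imp_Liminf tendsto_ennrealI)
    have eq: "expectation (?g n) = -2 * Re ((\<phi> n - 1) / complex_of_real ((u n)\<^sup>2))" for n
    proof -
      have "Re (\<phi> n) = expectation (\<lambda>\<omega>. cos (u n * X \<omega>))"
        unfolding \<phi>_def by (subst integral_Re[symmetric]) auto
      moreover have "expectation (\<lambda>\<omega>. 1 - cos (u n * X \<omega>)) = 1 - expectation (\<lambda>\<omega>. cos (u n * X \<omega>))"
        by (subst Bochner_Integration.integral_diff)
          (auto intro!: integrable_const_bound[where B=1] simp: prob_space)
      moreover have "Re ((\<phi> n - 1) / complex_of_real ((u n)\<^sup>2)) = (Re (\<phi> n) - 1) / (u n)\<^sup>2"
        by (simp only: Re_divide_of_real minus_complex.sel one_complex.sel)
      moreover have "expectation (?g n) = 2 / (u n)\<^sup>2 * expectation (\<lambda>\<omega>. 1 - cos (u n * X \<omega>))"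
        by (subst integral_mult_right_zero[symmetric]) simp
      ultimately show ?thesis by (simp add: diff_divide_distrib)
    qed
    have "(\<lambda>n. -2 * Re ((\<phi> n - 1) / complex_of_real ((u n)\<^sup>2))) \<longlonglongrightarrow> -2 * Re (complex_of_real (- s / 2))"
      by (intro tendsto_intros lim)
    then show "(\<lambda>n. expectation (?g n)) \<longlonglongrightarrow> s" unfolding eq by simp
  qed simp
  finally have "(\<integral>\<^sup>+\<omega>. ennreal ((X \<omega>)\<^sup>2) \<partial>M) < \<infinity>" by (rule order.strict_trans1) simp
  then have X2: "sq_integrable M X"
    by (intro sq_integrableI integrableI_nonneg) auto
  then show "sq_integrable M X" .
  have iX: "integrable M X" using sq_integrable_mult[OF X2, of "\<lambda>_. 1"] by (simp add: sq_integrable_def)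
  \<comment> \<open>The first-order quotient has limit i E X, yet it equals \<open>u n\<close> times
    the convergent second-order quotient; hence E X = 0.\<close>
  have "(\<lambda>n. \<integral>\<omega>. (cis (u n * X \<omega>) - 1) / complex_of_real (u n) \<partial>M) \<longlonglongrightarrow> (\<integral>\<omega>. \<i> * complex_of_real (X \<omega>) \<partial>M)"
  proof (rule integral_dominated_convergence[where w="\<lambda>\<omega>. \<bar>X \<omega>\<bar>"])
    show "AE \<omega> in M. norm ((cis (u n * X \<omega>) - 1) / complex_of_real (u n)) \<le> \<bar>X \<omega>\<bar>" for n
    proof (rule AE_I2)
      fix \<omega>
      have "cmod (cis (u n * X \<omega>) - 1) \<le> \<bar>u n * X \<omega>\<bar>"
        using iexp_approx1[of "u n * X \<omega>" 0] by (simp add: cis_conv_exp)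
      then show "norm ((cis (u n * X \<omega>) - 1) / complex_of_real (u n)) \<le> \<bar>X \<omega>\<bar>"
        using u(3)[of n] by (simp add: norm_divide abs_mult field_simps)
    qed
    show "AE \<omega> in M. (\<lambda>n. (cis (u n * X \<omega>) - 1) / complex_of_real (u n)) \<longlonglongrightarrow> \<i> * complex_of_real (X \<omega>)"
    proof (rule AE_I2)
      fix \<omega>
      have "(\<lambda>n. (cis (u n * X \<omega>) - 1) / complex_of_real (u n) - \<i> * complex_of_real (X \<omega>)) \<longlonglongrightarrow> 0"
      proof (rule Lim_null_comparison[OF always_eventually], intro allI)
        fix n
        have "cmod (cis (u n * X \<omega>) - 1 - \<i> * complex_of_real (u n * X \<omega>)) \<le> (u n * X \<omega>)\<^sup>2 / 2"
          using iexp_approx1[of "u n * X \<omega>" 1] by (simp add: cis_conv_exp power2_eq_square abs_mult_self_eq algebra_simps)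
        moreover have "(cis (u n * X \<omega>) - 1) / complex_of_real (u n) - \<i> * complex_of_real (X \<omega>) =
          (cis (u n * X \<omega>) - 1 - \<i> * complex_of_real (u n * X \<omega>)) / complex_of_real (u n)"
          using u(2)[of n] by (simp add: field_simps)
        ultimately have "cmod ((cis (u n * X \<omega>) - 1) / complex_of_real (u n) - \<i> * complex_of_real (X \<omega>)) \<le>
          (u n * X \<omega>)\<^sup>2 / 2 / u n"
          using u(3)[of n] by (simp only: norm_divide norm_of_real abs_of_pos divide_right_mono less_imp_le)
        also have "\<dots> = u n * ((X \<omega>)\<^sup>2 / 2)"
          using u(2)[of n] by (simp add: power2_eq_square)
        finally show "cmod ((cis (u n * X \<omega>) - 1) / complex_of_real (u n) - \<i> * complex_of_real (X \<omega>)) \<le> u n * ((X \<omega>)\<^sup>2 / 2)" .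
        show "(\<lambda>n. u n * ((X \<omega>)\<^sup>2 / 2)) \<longlonglongrightarrow> 0"
          using tendsto_mult[OF u(1) tendsto_const] by simp
      qed
      then show "(\<lambda>n. (cis (u n * X \<omega>) - 1) / complex_of_real (u n)) \<longlonglongrightarrow> \<i> * complex_of_real (X \<omega>)"
        by (simp only: LIM_zero_iff)
    qed
  qed (use iX in auto)
  moreover have "(\<integral>\<omega>. (cis (u n * X \<omega>) - 1) / complex_of_real (u n) \<partial>M) = complex_of_real (u n) * ((\<phi> n - 1) / complex_of_real ((u n)\<^sup>2))" for n
  proof -
    have "(\<integral>\<omega>. (cis (u n * X \<omega>) - 1) / complex_of_real (u n) \<partial>M) = (\<phi> n - 1) / complex_of_real (u n)"
      by (simp add: \<phi>_def prob_space)
    then show ?thesis using u(2)[of n] by (simp add: power2_eq_square)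
  qed
  moreover have "(\<lambda>n. complex_of_real (u n) * ((\<phi> n - 1) / complex_of_real ((u n)\<^sup>2))) \<longlonglongrightarrow> complex_of_real 0 * complex_of_real (- s / 2)"
    by (intro tendsto_intros lim u)
  ultimately have "(\<integral>\<omega>. \<i> * complex_of_real (X \<omega>) \<partial>M) = 0"
    using LIMSEQ_unique by fastforce
  then show m0: "expectation X = 0" by simp
  \<comment> \<open>Fatou bounds the second moment only from above by \<open>s\<close>; comparing
    two limits of the same sequence gives equality.\<close>
  have "(\<lambda>n. (\<phi> n - 1) / complex_of_real ((u n)\<^sup>2)) \<longlonglongrightarrow> complex_of_real (- expectation (\<lambda>\<omega>. (X \<omega>)\<^sup>2) / 2)"
    unfolding \<phi>_def by (rule char_second_order[OF X2 m0 u(1,2)])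
  from LIMSEQ_unique[OF lim this] show "expectation (\<lambda>\<omega>. (X \<omega>)\<^sup>2) = s"
    by (simp only: of_real_eq_iff)
qed

end

section \<open>Independence of the two halves and moments of increments\<close>

lemma proc_sigma_subset_Pow: "proc_sigma M Z I \<subseteq> Pow (space M)"
  unfolding proc_sigma_def by (rule subsetI, rule PowI, rule sigma_sets_into_sp[rotated], assumption) auto

text \<open>Independence is assumed for the sigma-algebras of the two paths. The preimages under
  \<open>A\<close> and \<open>B\<close> generate sub-sigma-algebras of these, and independence
  passes to subfamilies.\<close>

lemma (in prob_space) indep_var_proc_sigma:
  fixes A B :: "'a \<Rightarrow> real"
  assumes ind: "indep_set (proc_sigma M X {0..}) (proc_sigma M Y {0..})"
    and X: "\<And>t. 0 \<le> t \<Longrightarrow> X t \<in> borel_measurable M" and Y: "\<And>t. 0 \<le> t \<Longrightarrow> Y t \<in> borel_measurable M"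
    and A: "A \<in> borel_measurable (sigma (space M) (proc_sigma M X {0..}))"
    and B: "B \<in> borel_measurable (sigma (space M) (proc_sigma M Y {0..}))"
  shows "indep_var borel A borel B"
proof -
  have idem: "sigma_sets (space M) (proc_sigma M Z {0..}) = proc_sigma M Z {0..}" for Z :: "real \<Rightarrow> 'a \<Rightarrow> real"
    unfolding proc_sigma_def by (rule sigma_sets_sigma_sets_eq) auto
  have sets: "sets (sigma (space M) (proc_sigma M Z {0..})) = proc_sigma M Z {0..}" for Z :: "real \<Rightarrow> 'a \<Rightarrow> real"
    by (simp only: sets_measure_of[OF proc_sigma_subset_Pow] idem)
  have gen: "sigma_sets (space M) {F -` S \<inter> space M | S. S \<in> sets borel} \<subseteq> proc_sigma M Z {0..}"
    if F: "F \<in> borel_measurable (sigma (space M) (proc_sigma M Z {0..}))" for F :: "'a \<Rightarrow> real" and Z :: "real \<Rightarrow> 'a \<Rightarrow> real"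
  proof -
    have "F -` S \<inter> space M \<in> proc_sigma M Z {0..}" if "S \<in> sets borel" for S
      using measurable_sets[OF F that] by (simp only: sets space_measure_of_conv)
    then have "{F -` S \<inter> space M | S. S \<in> sets borel} \<subseteq> sigma_sets (space M) (proc_sigma M Z {0..})"
      by (auto simp only: idem)
    from sigma_sets_mono[OF this] show ?thesis by (simp only: idem)
  qed
  have subM: "proc_sigma M Z {0..} \<subseteq> sets M" if "\<And>t. 0 \<le> t \<Longrightarrow> Z t \<in> borel_measurable M" for Z :: "real \<Rightarrow> 'a \<Rightarrow> real"
    unfolding proc_sigma_def using that by (intro sets.sigma_sets_subset) (auto intro: measurable_sets)
  have rv: "F \<in> borel_measurable M" if "F \<in> borel_measurable (sigma (space M) (proc_sigma M Z {0..}))"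
    "\<And>t. 0 \<le> t \<Longrightarrow> Z t \<in> borel_measurable M" for F :: "'a \<Rightarrow> real" and Z :: "real \<Rightarrow> 'a \<Rightarrow> real"
  proof (rule measurableI)
    fix S :: "real set" assume "S \<in> sets borel"
    then have "F -` S \<inter> space M \<in> proc_sigma M Z {0..}"
      using measurable_sets[OF that(1)] by (simp only: sets space_measure_of_conv)
    moreover have "proc_sigma M Z {0..} \<subseteq> sets M" by (rule subM) (rule that(2))
    ultimately show "F -` S \<inter> space M \<in> sets M" by (rule subsetD[rotated])
  qed simp
  show ?thesis
    unfolding indep_var_eq
  proof (intro conjI)
    show "indep_set (sigma_sets (space M) {A -` S \<inter> space M |S. S \<in> sets borel})
     (sigma_sets (space M) {B -` S \<inter> space M |S. S \<in> sets borel})"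
      using ind gen[OF A] gen[OF B] unfolding indep_set_def
      by (elim indep_sets_mono_sets) (auto split: bool.splits)
    show "random_variable borel A" by (rule rv[OF A X])
    show "random_variable borel B" by (rule rv[OF B Y])
  qed
qed

lemma proc_measurable:
  assumes "0 \<le> t"
  shows "X t \<in> borel_measurable (sigma (space M) (proc_sigma M X {0..}))"
proof (rule measurableI)
  fix S :: "real set" assume "S \<in> sets borel"
  then have *: "X t -` S \<inter> space M \<in> proc_sigma M X {0..}"
    unfolding proc_sigma_def using assms by (intro sigma_sets.Basic) auto
  show "X t -` S \<inter> space (sigma (space M) (proc_sigma M X {0..})) \<in>
      sets (sigma (space M) (proc_sigma M X {0..}))"
    using * by (simp add: space_measure_of_conv sets_measure_of[OF proc_sigma_subset_Pow])
qed simp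

lemma
  assumes "levy_process M a b Lm X"
  shows levy_process_measurable: "0 \<le> t \<Longrightarrow> X t \<in> borel_measurable M"
    and levy_process_0: "AE \<omega> in M. X 0 \<omega> = 0"
    and levy_process_char: "0 \<le> s \<Longrightarrow> s \<le> t \<Longrightarrow>
      (\<integral>\<omega>. cis (u * (X t \<omega> - X s \<omega>)) \<partial>M) = exp (complex_of_real (t - s) * levy_exponent a b Lm u)"
    and levy_process_indep: "0 \<le> ts 0 \<Longrightarrow> (\<And>k. k < n \<Longrightarrow> ts k < ts (Suc k)) \<Longrightarrow>
      prob_space.indep_vars M (\<lambda>_. borel) (\<lambda>k \<omega>. X (ts (Suc k)) \<omega> - X (ts k) \<omega>) {..<n}"
  using assms unfolding levy_process_def by blast+

text \<open>Moments are assumed for \<open>L0 1\<close> alone; those of all other increments,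
  including the ones of \<open>L1\<close>, follow through the common exponent.\<close>

locale centered_levy = prob_space M for M :: "'w measure" +
  fixes a b :: real and Lm :: "real measure" and L0 L1 :: "real \<Rightarrow> 'w \<Rightarrow> real"
  assumes levy: "two_sided_levy M a b Lm L0 L1"
    and sq: "integrable M (\<lambda>\<omega>. (L0 1 \<omega>)\<^sup>2)" and mean: "expectation (L0 1) = 0"
begin

abbreviation "L \<equiv> two_sided L0 L1"
abbreviation "\<psi> \<equiv> levy_exponent a b Lm"

definition "d2 = expectation (\<lambda>\<omega>. (L0 1 \<omega>)\<^sup>2)"

lemma lp: "levy_process M a b Lm L0" "levy_process M a b Lm L1"
  using levy by (auto simp: two_sided_levy_def)

lemma triplet: "levy_triplet a b Lm"
  using lp(1) by (simp add: levy_process_def)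

lemma L_measurable:
  "0 \<le> t \<Longrightarrow> L0 t \<in> borel_measurable M" "0 \<le> t \<Longrightarrow> L1 t \<in> borel_measurable M"
  using lp by (blast intro: levy_process_measurable)+

lemma L_0: "AE \<omega> in M. L0 0 \<omega> = 0" "AE \<omega> in M. L1 0 \<omega> = 0"
  using lp by (blast intro: levy_process_0)+

lemma L_char:
  assumes "0 \<le> s" "s \<le> t"
  shows "(\<integral>\<omega>. cis (u * (L0 t \<omega> - L0 s \<omega>)) \<partial>M) = exp (complex_of_real (t - s) * \<psi> u)"
    "(\<integral>\<omega>. cis (u * (L1 t \<omega> - L1 s \<omega>)) \<partial>M) = exp (complex_of_real (t - s) * \<psi> u)"
  using levy_process_char[OF lp(1) assms] levy_process_char[OF lp(2) assms] by blast+

lemma L_indep: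
  fixes A B :: "'w \<Rightarrow> real"
  assumes "A \<in> borel_measurable (sigma (space M) (proc_sigma M L0 {0..}))"
    and "B \<in> borel_measurable (sigma (space M) (proc_sigma M L1 {0..}))"
  shows "indep_var borel A borel B"
proof (rule indep_var_proc_sigma[OF _ _ _ assms])
  show "indep_set (proc_sigma M L0 {0..}) (proc_sigma M L1 {0..})"
    using levy by (simp add: two_sided_levy_def)
qed (rule L_measurable, assumption)+

text \<open>The characteristic function of L(1) is exp(psi u), so its second-order expansion
  concerns exp(psi u) - 1. Dividing by \<open>expm1_quot\<close> at psi u, which tends to 1, moves
  the expansion to psi itself.\<close>

lemma exponent_quadratic:
  assumes u: "u \<longlonglongrightarrow> 0" "\<And>n. u n \<noteq> 0"
  shows "(\<lambda>n. \<psi> (u n) / complex_of_real ((u n)\<^sup>2)) \<longlonglongrightarrow> complex_of_real (- d2 / 2)"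
proof -
  \<comment> \<open>The characteristic function is prescribed for increments, and
    \<open>L0 0\<close> vanishes only almost surely.\<close>
  define X where "X \<omega> = L0 1 \<omega> - L0 0 \<omega>" for \<omega>
  have [measurable]: "L0 0 \<in> borel_measurable M" "L0 1 \<in> borel_measurable M"
    using L_measurable by auto
  have [measurable]: "X \<in> borel_measurable M" unfolding X_def[abs_def] by measurable
  have ae: "AE \<omega> in M. X \<omega> = L0 1 \<omega>" using L_0(1) by eventually_elim (simp add: X_def)
  have "integrable M (\<lambda>\<omega>. (X \<omega>)\<^sup>2) \<longleftrightarrow> integrable M (\<lambda>\<omega>. (L0 1 \<omega>)\<^sup>2)"
    using ae by (intro integrable_cong_AE) auto
  with sq have X: "sq_integrable M X" by (intro sq_integrableI) auto
  have EX: "expectation X = 0" using integral_cong_AE[of X M "L0 1"] ae mean by auto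
  have EX2: "expectation (\<lambda>\<omega>. (X \<omega>)\<^sup>2) = d2"
    unfolding d2_def using ae by (intro integral_cong_AE) auto
  have char: "(\<integral>\<omega>. cis (v * X \<omega>) \<partial>M) = exp (\<psi> v)" for v
    using L_char(1)[of 0 1 v] by (simp add: X_def)
  have 1: "(\<lambda>n. (exp (\<psi> (u n)) - 1) / complex_of_real ((u n)\<^sup>2)) \<longlonglongrightarrow> complex_of_real (- d2 / 2)"
    using char_second_order[OF X EX u] unfolding EX2 char .
  have \<kappa>: "(\<lambda>n. expm1_quot (\<psi> (u n))) \<longlonglongrightarrow> 1"
    by (intro expm1_quot_tendsto levy_exponent_tendsto_0[OF triplet u(1)])
  have "(\<lambda>n. (exp (\<psi> (u n)) - 1) / complex_of_real ((u n)\<^sup>2) / expm1_quot (\<psi> (u n))) \<longlonglongrightarrow> complex_of_real (- d2 / 2) / 1"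
    by (intro tendsto_divide 1 \<kappa>) simp
  moreover have "\<forall>\<^sub>F n in sequentially. expm1_quot (\<psi> (u n)) \<noteq> 0"
    using tendsto_imp_eventually_ne[OF \<kappa>, of 0] by simp
  then have "\<forall>\<^sub>F n in sequentially. (exp (\<psi> (u n)) - 1) / complex_of_real ((u n)\<^sup>2) / expm1_quot (\<psi> (u n)) =
     \<psi> (u n) / complex_of_real ((u n)\<^sup>2)"
    by eventually_elim (simp add: expm1_quot)
  ultimately show ?thesis
    by (auto elim!: Lim_transform_eventually)
qed

lemma exponent_approx:
  assumes "\<eta> > 0"
  obtains \<delta> where "\<delta> > 0" "\<And>x. \<bar>x\<bar> \<le> \<delta> \<Longrightarrow> cmod (\<psi> x + complex_of_real (d2 * x\<^sup>2 / 2)) \<le> \<eta> * x\<^sup>2"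
proof -
  have "((\<lambda>x. \<psi> x / complex_of_real (x\<^sup>2)) \<longlongrightarrow> complex_of_real (- d2 / 2)) (at 0)"
    unfolding tendsto_at_iff_sequentially using exponent_quadratic by (auto simp: o_def)
  from tendstoD[OF this assms] obtain \<delta> where \<delta>: "\<delta> > 0"
    "\<And>x. x \<noteq> 0 \<Longrightarrow> \<bar>x\<bar> < \<delta> \<Longrightarrow> dist (\<psi> x / complex_of_real (x\<^sup>2)) (complex_of_real (- d2 / 2)) < \<eta>"
    by (auto simp: eventually_at)
  show ?thesis
  proof (rule that[of "\<delta> / 2"])
    fix x :: real assume x: "\<bar>x\<bar> \<le> \<delta> / 2"
    show "cmod (\<psi> x + complex_of_real (d2 * x\<^sup>2 / 2)) \<le> \<eta> * x\<^sup>2"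
    proof (cases "x = 0")
      case False
      have "cmod (\<psi> x / complex_of_real (x\<^sup>2) + complex_of_real (d2 / 2)) < \<eta>"
        using \<delta>(2)[OF False] x \<delta>(1) by (simp add: dist_norm)
      moreover have "\<psi> x + complex_of_real (d2 * x\<^sup>2 / 2) =
          (\<psi> x / complex_of_real (x\<^sup>2) + complex_of_real (d2 / 2)) * complex_of_real (x\<^sup>2)"
        using False by (simp add: field_simps)
      ultimately show ?thesis
        by (simp add: norm_mult norm_power mult_right_mono less_imp_le)
    qed simp
  qed (use \<delta> in auto)
qed

text \<open>exp(psi u) is a value of a characteristic function, so its modulus exp(Re psi u) is at
  most 1. This keeps exponents in the half-plane of \<open>cmod_exp_diff_le\<close>.\<close>

lemma Re_exponent_nonpos: "Re (\<psi> u) \<le> 0"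
proof -
  have "cmod (exp (\<psi> u)) \<le> 1"
  proof -
    have "exp (\<psi> u) = (\<integral>\<omega>. cis (u * (L0 1 \<omega> - L0 0 \<omega>)) \<partial>M)"
      using L_char(1)[of 0 1 u] by simp
    also have "cmod \<dots> \<le> (\<integral>\<omega>. cmod (cis (u * (L0 1 \<omega> - L0 0 \<omega>))) \<partial>M)"
      by (rule integral_norm_bound)
    finally show ?thesis by (simp add: prob_space)
  qed
  then show ?thesis by simp
qed

text \<open>The expansion of psi obtained from L(1) is multiplied by tau and brought back through
  \<open>expm1_quot\<close> to the characteristic function of \<open>X\<close>, from which
  \<open>moments_from_char\<close> reads off the moments.\<close>

lemma moments_increment:
  assumes X [measurable]: "X \<in> borel_measurable M" and "0 \<le> \<tau>"
    and char: "\<And>u. (\<integral>\<omega>. cis (u * X \<omega>) \<partial>M) = exp (complex_of_real \<tau> * \<psi> u)"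
  shows "sq_integrable M X" "expectation X = 0" "expectation (\<lambda>\<omega>. (X \<omega>)\<^sup>2) = \<tau> * d2"
proof -
  define u where "u n = inverse (real (Suc n))" for n
  have u: "u \<longlonglongrightarrow> 0" "\<And>n. u n \<noteq> 0"
    using LIMSEQ_inverse_real_of_nat by (auto simp: u_def[abs_def])
  have "(\<lambda>n. complex_of_real \<tau> * \<psi> (u n)) \<longlonglongrightarrow> complex_of_real \<tau> * 0"
    by (intro tendsto_intros levy_exponent_tendsto_0[OF triplet u(1)])
  then have lim: "(\<lambda>n. complex_of_real \<tau> * (\<psi> (u n) / complex_of_real ((u n)\<^sup>2)) * expm1_quot (complex_of_real \<tau> * \<psi> (u n)))
     \<longlonglongrightarrow> complex_of_real \<tau> * complex_of_real (- d2 / 2) * 1"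
    by (intro tendsto_mult tendsto_const exponent_quadratic[OF u] expm1_quot_tendsto) simp
  have eq: "complex_of_real \<tau> * (\<psi> (u n) / complex_of_real ((u n)\<^sup>2)) * expm1_quot (complex_of_real \<tau> * \<psi> (u n)) =
     ((\<integral>\<omega>. cis (u n * X \<omega>) \<partial>M) - 1) / complex_of_real ((u n)\<^sup>2)" for n
    unfolding char expm1_quot by simp
  have "complex_of_real \<tau> * complex_of_real (- d2 / 2) * 1 = complex_of_real (- (\<tau> * d2) / 2)" by simp
  then have "(\<lambda>n. ((\<integral>\<omega>. cis (u n * X \<omega>) \<partial>M) - 1) / complex_of_real ((u n)\<^sup>2)) \<longlonglongrightarrow> complex_of_real (- (\<tau> * d2) / 2)"
    using lim unfolding eq by (simp only:)
  from moments_from_char[OF X this[unfolded u_def]]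
  show "sq_integrable M X" "expectation X = 0" "expectation (\<lambda>\<omega>. (X \<omega>)\<^sup>2) = \<tau> * d2" by auto
qed

lemma moments_L:
  assumes "0 \<le> s" "s \<le> t"
  shows "sq_integrable M (\<lambda>\<omega>. L0 t \<omega> - L0 s \<omega>)" "expectation (\<lambda>\<omega>. L0 t \<omega> - L0 s \<omega>) = 0"
    "expectation (\<lambda>\<omega>. (L0 t \<omega> - L0 s \<omega>)\<^sup>2) = (t - s) * d2"
    "sq_integrable M (\<lambda>\<omega>. L1 t \<omega> - L1 s \<omega>)" "expectation (\<lambda>\<omega>. L1 t \<omega> - L1 s \<omega>) = 0"
    "expectation (\<lambda>\<omega>. (L1 t \<omega> - L1 s \<omega>)\<^sup>2) = (t - s) * d2"
proof -
  have [measurable]: "L0 s \<in> borel_measurable M" "L0 t \<in> borel_measurable M"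
    "L1 s \<in> borel_measurable M" "L1 t \<in> borel_measurable M"
    using L_measurable assms by auto
  have m0: "(\<lambda>\<omega>. L0 t \<omega> - L0 s \<omega>) \<in> borel_measurable M" and m1: "(\<lambda>\<omega>. L1 t \<omega> - L1 s \<omega>) \<in> borel_measurable M"
    by measurable
  note m = moments_increment[OF m0 _ L_char(1)[OF assms]] moments_increment[OF m1 _ L_char(2)[OF assms]]
  show "sq_integrable M (\<lambda>\<omega>. L0 t \<omega> - L0 s \<omega>)" "expectation (\<lambda>\<omega>. L0 t \<omega> - L0 s \<omega>) = 0"
    "expectation (\<lambda>\<omega>. (L0 t \<omega> - L0 s \<omega>)\<^sup>2) = (t - s) * d2"
    "sq_integrable M (\<lambda>\<omega>. L1 t \<omega> - L1 s \<omega>)" "expectation (\<lambda>\<omega>. L1 t \<omega> - L1 s \<omega>) = 0"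
    "expectation (\<lambda>\<omega>. (L1 t \<omega> - L1 s \<omega>)\<^sup>2) = (t - s) * d2"
    using m assms by auto
qed

lemma two_sided_measurable [measurable]: "L t \<in> borel_measurable M"
  using L_measurable[of t] L_measurable[of "- t"] by (cases "0 \<le> t") (auto simp: two_sided_def[abs_def])

lemma two_sided_increment:
  assumes "s \<le> t"
  shows "sq_integrable M (\<lambda>\<omega>. L t \<omega> - L s \<omega>)" "expectation (\<lambda>\<omega>. (L t \<omega> - L s \<omega>)\<^sup>2) = (t - s) * d2"
proof -
  have "sq_integrable M (\<lambda>\<omega>. L t \<omega> - L s \<omega>) \<and> expectation (\<lambda>\<omega>. (L t \<omega> - L s \<omega>)\<^sup>2) = (t - s) * d2"
  proof -
    consider "0 \<le> s" | "t < 0" | "s < 0" "0 \<le> t" using assms by linarith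
    then show ?thesis
    proof cases
      case 1
      then show ?thesis using moments_L[of s t] assms by (simp add: two_sided_def)
    next
      case 2
      then have "L t \<omega> - L s \<omega> = L1 (- s) \<omega> - L1 (- t) \<omega>" for \<omega>
        using assms by (simp add: two_sided_def)
      then show ?thesis using moments_L(4,6)[of "- t" "- s"] assms 2 by simp
    next
      \<comment> \<open>The interval contains 0: up to a null set the increment is the sum of an
        increment of \<open>L0\<close> and one of \<open>L1\<close>, independent and centred, so the
        mixed term vanishes.\<close>
      case 3
      let ?A = "\<lambda>\<omega>. L0 t \<omega> - L0 0 \<omega>" and ?B = "\<lambda>\<omega>. L1 (- s) \<omega> - L1 0 \<omega>"
      have A: "sq_integrable M ?A" "expectation ?A = 0" "expectation (\<lambda>\<omega>. (?A \<omega>)\<^sup>2) = t * d2"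
        using moments_L(1-3)[of 0 t] 3 by auto
      have B: "sq_integrable M ?B" "expectation ?B = 0" "expectation (\<lambda>\<omega>. (?B \<omega>)\<^sup>2) = - s * d2"
        using moments_L(4-6)[of 0 "- s"] 3 by auto
      have "indep_var borel ?A borel ?B"
        using 3 by (intro L_indep borel_measurable_diff proc_measurable) auto
      then have AB: "expectation (\<lambda>\<omega>. ?A \<omega> * ?B \<omega>) = 0"
        using indep_var_lebesgue_integral[of ?A ?B] A B
          sq_integrable_mult[OF A(1), of "\<lambda>_. 1"] sq_integrable_mult[OF B(1), of "\<lambda>_. 1"]
        by (simp add: sq_integrable_def)
      have ae: "AE \<omega> in M. ?A \<omega> + ?B \<omega> = L t \<omega> - L s \<omega>"
        using L_0 by eventually_elim (use 3 in \<open>auto simp: two_sided_def\<close>)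
      have sqAB: "sq_integrable M (\<lambda>\<omega>. ?A \<omega> + ?B \<omega>)" using A(1) B(1) by (rule sq_integrable_add)
      have "integrable M (\<lambda>\<omega>. (?A \<omega> + ?B \<omega>)\<^sup>2) \<longleftrightarrow> integrable M (\<lambda>\<omega>. (L t \<omega> - L s \<omega>)\<^sup>2)"
        using ae sqAB by (intro integrable_cong_AE) auto
      then have sqL: "sq_integrable M (\<lambda>\<omega>. L t \<omega> - L s \<omega>)"
        using sqAB by (auto simp: sq_integrable_def)
      have "expectation (\<lambda>\<omega>. (L t \<omega> - L s \<omega>)\<^sup>2) = expectation (\<lambda>\<omega>. (?A \<omega> + ?B \<omega>)\<^sup>2)"
        using ae sqAB by (intro integral_cong_AE) auto
      also have "\<dots> = expectation (\<lambda>\<omega>. (?A \<omega>)\<^sup>2 + (?B \<omega>)\<^sup>2 + 2 * (?A \<omega> * ?B \<omega>))"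
        by (simp only: power2_sum mult.assoc)
      also have "\<dots> = expectation (\<lambda>\<omega>. (?A \<omega>)\<^sup>2) + expectation (\<lambda>\<omega>. (?B \<omega>)\<^sup>2) + 2 * expectation (\<lambda>\<omega>. ?A \<omega> * ?B \<omega>)"
        using sq_integrable_square[OF A(1)] sq_integrable_square[OF B(1)] sq_integrable_mult[OF A(1) B(1)]
        by (simp only: Bochner_Integration.integral_add Bochner_Integration.integrable_add
          integral_mult_right_zero integrable_mult_right)
      also have "\<dots> = (t - s) * d2" unfolding AB A(3) B(3) by (simp add: algebra_simps)
      finally show ?thesis using sqL by blast
    qed
  qed
  then show "sq_integrable M (\<lambda>\<omega>. L t \<omega> - L s \<omega>)" "expectation (\<lambda>\<omega>. (L t \<omega> - L s \<omega>)\<^sup>2) = (t - s) * d2" by auto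
qed

text \<open>The polarization identity in \<open>increment_covariance\<close> uses increments whose
  end points come in either order.\<close>

lemma two_sided_increment_abs:
  "sq_integrable M (\<lambda>\<omega>. L t \<omega> - L s \<omega>)" "expectation (\<lambda>\<omega>. (L t \<omega> - L s \<omega>)\<^sup>2) = \<bar>t - s\<bar> * d2"
proof -
  have "sq_integrable M (\<lambda>\<omega>. L t \<omega> - L s \<omega>) \<and> expectation (\<lambda>\<omega>. (L t \<omega> - L s \<omega>)\<^sup>2) = \<bar>t - s\<bar> * d2"
  proof (cases "s \<le> t")
    case False
    have "sq_integrable M (\<lambda>\<omega>. - 1 * (L s \<omega> - L t \<omega>))"
      using two_sided_increment(1)[of t s] False by (intro sq_integrable_cmult) auto
    moreover have "expectation (\<lambda>\<omega>. (L t \<omega> - L s \<omega>)\<^sup>2) = \<bar>t - s\<bar> * d2"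
      using two_sided_increment(2)[of t s] False by (simp add: power2_commute)
    ultimately show ?thesis by simp
  qed (use two_sided_increment in auto)
  then show "sq_integrable M (\<lambda>\<omega>. L t \<omega> - L s \<omega>)" "expectation (\<lambda>\<omega>. (L t \<omega> - L s \<omega>)\<^sup>2) = \<bar>t - s\<bar> * d2" by auto
qed

lemma increment_covariance:
  assumes "s \<le> t" "u \<le> v"
  shows "expectation (\<lambda>\<omega>. (L t \<omega> - L s \<omega>) * (L v \<omega> - L u \<omega>)) =
    d2 * (LINT x|lborel. indicator {s<..t} x * indicator {u<..v} x)"
proof -
  \<comment> \<open>Polarization reduces the claim to the variances of increments.\<close>
  note i = two_sided_increment_abs(1)[THEN sq_integrable_square]
  have "expectation (\<lambda>\<omega>. (L t \<omega> - L s \<omega>) * (L v \<omega> - L u \<omega>)) =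
    expectation (\<lambda>\<omega>. ((L t \<omega> - L u \<omega>)\<^sup>2 + (L s \<omega> - L v \<omega>)\<^sup>2 - (L t \<omega> - L v \<omega>)\<^sup>2 - (L s \<omega> - L u \<omega>)\<^sup>2) / 2)"
    by (intro Bochner_Integration.integral_cong) (auto simp: power2_eq_square algebra_simps)
  also have "\<dots> = (expectation (\<lambda>\<omega>. (L t \<omega> - L u \<omega>)\<^sup>2) + expectation (\<lambda>\<omega>. (L s \<omega> - L v \<omega>)\<^sup>2)
     - expectation (\<lambda>\<omega>. (L t \<omega> - L v \<omega>)\<^sup>2) - expectation (\<lambda>\<omega>. (L s \<omega> - L u \<omega>)\<^sup>2)) / 2"
    using i[of t u] i[of s v] i[of t v] i[of s u] by simp
  also have "\<dots> = d2 * ((\<bar>t - u\<bar> + \<bar>s - v\<bar> - \<bar>t - v\<bar> - \<bar>s - u\<bar>) / 2)"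
    unfolding two_sided_increment_abs(2) by (simp add: algebra_simps)
  \<comment> \<open>The signed sum of distances is twice the length of the overlap of the two
    intervals.\<close>
  also have "\<bar>t - u\<bar> + \<bar>s - v\<bar> - \<bar>t - v\<bar> - \<bar>s - u\<bar> = 2 * max 0 (min t v - max s u)"
    using assms by (cases "t \<le> v"; cases "s \<le> u"; cases "t \<le> u"; cases "s \<le> v")
      (simp_all add: min_absorb1 min_absorb2 max_absorb1 max_absorb2)
  also have "\<dots> / 2 = max 0 (min t v - max s u)" by simp
  also have "\<dots> = measure lborel {max s u<..min t v}"
    by (cases "max s u \<le> min t v") auto
  also have "\<dots> = (LINT x|lborel. indicator {max s u<..min t v} x)" by simp
  also have "\<dots> = (LINT x|lborel. indicator {s<..t} x * indicator {u<..v} x)"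
    by (intro Bochner_Integration.integral_cong) (auto simp: indicator_def)
  finally show ?thesis .
qed

end

section \<open>The isometry of the stochastic integral\<close>

lemma emeasure_lborel_Ioc_less_top: "emeasure lborel {s<..t::real} < top"
proof -
  have "bounded {s<..t}" by (rule bounded_subset[OF bounded_closed_interval[of s t]]) auto
  from emeasure_bounded_finite[OF this] show ?thesis by simp
qed

lemma char_distr_1:
  assumes [measurable]: "X \<in> borel_measurable M"
  shows "char (distr M borel X) 1 = (\<integral>\<omega>. cis (X \<omega>) \<partial>M)"
  by (simp add: char_def integral_distr cis_conv_exp)

lemma sq_integrable_step_fun: "sq_integrable lborel (step_fun c s t n)"
proof -
  have "sq_integrable lborel (\<lambda>x. c k * indicator {s k<..t k} x :: real)" for k
  proof (rule sq_integrable_cmult, rule sq_integrableI)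
    have "integrable lborel (indicator {s k<..t k} :: real \<Rightarrow> real)"
      by (intro integrable_real_indicator) (auto simp: emeasure_lborel_Ioc_less_top)
    moreover have "(indicator {s k<..t k} x :: real)\<^sup>2 = indicator {s k<..t k} x" for x
      by (simp add: indicator_def)
    ultimately show "integrable lborel (\<lambda>x. (indicator {s k<..t k} x :: real)\<^sup>2)" by simp
  qed measurable
  then show ?thesis unfolding step_fun_def[abs_def] by (intro sq_integrable_sum)
qed

context centered_levy
begin

lemma sq_integrable_step_int: "sq_integrable M (step_int L c s t n)"
  unfolding step_int_def[abs_def] by (intro sq_integrable_sum sq_integrable_cmult two_sided_increment_abs(1))

lemma step_int_isometry:
  assumes "\<And>k. s k \<le> t k" "\<And>k. s' k \<le> t' k"
  shows "expectation (\<lambda>\<omega>. step_int L c s t n \<omega> * step_int L c' s' t' n' \<omega>) =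
    d2 * (LINT x|lborel. step_fun c s t n x * step_fun c' s' t' n' x)"
proof -
  let ?I = "\<lambda>k x. indicator {s k<..t k} x :: real" and ?I' = "\<lambda>k x. indicator {s' k<..t' k} x :: real"
  have "expectation (\<lambda>\<omega>. step_int L c s t n \<omega> * step_int L c' s' t' n' \<omega>) =
    expectation (\<lambda>\<omega>. \<Sum>k<n. \<Sum>j<n'. c k * c' j * ((L (t k) \<omega> - L (s k) \<omega>) * (L (t' j) \<omega> - L (s' j) \<omega>)))"
    unfolding step_int_def sum_product by (simp add: mult_ac)
  also have "\<dots> = (\<Sum>k<n. \<Sum>j<n'. c k * c' j * expectation (\<lambda>\<omega>. (L (t k) \<omega> - L (s k) \<omega>) * (L (t' j) \<omega> - L (s' j) \<omega>)))"
    by (subst Bochner_Integration.integral_sum, intro Bochner_Integration.integrable_sum integrable_mult_right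
      sq_integrable_mult two_sided_increment_abs(1))
      (simp add: Bochner_Integration.integral_sum sq_integrable_mult two_sided_increment_abs(1))
  also have "\<dots> = (\<Sum>k<n. \<Sum>j<n'. c k * c' j * (d2 * (LINT x|lborel. ?I k x * ?I' j x)))"
    by (simp add: increment_covariance assms)
  also have "\<dots> = d2 * (\<Sum>k<n. \<Sum>j<n'. c k * c' j * (LINT x|lborel. ?I k x * ?I' j x))"
    by (simp add: sum_distrib_left mult_ac)
  also have "(\<Sum>k<n. \<Sum>j<n'. c k * c' j * (LINT x|lborel. ?I k x * ?I' j x)) =
     (LINT x|lborel. (\<Sum>k<n. \<Sum>j<n'. c k * c' j * (?I k x * ?I' j x)))"
  proof -
    have i: "integrable lborel (\<lambda>x. ?I k x * ?I' j x)" for k j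
    proof -
      have "integrable lborel (?I k)"
        by (intro integrable_real_indicator) (auto simp: emeasure_lborel_Ioc_less_top)
      then show ?thesis
        by (rule Bochner_Integration.integrable_bound) (auto simp: indicator_def)
    qed
    show ?thesis
      by (subst Bochner_Integration.integral_sum, intro Bochner_Integration.integrable_sum integrable_mult_right i)
        (simp add: Bochner_Integration.integral_sum i)
  qed
  also have "\<dots> = (LINT x|lborel. step_fun c s t n x * step_fun c' s' t' n' x)"
    unfolding step_fun_def sum_product by (simp add: mult_ac)
  finally show ?thesis .
qed

text \<open>The approximating sequence is constant. Thereby a step integral may be a factor in
  \<open>stoch_integral_isometry\<close>.\<close>

lemma is_stoch_integral_step:
  assumes "\<And>k. s k \<le> t k"
  shows "is_stoch_integral M L (step_fun c s t n) (step_int L c s t n)"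
  unfolding is_stoch_integral_def
proof (intro conjI exI)
  show "step_int L c s t n \<in> borel_measurable M"
    using sq_integrable_step_int by auto
  show "\<forall>m k. (\<lambda>_. s) m k \<le> (\<lambda>_. t) m k" using assms by simp
  show "(\<lambda>m. \<integral>\<^sup>+x. ennreal ((step_fun c s t n x - step_fun ((\<lambda>_::nat. c) m) ((\<lambda>_. s) m) ((\<lambda>_. t) m) ((\<lambda>_. n) m) x)\<^sup>2) \<partial>lborel) \<longlonglongrightarrow> 0"
    by simp
  show "(\<lambda>m. \<integral>\<^sup>+\<omega>. ennreal ((step_int L c s t n \<omega> - step_int L ((\<lambda>_::nat. c) m) ((\<lambda>_. s) m) ((\<lambda>_. t) m) ((\<lambda>_. n) m) \<omega>)\<^sup>2) \<partial>M) \<longlonglongrightarrow> 0"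
    by simp
qed

text \<open>The two integrals come with unrelated approximating sequences; the bilinear
  \<open>step_int_isometry\<close> holds for each pair of approximants, and
  \<open>tendsto_integral_mult\<close> takes the limit on both sides.\<close>

lemma stoch_integral_isometry:
  assumes X: "is_stoch_integral M L f X" and Y: "is_stoch_integral M L g Y"
    and [measurable]: "f \<in> borel_measurable borel" "g \<in> borel_measurable borel"
  shows "sq_integrable M X" "sq_integrable M Y"
    and "expectation (\<lambda>\<omega>. X \<omega> * Y \<omega>) = d2 * (LINT x|lborel. f x * g x)"
proof -
  obtain C S T N where X': "\<And>m k. S m k \<le> T m k"
      "(\<lambda>m. \<integral>\<^sup>+x. ennreal ((f x - step_fun (C m) (S m) (T m) (N m) x)\<^sup>2) \<partial>lborel) \<longlonglongrightarrow> 0"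
      "(\<lambda>m. \<integral>\<^sup>+\<omega>. ennreal ((X \<omega> - step_int L (C m) (S m) (T m) (N m) \<omega>)\<^sup>2) \<partial>M) \<longlonglongrightarrow> 0"
    using X unfolding is_stoch_integral_def by blast
  obtain C' S' T' N' where Y': "\<And>m k. S' m k \<le> T' m k"
      "(\<lambda>m. \<integral>\<^sup>+x. ennreal ((g x - step_fun (C' m) (S' m) (T' m) (N' m) x)\<^sup>2) \<partial>lborel) \<longlonglongrightarrow> 0"
      "(\<lambda>m. \<integral>\<^sup>+\<omega>. ennreal ((Y \<omega> - step_int L (C' m) (S' m) (T' m) (N' m) \<omega>)\<^sup>2) \<partial>M) \<longlonglongrightarrow> 0"
    using Y unfolding is_stoch_integral_def by blast
  have [measurable]: "X \<in> borel_measurable M" "Y \<in> borel_measurable M"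
    using X Y by (auto simp: is_stoch_integral_def)
  have fm: "f \<in> borel_measurable lborel" "g \<in> borel_measurable lborel" by auto
  note lX = sq_integrable_nn_limit[OF sq_integrable_step_int _ X'(3)]
  note lY = sq_integrable_nn_limit[OF sq_integrable_step_int _ Y'(3)]
  note lf = sq_integrable_nn_limit[OF sq_integrable_step_fun fm(1) X'(2)]
  note lg = sq_integrable_nn_limit[OF sq_integrable_step_fun fm(2) Y'(2)]
  show sX: "sq_integrable M X" and sY: "sq_integrable M Y" using lX(1) lY(1) by auto
  have "(\<lambda>m. expectation (\<lambda>\<omega>. step_int L (C m) (S m) (T m) (N m) \<omega> * step_int L (C' m) (S' m) (T' m) (N' m) \<omega>))
     \<longlonglongrightarrow> expectation (\<lambda>\<omega>. X \<omega> * Y \<omega>)"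
    by (intro tendsto_integral_mult sq_integrable_step_int sX sY lX(2) lY(2)) auto
  moreover have "(\<lambda>m. d2 * (LINT x|lborel. step_fun (C m) (S m) (T m) (N m) x * step_fun (C' m) (S' m) (T' m) (N' m) x))
     \<longlonglongrightarrow> d2 * (LINT x|lborel. f x * g x)"
    by (intro tendsto_mult tendsto_const tendsto_integral_mult sq_integrable_step_fun lf lg)
  ultimately show "expectation (\<lambda>\<omega>. X \<omega> * Y \<omega>) = d2 * (LINT x|lborel. f x * g x)"
    unfolding step_int_isometry[OF X'(1) Y'(1)] by (rule LIMSEQ_unique)
qed

section \<open>Characteristic functions of integrals over a uniform grid\<close>

lemma levy_char_sum:
  assumes lp: "levy_process M a b Lm X" and "\<delta> > 0"
  shows "(\<integral>\<omega>. cis (\<Sum>k<m. c k * (X (\<delta> * real (Suc k)) \<omega> - X (\<delta> * real k) \<omega>)) \<partial>M) =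
    exp (\<Sum>k<m. complex_of_real \<delta> * \<psi> (c k))"
proof -
  define ts where "ts k = \<delta> * real k" for k :: nat
  let ?D = "\<lambda>k \<omega>. X (ts (Suc k)) \<omega> - X (ts k) \<omega>"
  have ts: "0 \<le> ts k" "ts k < ts (Suc k)" for k using \<open>\<delta> > 0\<close> by (auto simp: ts_def)
  have [measurable]: "X (ts k) \<in> borel_measurable M" for k
    using ts by (intro levy_process_measurable[OF lp])
  have "indep_vars (\<lambda>_. borel) ?D {..<m}"
    using ts by (intro levy_process_indep[OF lp]) auto
  then have ind: "indep_vars (\<lambda>_. borel) (\<lambda>k \<omega>. c k * ?D k \<omega>) {..<m}"
    by (rule indep_vars_compose2[where Y="\<lambda>k x. c k * x"]) simp
  have "(\<integral>\<omega>. cis (\<Sum>k<m. c k * ?D k \<omega>) \<partial>M) = char (distr M borel (\<lambda>\<omega>. \<Sum>k<m. c k * ?D k \<omega>)) 1"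
    by (simp add: char_def integral_distr cis_conv_exp)
  also have "\<dots> = (\<Prod>k<m. char (distr M borel (\<lambda>\<omega>. c k * ?D k \<omega>)) 1)"
    using char_distr_sum[OF ind] by simp
  also have "\<dots> = (\<Prod>k<m. exp (complex_of_real \<delta> * \<psi> (c k)))"
  proof (rule prod.cong[OF refl])
    fix k
    have "char (distr M borel (\<lambda>\<omega>. c k * ?D k \<omega>)) 1 = (\<integral>\<omega>. cis (c k * ?D k \<omega>) \<partial>M)"
      by (simp add: char_def integral_distr cis_conv_exp)
    also have "\<dots> = exp (complex_of_real (ts (Suc k) - ts k) * \<psi> (c k))"
      using ts by (intro levy_process_char[OF lp]) (auto intro: less_imp_le)
    also have "ts (Suc k) - ts k = \<delta>" by (simp add: ts_def algebra_simps)
    finally show "char (distr M borel (\<lambda>\<omega>. c k * ?D k \<omega>)) 1 = exp (complex_of_real \<delta> * \<psi> (c k))" .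
  qed
  also have "\<dots> = exp (\<Sum>k<m. complex_of_real \<delta> * \<psi> (c k))" by (simp add: exp_sum)
  finally show ?thesis by (simp only: ts_def)
qed

text \<open>The grid is split at 0, with \<open>m\<close> cells on each side, so that every cell
  concerns only one of \<open>L0\<close> and \<open>L1\<close>. The coefficients \<open>c'\<close>
  run outwards from 0 to the left.\<close>

definition grid_int :: "real \<Rightarrow> (nat \<Rightarrow> real) \<Rightarrow> (nat \<Rightarrow> real) \<Rightarrow> nat \<Rightarrow> 'w \<Rightarrow> real" where
  "grid_int \<delta> c c' m \<omega> =
    step_int L c (\<lambda>k. \<delta> * real k) (\<lambda>k. \<delta> * real (Suc k)) m \<omega>
  + step_int L c' (\<lambda>k. - (\<delta> * real (Suc k))) (\<lambda>k. - (\<delta> * real k)) m \<omega>"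

end

definition grid_fun :: "real \<Rightarrow> (nat \<Rightarrow> real) \<Rightarrow> (nat \<Rightarrow> real) \<Rightarrow> nat \<Rightarrow> real \<Rightarrow> real" where
  "grid_fun \<delta> c c' m x =
    step_fun c (\<lambda>k. \<delta> * real k) (\<lambda>k. \<delta> * real (Suc k)) m x
  + step_fun c' (\<lambda>k. - (\<delta> * real (Suc k))) (\<lambda>k. - (\<delta> * real k)) m x"

context centered_levy
begin

lemma grid_int_char:
  assumes "\<delta> > 0"
  shows "(\<integral>\<omega>. cis (grid_int \<delta> c c' m \<omega>) \<partial>M) =
    exp (complex_of_real \<delta> * ((\<Sum>k<m. \<psi> (c k)) + (\<Sum>k<m. \<psi> (c' k))))"
proof -
  let ?A = "\<lambda>\<omega>. \<Sum>k<m. c k * (L0 (\<delta> * real (Suc k)) \<omega> - L0 (\<delta> * real k) \<omega>)"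
  let ?B = "\<lambda>\<omega>. \<Sum>k<m. c' k * (L1 (\<delta> * real (Suc k)) \<omega> - L1 (\<delta> * real k) \<omega>)"
  have nn: "0 \<le> \<delta> * real k" for k using assms by simp
  have [measurable]: "L0 (\<delta> * real k) \<in> borel_measurable M" "L1 (\<delta> * real k) \<in> borel_measurable M" for k
    using nn L_measurable by auto
  have AB: "indep_var borel ?A borel ?B"
    using nn by (intro L_indep borel_measurable_sum borel_measurable_times borel_measurable_const
      borel_measurable_diff proc_measurable)
  have "AE \<omega> in M. grid_int \<delta> c c' m \<omega> = ?A \<omega> + ?B \<omega>"
    using L_0
  proof eventually_elim
    case (elim \<omega>)
    have "step_int L c (\<lambda>k. \<delta> * real k) (\<lambda>k. \<delta> * real (Suc k)) m \<omega> = ?A \<omega>"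
      using nn unfolding step_int_def two_sided_def by (simp del: of_nat_Suc)
    moreover have "step_int L c' (\<lambda>k. - (\<delta> * real (Suc k))) (\<lambda>k. - (\<delta> * real k)) m \<omega> = ?B \<omega>"
      unfolding step_int_def
    proof (rule sum.cong[OF refl])
      fix k
      have neg: "\<not> 0 \<le> - (\<delta> * real (Suc k))" using assms by (simp add: mult_pos_pos not_le del: of_nat_Suc)
      \<comment> \<open>At k = 0 the point is 0, where \<open>two_sided\<close> takes the branch of
        \<open>L0\<close>; both processes vanish there almost surely, so the formula
        persists.\<close>
      have "L (- (\<delta> * real k)) \<omega> = - L1 (\<delta> * real k) \<omega>"
      proof (cases "k = 0")
        case True
        then show ?thesis using elim by (simp add: two_sided_def)
      next
        case False
        then have "\<not> 0 \<le> - (\<delta> * real k)" using assms by (simp add: not_le)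
        then show ?thesis by (simp add: two_sided_def)
      qed
      then show "c' k * (L (- (\<delta> * real k)) \<omega> - L (- (\<delta> * real (Suc k))) \<omega>) =
          c' k * (L1 (\<delta> * real (Suc k)) \<omega> - L1 (\<delta> * real k) \<omega>)"
        using neg by (simp add: two_sided_def del: of_nat_Suc)
    qed
    ultimately show ?case by (simp only: grid_int_def)
  qed
  moreover have "grid_int \<delta> c c' m \<in> borel_measurable M"
    unfolding grid_int_def[abs_def] step_int_def by measurable
  ultimately have "(\<integral>\<omega>. cis (grid_int \<delta> c c' m \<omega>) \<partial>M) = (\<integral>\<omega>. cis (?A \<omega> + ?B \<omega>) \<partial>M)"
    by (intro integral_cong_AE) (auto simp del: of_nat_Suc)
  also have "\<dots> = char (distr M borel (\<lambda>\<omega>. ?A \<omega> + ?B \<omega>)) 1"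
    by (intro char_distr_1[symmetric]) measurable
  also have "\<dots> = char (distr M borel ?A) 1 * char (distr M borel ?B) 1"
    by (rule char_distr_add[OF AB])
  also have "char (distr M borel ?A) 1 = (\<integral>\<omega>. cis (?A \<omega>) \<partial>M)"
    by (intro char_distr_1) measurable
  also have "char (distr M borel ?B) 1 = (\<integral>\<omega>. cis (?B \<omega>) \<partial>M)"
    by (intro char_distr_1) measurable
  finally show ?thesis
    unfolding levy_char_sum[OF lp(1) assms] levy_char_sum[OF lp(2) assms]
    by (simp add: exp_add[symmetric] sum_distrib_left distrib_left)
qed

lemma sq_integrable_grid_int: "sq_integrable M (grid_int \<delta> c c' m)"
  unfolding grid_int_def[abs_def] by (intro sq_integrable_add sq_integrable_step_int)

end

lemma sq_integrable_grid_fun: "sq_integrable lborel (grid_fun \<delta> c c' m)"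
  unfolding grid_fun_def[abs_def] by (intro sq_integrable_add sq_integrable_step_fun)

context centered_levy
begin

lemma grid_isometry:
  assumes X: "is_stoch_integral M L f X" and f [measurable]: "f \<in> borel_measurable borel" "sq_integrable lborel f" and "\<delta> > 0"
  shows "expectation (\<lambda>\<omega>. X \<omega> * grid_int \<delta> c c' m \<omega>) = d2 * (LINT x|lborel. f x * grid_fun \<delta> c c' m x)"
proof -
  let ?s = "\<lambda>k. \<delta> * real k" and ?t = "\<lambda>k. \<delta> * real (Suc k)"
  let ?s' = "\<lambda>k. - (\<delta> * real (Suc k))" and ?t' = "\<lambda>k. - (\<delta> * real k)"
  have st: "?s k \<le> ?t k" "?s' k \<le> ?t' k" for k using \<open>\<delta> > 0\<close> by auto
  have m: "step_fun c s t n \<in> borel_measurable borel" for c s t n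
    using sq_integrable_measurable[OF sq_integrable_step_fun[of c s t n]] by simp
  note 1 = stoch_integral_isometry[OF X is_stoch_integral_step[of ?s ?t c m] f(1) m, OF st(1)]
  note 2 = stoch_integral_isometry[OF X is_stoch_integral_step[of ?s' ?t' c' m] f(1) m, OF st(2)]
  have "expectation (\<lambda>\<omega>. X \<omega> * grid_int \<delta> c c' m \<omega>) =
    expectation (\<lambda>\<omega>. X \<omega> * step_int L c ?s ?t m \<omega> + X \<omega> * step_int L c' ?s' ?t' m \<omega>)"
    by (simp only: grid_int_def distrib_left)
  also have "\<dots> = expectation (\<lambda>\<omega>. X \<omega> * step_int L c ?s ?t m \<omega>) + expectation (\<lambda>\<omega>. X \<omega> * step_int L c' ?s' ?t' m \<omega>)"
    by (intro Bochner_Integration.integral_add sq_integrable_mult 1 2)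
  also have "\<dots> = d2 * ((LINT x|lborel. f x * step_fun c ?s ?t m x) + (LINT x|lborel. f x * step_fun c' ?s' ?t' m x))"
    unfolding 1(3) 2(3) by (simp only: distrib_left)
  also have "(LINT x|lborel. f x * step_fun c ?s ?t m x) + (LINT x|lborel. f x * step_fun c' ?s' ?t' m x) =
    (LINT x|lborel. f x * step_fun c ?s ?t m x + f x * step_fun c' ?s' ?t' m x)"
    by (intro Bochner_Integration.integral_add[symmetric] sq_integrable_mult f sq_integrable_step_fun)
  finally show ?thesis by (simp only: grid_fun_def distrib_left)
qed

lemma grid_int_square:
  assumes "\<delta> > 0"
  shows "expectation (\<lambda>\<omega>. (grid_int \<delta> c c' m \<omega>)\<^sup>2) = d2 * (LINT x|lborel. (grid_fun \<delta> c c' m x)\<^sup>2)"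
proof -
  let ?s = "\<lambda>k. \<delta> * real k" and ?t = "\<lambda>k. \<delta> * real (Suc k)"
  let ?s' = "\<lambda>k. - (\<delta> * real (Suc k))" and ?t' = "\<lambda>k. - (\<delta> * real k)"
  let ?A = "step_int L c ?s ?t m" and ?B = "step_int L c' ?s' ?t' m"
  have st: "?s k \<le> ?t k" "?s' k \<le> ?t' k" for k using \<open>\<delta> > 0\<close> by auto
  have m: "step_fun c s t n \<in> borel_measurable borel" for c s t n
    using sq_integrable_measurable[OF sq_integrable_step_fun[of c s t n]] by simp
  have "expectation (\<lambda>\<omega>. (grid_int \<delta> c c' m \<omega>)\<^sup>2) = expectation (\<lambda>\<omega>. ?A \<omega> * grid_int \<delta> c c' m \<omega> + ?B \<omega> * grid_int \<delta> c c' m \<omega>)"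
    by (simp only: power2_eq_square grid_int_def distrib_right)
  also have "\<dots> = expectation (\<lambda>\<omega>. ?A \<omega> * grid_int \<delta> c c' m \<omega>) + expectation (\<lambda>\<omega>. ?B \<omega> * grid_int \<delta> c c' m \<omega>)"
    by (intro Bochner_Integration.integral_add sq_integrable_mult sq_integrable_step_int sq_integrable_grid_int)
  also have "\<dots> = d2 * ((LINT x|lborel. step_fun c ?s ?t m x * grid_fun \<delta> c c' m x) +
      (LINT x|lborel. step_fun c' ?s' ?t' m x * grid_fun \<delta> c c' m x))"
    using grid_isometry[OF is_stoch_integral_step[of ?s ?t c m, OF st(1)] m sq_integrable_step_fun assms]
      grid_isometry[OF is_stoch_integral_step[of ?s' ?t' c' m, OF st(2)] m sq_integrable_step_fun assms]
    by (simp only: distrib_left)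
  also have "(LINT x|lborel. step_fun c ?s ?t m x * grid_fun \<delta> c c' m x) +
      (LINT x|lborel. step_fun c' ?s' ?t' m x * grid_fun \<delta> c c' m x) =
      (LINT x|lborel. step_fun c ?s ?t m x * grid_fun \<delta> c c' m x + step_fun c' ?s' ?t' m x * grid_fun \<delta> c c' m x)"
    by (intro Bochner_Integration.integral_add[symmetric] sq_integrable_mult sq_integrable_grid_fun sq_integrable_step_fun)
  finally show ?thesis by (simp only: power2_eq_square grid_fun_def distrib_right)
qed

end

section \<open>Approximation by integrals of grid step functions\<close>

text \<open>Cells closed on the right match the ceiling: a point lies in exactly one cell, and a
  grid function can be evaluated without a sum.\<close>

lemma indicator_Ioc_ceiling:
  fixes x \<delta> :: real assumes "\<delta> > 0"
  shows "indicator {\<delta> * (of_int z - 1)<..\<delta> * of_int z} x = (if \<lceil>x / \<delta>\<rceil> = z then 1 else 0 :: real)"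
proof -
  have "x \<in> {\<delta> * (of_int z - 1)<..\<delta> * of_int z} \<longleftrightarrow> of_int z - 1 < x / \<delta> \<and> x / \<delta> \<le> of_int z"
    using assms by (auto simp: field_simps)
  also have "\<dots> \<longleftrightarrow> \<lceil>x / \<delta>\<rceil> = z" by (simp add: ceiling_eq_iff)
  finally show ?thesis by (simp add: indicator_def)
qed

text \<open>\<open>H\<close> is indexed by the integer z of the cell from delta (z - 1) to delta z.
  Right of 0 this is z = k + 1, left of 0 it is z = - k; so z = 0 counts to the left half and the
  cells run over - m < z <= m.\<close>

lemma grid_fun_eq:
  assumes "\<delta> > 0"
  shows "grid_fun \<delta> (\<lambda>k. H (int k + 1)) (\<lambda>k. H (- int k)) m x =
    (if - int m < \<lceil>x / \<delta>\<rceil> \<and> \<lceil>x / \<delta>\<rceil> \<le> int m then H \<lceil>x / \<delta>\<rceil> else 0)"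
proof -
  define z where "z = \<lceil>x / \<delta>\<rceil>"
  have 1: "step_fun (\<lambda>k. H (int k + 1)) (\<lambda>k. \<delta> * real k) (\<lambda>k. \<delta> * real (Suc k)) m x =
     (if 0 < z \<and> z \<le> int m then H z else 0)"
  proof -
    have "step_fun (\<lambda>k. H (int k + 1)) (\<lambda>k. \<delta> * real k) (\<lambda>k. \<delta> * real (Suc k)) m x =
      (\<Sum>k<m. H (int k + 1) * (if z = int k + 1 then 1 else 0))"
      unfolding step_fun_def
    proof (rule sum.cong[OF refl])
      fix k
      show "H (int k + 1) * indicator {\<delta> * real k<..\<delta> * real (Suc k)} x = H (int k + 1) * (if z = int k + 1 then 1 else 0)"
        using indicator_Ioc_ceiling[OF assms, of "int k + 1" x] by (simp add: add.commute z_def)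
    qed
    also have "\<dots> = (if 0 < z \<and> z \<le> int m then H z else 0)"
    proof (cases "0 < z \<and> z \<le> int m")
      case True
      then have LT: "nat (z - 1) < m" by linarith
      have "(\<Sum>k<m. H (int k + 1) * (if z = int k + 1 then 1 else 0)) =
        (\<Sum>k<m. if k = nat (z - 1) then H z else 0)"
        using True by (intro sum.cong refl) auto
      also have "\<dots> = H z" using LT by (subst sum.delta) auto
      finally show ?thesis using True by simp
    next
      case False
      then have "(\<Sum>k<m. H (int k + 1) * (if z = int k + 1 then 1 else 0)) = 0"
        by (intro sum.neutral) auto
      then show ?thesis using False by auto
    qed
    finally show ?thesis .
  qed
  have 2: "step_fun (\<lambda>k. H (- int k)) (\<lambda>k. - (\<delta> * real (Suc k))) (\<lambda>k. - (\<delta> * real k)) m x =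
     (if - int m < z \<and> z \<le> 0 then H z else 0)"
  proof -
    have "step_fun (\<lambda>k. H (- int k)) (\<lambda>k. - (\<delta> * real (Suc k))) (\<lambda>k. - (\<delta> * real k)) m x =
      (\<Sum>k<m. H (- int k) * (if z = - int k then 1 else 0))"
      unfolding step_fun_def
    proof (rule sum.cong[OF refl])
      fix k
      have "{- (\<delta> * real (Suc k))<..- (\<delta> * real k)} = {\<delta> * (of_int (- int k) - 1)<..\<delta> * of_int (- int k)}"
        by (intro arg_cong2[where f=greaterThanAtMost]) (simp_all add: algebra_simps)
      then show "H (- int k) * indicator {- (\<delta> * real (Suc k))<..- (\<delta> * real k)} x = H (- int k) * (if z = - int k then 1 else 0)"
        by (simp only: indicator_Ioc_ceiling[OF assms] z_def)
    qed
    also have "\<dots> = (if - int m < z \<and> z \<le> 0 then H z else 0)"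
    proof (cases "- int m < z \<and> z \<le> 0")
      case True
      then have LT: "nat (- z) < m" by linarith
      have "(\<Sum>k<m. H (- int k) * (if z = - int k then 1 else 0)) =
        (\<Sum>k<m. if k = nat (- z) then H z else 0)"
        using True by (intro sum.cong refl) auto
      also have "\<dots> = H z" using LT by (subst sum.delta) auto
      finally show ?thesis using True by simp
    next
      case False
      then have "(\<Sum>k<m. H (- int k) * (if z = - int k then 1 else 0)) = 0"
        by (intro sum.neutral) auto
      then show ?thesis using False by auto
    qed
    finally show ?thesis .
  qed
  show ?thesis unfolding grid_fun_def 1 2 z_def[symmetric] by auto
qed

lemma integrable_step_fun: "integrable lborel (step_fun c s t n)"
  unfolding step_fun_def[abs_def]
  by (intro Bochner_Integration.integrable_sum integrable_mult_right integrable_real_indicator)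
    (auto simp: emeasure_lborel_Ioc_less_top)

lemma integral_step_fun:
  assumes "\<And>k. s k \<le> t k"
  shows "(LINT x|lborel. step_fun c s t n x) = (\<Sum>k<n. c k * (t k - s k))"
  unfolding step_fun_def using assms
  by (subst Bochner_Integration.integral_sum)
    (auto intro!: integrable_real_indicator integrable_mult_right simp: emeasure_lborel_Ioc_less_top)

text \<open>The cells are disjoint, so squaring acts on the coefficients.\<close>

lemma integral_grid_fun_square:
  assumes "\<delta> > 0"
  shows "(LINT x|lborel. (grid_fun \<delta> (\<lambda>k. H (int k + 1)) (\<lambda>k. H (- int k)) m x)\<^sup>2) =
     \<delta> * ((\<Sum>k<m. (H (int k + 1))\<^sup>2) + (\<Sum>k<m. (H (- int k))\<^sup>2))"
proof -
  have "(grid_fun \<delta> (\<lambda>k. H (int k + 1)) (\<lambda>k. H (- int k)) m x)\<^sup>2 =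
    grid_fun \<delta> (\<lambda>k. (H (int k + 1))\<^sup>2) (\<lambda>k. (H (- int k))\<^sup>2) m x" for x
    using grid_fun_eq[OF assms, of H] grid_fun_eq[OF assms, of "\<lambda>z. (H z)\<^sup>2"] by simp
  then have "(LINT x|lborel. (grid_fun \<delta> (\<lambda>k. H (int k + 1)) (\<lambda>k. H (- int k)) m x)\<^sup>2) =
    (LINT x|lborel. grid_fun \<delta> (\<lambda>k. (H (int k + 1))\<^sup>2) (\<lambda>k. (H (- int k))\<^sup>2) m x)" by simp
  also have "\<dots> = (LINT x|lborel. step_fun (\<lambda>k. (H (int k + 1))\<^sup>2) (\<lambda>k. \<delta> * real k) (\<lambda>k. \<delta> * real (Suc k)) m x)
    + (LINT x|lborel. step_fun (\<lambda>k. (H (- int k))\<^sup>2) (\<lambda>k. - (\<delta> * real (Suc k))) (\<lambda>k. - (\<delta> * real k)) m x)"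
    unfolding grid_fun_def
    by (intro Bochner_Integration.integral_add integrable_step_fun)
  also have "\<dots> = (\<Sum>k<m. (H (int k + 1))\<^sup>2 * (\<delta> * real (Suc k) - \<delta> * real k)) +
     (\<Sum>k<m. (H (- int k))\<^sup>2 * (- (\<delta> * real k) - - (\<delta> * real (Suc k))))"
    using assms by (subst (1 2) integral_step_fun) auto
  also have "\<dots> = \<delta> * ((\<Sum>k<m. (H (int k + 1))\<^sup>2) + (\<Sum>k<m. (H (- int k))\<^sup>2))"
    by (simp add: algebra_simps sum_distrib_left)
  finally show ?thesis .
qed

text \<open>Sampling at the right end points of the cells. The samples obey the bound
  \<open>B\<close> of \<open>h\<close>, and \<open>char_bound\<close> relies on this: psi is
  controlled only at arguments up to \<open>B\<close>.\<close>

lemma grid_approximation: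
  fixes h :: "real \<Rightarrow> real"
  assumes cont: "continuous_on UNIV h" and bound: "\<And>x. \<bar>h x\<bar> \<le> B"
    and sq: "integrable lborel (\<lambda>x. (h x)\<^sup>2)" and "e > 0"
  obtains \<delta> H m where "\<delta> > 0" "\<And>z. \<bar>H z\<bar> \<le> B"
    "(LINT x|lborel. (h x - grid_fun \<delta> (\<lambda>k. H (int k + 1)) (\<lambda>k. H (- int k)) m x)\<^sup>2) < e"
proof -
  have [measurable]: "h \<in> borel_measurable borel" using cont by (rule borel_measurable_continuous_onI)
  have B: "0 \<le> B" using order.trans[OF abs_ge_zero bound[of 0]] .
  have lim0: "(\<lambda>K. LINT x|lborel. (h x)\<^sup>2 * indicator (- {- real K<..real K}) x) \<longlonglongrightarrow> (LINT x|(lborel::real measure). 0)"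
  proof (rule integral_dominated_convergence[where w="\<lambda>x. (h x)\<^sup>2"])
    show "AE x in lborel. (\<lambda>K. (h x)\<^sup>2 * indicator (- {- real K<..real K}) x) \<longlonglongrightarrow> 0"
    proof (rule AE_I2)
      fix x :: real
      obtain N :: nat where N: "\<bar>x\<bar> < N" using reals_Archimedean2 by blast
      have "\<forall>\<^sub>F K in sequentially. (h x)\<^sup>2 * indicator (- {- real K<..real K}) x = 0"
        using eventually_ge_at_top[of N] by eventually_elim (use N in \<open>auto simp: indicator_def\<close>)
      then show "(\<lambda>K. (h x)\<^sup>2 * indicator (- {- real K<..real K}) x) \<longlonglongrightarrow> 0"
        by (rule tendsto_eventually)
    qed
  qed (use sq in \<open>auto simp: indicator_def\<close>)
  have "\<forall>\<^sub>F K in sequentially. (LINT x|lborel. (h x)\<^sup>2 * indicator (- {- real K<..real K}) x) < e"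
    using order_tendstoD(2)[OF lim0, of e] \<open>e > 0\<close> by simp
  then obtain K where K: "(LINT x|lborel. (h x)\<^sup>2 * indicator (- {- real K<..real K}) x) < e"
    by (auto simp: eventually_sequentially)
  define \<delta> where "\<delta> n = inverse (real (Suc n))" for n
  have \<delta>: "\<delta> n > 0" "\<delta> \<longlonglongrightarrow> 0" for n
    using LIMSEQ_inverse_real_of_nat by (auto simp: \<delta>_def[abs_def])
  define H where "H n z = h (\<delta> n * of_int z)" for n and z :: int
  \<comment> \<open>With mesh 1 / (n + 1) this many cells on each side cover exactly the interval
    from - K to K, for every n.\<close>
  define m where "m n = K * Suc n" for n
  define f where "f n = grid_fun (\<delta> n) (\<lambda>k. H n (int k + 1)) (\<lambda>k. H n (- int k)) (m n)" for n
  have f_eq: "f n x = h (\<delta> n * of_int \<lceil>x / \<delta> n\<rceil>) * indicator {- real K<..real K} x" for n x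
  proof -
    have x: "x / \<delta> n = x * real (Suc n)" and mn: "real (m n) = real K * real (Suc n)"
      by (simp_all add: \<delta>_def m_def divide_inverse algebra_simps)
    have "- int (m n) < \<lceil>x / \<delta> n\<rceil> \<longleftrightarrow> (- real K) * real (Suc n) < x * real (Suc n)"
      unfolding less_ceiling_iff x using mn by simp
    then have 1: "- int (m n) < \<lceil>x / \<delta> n\<rceil> \<longleftrightarrow> - real K < x"
      by (simp only: mult_less_cancel_right_pos of_nat_0_less_iff zero_less_Suc)
    have "\<lceil>x / \<delta> n\<rceil> \<le> int (m n) \<longleftrightarrow> x * real (Suc n) \<le> real K * real (Suc n)"
      unfolding ceiling_le_iff x using mn by simp
    then have 2: "\<lceil>x / \<delta> n\<rceil> \<le> int (m n) \<longleftrightarrow> x \<le> real K"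
      by (simp only: mult_le_cancel_right_pos of_nat_0_less_iff zero_less_Suc)
    show ?thesis unfolding f_def grid_fun_eq[OF \<delta>(1)] 1 2 by (simp add: H_def indicator_def)
  qed
  have fm [measurable]: "f n \<in> borel_measurable borel" for n
    using sq_integrable_measurable[OF sq_integrable_grid_fun] unfolding f_def by fastforce
  \<comment> \<open>For fixed \<open>K\<close> the limit is the tail of \<open>h\<close> outside the
    window, already below \<open>e\<close>; one large n then suffices.\<close>
  have "(\<lambda>n. LINT x|lborel. (h x - f n x)\<^sup>2) \<longlonglongrightarrow> (LINT x|lborel. (h x)\<^sup>2 * indicator (- {- real K<..real K}) x)"
  proof (rule integral_dominated_convergence[where w="\<lambda>x. (h x)\<^sup>2 + (2 * B)\<^sup>2 * indicator {- real K<..real K} x"])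
    show "integrable lborel (\<lambda>x. (h x)\<^sup>2 + (2 * B)\<^sup>2 * indicator {- real K<..real K} x)"
      using sq by (intro Bochner_Integration.integrable_add integrable_mult_right integrable_real_indicator)
        (auto simp: emeasure_lborel_Ioc_less_top)
    show "AE x in lborel. norm ((h x - f n x)\<^sup>2) \<le> (h x)\<^sup>2 + (2 * B)\<^sup>2 * indicator {- real K<..real K} x" for n
    proof (rule AE_I2)
      fix x
      have "\<bar>h x - h (\<delta> n * of_int \<lceil>x / \<delta> n\<rceil>)\<bar> \<le> 2 * B"
        using bound[of x] bound[of "\<delta> n * of_int \<lceil>x / \<delta> n\<rceil>"] by linarith
      then have "(h x - h (\<delta> n * of_int \<lceil>x / \<delta> n\<rceil>))\<^sup>2 \<le> (2 * B)\<^sup>2"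
        using power_mono[of "\<bar>h x - h (\<delta> n * of_int \<lceil>x / \<delta> n\<rceil>)\<bar>" "2 * B" 2] by simp
      then show "norm ((h x - f n x)\<^sup>2) \<le> (h x)\<^sup>2 + (2 * B)\<^sup>2 * indicator {- real K<..real K} x"
        unfolding f_eq by (cases "x \<in> {- real K<..real K}") (auto intro: add_increasing)
    qed
    show "AE x in lborel. (\<lambda>n. (h x - f n x)\<^sup>2) \<longlonglongrightarrow> (h x)\<^sup>2 * indicator (- {- real K<..real K}) x"
    proof (rule AE_I2)
      fix x
      have "(\<lambda>n. \<delta> n * of_int \<lceil>x / \<delta> n\<rceil> - x) \<longlonglongrightarrow> 0"
      proof (rule Lim_null_comparison[OF _ \<delta>(2)], intro always_eventually allI)
        fix n
        have "x / \<delta> n \<le> of_int \<lceil>x / \<delta> n\<rceil>" "of_int \<lceil>x / \<delta> n\<rceil> < x / \<delta> n + 1"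
          using ceiling_correct[of "x / \<delta> n"] by linarith+
        then have "x \<le> of_int \<lceil>x / \<delta> n\<rceil> * \<delta> n" "of_int \<lceil>x / \<delta> n\<rceil> < (x + \<delta> n) / \<delta> n"
          using \<delta>(1)[of n] by (simp_all only: pos_divide_le_eq add_divide_distrib) simp
        then have "x \<le> \<delta> n * of_int \<lceil>x / \<delta> n\<rceil>" "\<delta> n * of_int \<lceil>x / \<delta> n\<rceil> < x + \<delta> n"
          using \<delta>(1)[of n] by (simp_all only: pos_less_divide_eq mult.commute)
        then show "norm (\<delta> n * of_int \<lceil>x / \<delta> n\<rceil> - x) \<le> \<delta> n" by simp
      qed
      then have "(\<lambda>n. \<delta> n * of_int \<lceil>x / \<delta> n\<rceil>) \<longlonglongrightarrow> x" by (simp only: LIM_zero_iff)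
      moreover have "isCont h x" using cont by (simp add: continuous_on_eq_continuous_at)
      ultimately have "(\<lambda>n. h (\<delta> n * of_int \<lceil>x / \<delta> n\<rceil>)) \<longlonglongrightarrow> h x"
        by (rule isCont_tendsto_compose[rotated])
      then have "(\<lambda>n. (h x - f n x)\<^sup>2) \<longlonglongrightarrow> (h x - h x * indicator {- real K<..real K} x)\<^sup>2"
        unfolding f_eq by (intro tendsto_intros)
      then show "(\<lambda>n. (h x - f n x)\<^sup>2) \<longlonglongrightarrow> (h x)\<^sup>2 * indicator (- {- real K<..real K}) x"
        by (cases "x \<in> {- real K<..real K}") auto
    qed
  qed measurable
  from order_tendstoD(2)[OF this K] obtain n where n: "(LINT x|lborel. (h x - f n x)\<^sup>2) < e"
    by (auto simp: eventually_sequentially)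
  show ?thesis
  proof (rule that[of "\<delta> n" "H n" "m n"])
    show "\<bar>H n z\<bar> \<le> B" for z unfolding H_def by (rule bound)
  qed (use \<delta>(1) n in \<open>auto simp: f_def\<close>)
qed

section \<open>Comparison with the Gaussian characteristic function\<close>

lemma cmod_cis_diff_le: "cmod (cis x - cis y) \<le> \<bar>x - y\<bar>"
proof -
  have "cis x - cis y = cis y * (cis (x - y) - 1)" by (simp add: cis_mult right_diff_distrib)
  then have "cmod (cis x - cis y) = cmod (cis (x - y) - 1)" by (simp add: norm_mult)
  also have "\<dots> \<le> \<bar>x - y\<bar>" using iexp_approx1[of "x - y" 0] by (simp add: cis_conv_exp)
  finally show ?thesis .
qed

text \<open>On the convex half-plane Re z <= 0 the derivative of exp has modulus at most 1.\<close>

lemma cmod_exp_diff_le: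
  assumes "Re w \<le> 0" "Re z \<le> 0"
  shows "cmod (exp w - exp z) \<le> cmod (w - z)"
proof -
  have "cmod (exp w - exp z) \<le> 1 * cmod (w - z)"
  proof (rule field_differentiable_bound[of "{z. Re z \<le> 0}"])
    show "convex {z. Re z \<le> 0}" using convex_halfspace_Re_le[of 0] .
    show "(exp has_field_derivative exp z) (at z within {z. Re z \<le> 0})" for z
      by (rule DERIV_subset[OF DERIV_exp]) simp
  qed (use assms in auto)
  then show ?thesis by simp
qed

context centered_levy
begin

lemma d2_nonneg: "0 \<le> d2"
  unfolding d2_def by simp

text \<open>\<open>Y\<close> enters only through its L2 distances \<open>iso\<close> to grid
  integrals. For these the exponent of the characteristic function is a finite sum of values of psi,
  within eta times the squared norm of the grid function of the Gaussian exponent. The estimate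
  passes to the limit along a sequence of grids.\<close>

lemma char_bound:
  assumes Y: "sq_integrable M Y"
    and cont: "continuous_on UNIV h" and bound: "\<And>x. \<bar>h x\<bar> \<le> B"
    and sqh: "sq_integrable lborel h"
    and iso: "\<And>\<delta> c c' m. \<delta> > 0 \<Longrightarrow> expectation (\<lambda>\<omega>. (Y \<omega> - grid_int \<delta> c c' m \<omega>)\<^sup>2) =
       d2 * (LINT x|lborel. (h x - grid_fun \<delta> c c' m x)\<^sup>2)"
    and \<psi>: "\<And>x. \<bar>x\<bar> \<le> B \<Longrightarrow> cmod (\<psi> x + complex_of_real (d2 * x\<^sup>2 / 2)) \<le> \<eta> * x\<^sup>2"
  shows "cmod ((\<integral>\<omega>. cis (Y \<omega>) \<partial>M) - exp (complex_of_real (- (d2 * (LINT x|lborel. (h x)\<^sup>2) / 2)))) \<le>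
     \<eta> * (LINT x|lborel. (h x)\<^sup>2)"
proof -
  have [measurable]: "Y \<in> borel_measurable M" using Y by auto
  \<comment> \<open>Bundles the data of one approximation, so that mesh, coefficients and number of
    cells are selected for all n by successive uses of \<open>choice\<close>.\<close>
  define P where "P n d H m \<longleftrightarrow> d > 0 \<and> (\<forall>z. \<bar>H z\<bar> \<le> B) \<and>
    (LINT x|lborel. (h x - grid_fun d (\<lambda>k. H (int k + 1)) (\<lambda>k. H (- int k)) m x)\<^sup>2) < inverse (real (Suc n))"
    for n :: nat and d H m
  have "\<exists>d H m. P n d H m" for n
    unfolding P_def
    by (rule grid_approximation[OF cont bound sq_integrable_square[OF sqh], of "inverse (real (Suc n))"]) (simp, blast)
  then have "\<forall>n. \<exists>d H m. P n d H m" by blast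
  from choice[OF this] obtain \<delta> where "\<forall>n. \<exists>H m. P n (\<delta> n) H m" ..
  from choice[OF this] obtain H where "\<forall>n. \<exists>m. P n (\<delta> n) (H n) m" ..
  from choice[OF this] obtain m where "\<forall>n. P n (\<delta> n) (H n) (m n)" ..
  then have g: "\<And>n. \<delta> n > 0" "\<And>n z. \<bar>H n z\<bar> \<le> B"
    "\<And>n. (LINT x|lborel. (h x - grid_fun (\<delta> n) (\<lambda>k. H n (int k + 1)) (\<lambda>k. H n (- int k)) (m n) x)\<^sup>2) < inverse (real (Suc n))"
    by (auto simp: P_def)
  define f where "f n = grid_fun (\<delta> n) (\<lambda>k. H n (int k + 1)) (\<lambda>k. H n (- int k)) (m n)" for n
  define J where "J n = grid_int (\<delta> n) (\<lambda>k. H n (int k + 1)) (\<lambda>k. H n (- int k)) (m n)" for n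
  have J: "sq_integrable M (J n)" for n unfolding J_def by (rule sq_integrable_grid_int)
  have [measurable]: "J n \<in> borel_measurable M" for n using J by auto
  have sqf: "sq_integrable lborel (f n)" for n unfolding f_def by (rule sq_integrable_grid_fun)
  have f0: "(\<lambda>n. LINT x|lborel. (h x - f n x)\<^sup>2) \<longlonglongrightarrow> 0"
    by (rule tendsto_sandwich[OF _ _ tendsto_const LIMSEQ_inverse_real_of_nat])
      (use g(3) in \<open>auto simp: f_def intro!: always_eventually less_imp_le\<close>)
  have fh: "(\<lambda>n. LINT x|lborel. (f n x)\<^sup>2) \<longlonglongrightarrow> (LINT x|lborel. (h x)\<^sup>2)"
    using tendsto_integral_mult[OF sqf sqh sqf sqh f0 f0] by (simp add: power2_eq_square)
  \<comment> \<open>\<open>cis\<close> is 1-Lipschitz, and Cauchy-Schwarz against the constant 1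
    bounds the mean distance by the L2 distance.\<close>
  have YJ: "cmod ((\<integral>\<omega>. cis (Y \<omega>) \<partial>M) - (\<integral>\<omega>. cis (J n \<omega>) \<partial>M)) \<le> sqrt (d2 * (LINT x|lborel. (h x - f n x)\<^sup>2))" for n
  proof -
    have i: "integrable M (\<lambda>\<omega>. cis (Z \<omega>))" if "Z \<in> borel_measurable M" for Z
      using integrable_cis[OF that, of 1] by simp
    have "(\<integral>\<omega>. cis (Y \<omega>) \<partial>M) - (\<integral>\<omega>. cis (J n \<omega>) \<partial>M) = (\<integral>\<omega>. cis (Y \<omega>) - cis (J n \<omega>) \<partial>M)"
      using i[of Y] i[of "J n"] by simp
    also have "cmod \<dots> \<le> (\<integral>\<omega>. cmod (cis (Y \<omega>) - cis (J n \<omega>)) \<partial>M)" by (rule integral_norm_bound)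
    also have "\<dots> \<le> (\<integral>\<omega>. \<bar>Y \<omega> - J n \<omega>\<bar> * 1 \<partial>M)"
    proof (rule integral_mono)
      show "integrable M (\<lambda>\<omega>. \<bar>Y \<omega> - J n \<omega>\<bar> * 1)"
        using integrable_abs[OF sq_integrable_mult[OF sq_integrable_diff[OF Y J, of n], of "\<lambda>_. 1"]]
        by (simp add: sq_integrable_def)
      show "integrable M (\<lambda>\<omega>. cmod (cis (Y \<omega>) - cis (J n \<omega>)))"
        using i[of Y] i[of "J n"] by (intro integrable_norm) auto
    qed (use cmod_cis_diff_le in auto)
    also have "\<dots> \<le> \<bar>\<integral>\<omega>. \<bar>Y \<omega> - J n \<omega>\<bar> * 1 \<partial>M\<bar>" by simp
    also have "\<dots> \<le> sqrt (\<integral>\<omega>. (\<bar>Y \<omega> - J n \<omega>\<bar>)\<^sup>2 \<partial>M) * sqrt (\<integral>\<omega>. 1\<^sup>2 \<partial>M)"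
      using sq_integrable_diff[OF Y J, of n]
      by (intro sq_integrable_Cauchy_Schwarz) (auto simp: sq_integrable_def)
    also have "\<dots> = sqrt (expectation (\<lambda>\<omega>. (Y \<omega> - J n \<omega>)\<^sup>2))" by (simp add: prob_space)
    also have "expectation (\<lambda>\<omega>. (Y \<omega> - J n \<omega>)\<^sup>2) = d2 * (LINT x|lborel. (h x - f n x)\<^sup>2)"
      unfolding J_def f_def by (rule iso[OF g(1)])
    finally show ?thesis .
  qed
  have JE: "cmod ((\<integral>\<omega>. cis (J n \<omega>) \<partial>M) - exp (complex_of_real (- (d2 * (LINT x|lborel. (f n x)\<^sup>2) / 2)))) \<le>
     \<eta> * (LINT x|lborel. (f n x)\<^sup>2)" for n
  proof -
    let ?c = "\<lambda>k. H n (int k + 1)" and ?c' = "\<lambda>k. H n (- int k)"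
    let ?w = "complex_of_real (\<delta> n) * ((\<Sum>k<m n. \<psi> (?c k)) + (\<Sum>k<m n. \<psi> (?c' k)))"
    have S: "(LINT x|lborel. (f n x)\<^sup>2) = \<delta> n * ((\<Sum>k<m n. (?c k)\<^sup>2) + (\<Sum>k<m n. (?c' k)\<^sup>2))"
      unfolding f_def by (rule integral_grid_fun_square[OF g(1)])
    have E: "(\<Sum>k<m n. complex_of_real (d2 * (r k)\<^sup>2 / 2)) = complex_of_real (d2 / 2 * (\<Sum>k<m n. (r k)\<^sup>2))" for r :: "nat \<Rightarrow> real"
      by (simp add: sum_distrib_left)
    \<comment> \<open>Both exponents have nonpositive real part, so the exponentials differ by no
      more than the exponents do.\<close>
    have "Re ?w \<le> 0"
      using g(1)[of n] by (auto intro!: mult_nonneg_nonpos add_nonpos_nonpos sum_nonpos Re_exponent_nonpos simp: less_imp_le)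
    moreover have "Re (complex_of_real (- (d2 * (LINT x|lborel. (f n x)\<^sup>2) / 2))) \<le> 0"
      using d2_nonneg by simp
    ultimately have "cmod (exp ?w - exp (complex_of_real (- (d2 * (LINT x|lborel. (f n x)\<^sup>2) / 2)))) \<le>
       cmod (?w - complex_of_real (- (d2 * (LINT x|lborel. (f n x)\<^sup>2) / 2)))"
      by (rule cmod_exp_diff_le)
    also have "?w - complex_of_real (- (d2 * (LINT x|lborel. (f n x)\<^sup>2) / 2)) =
      complex_of_real (\<delta> n) * ((\<Sum>k<m n. \<psi> (?c k) + complex_of_real (d2 * (?c k)\<^sup>2 / 2)) +
        (\<Sum>k<m n. \<psi> (?c' k) + complex_of_real (d2 * (?c' k)\<^sup>2 / 2)))"
      unfolding S sum.distrib E by (simp add: algebra_simps add_divide_distrib)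
    also have "cmod \<dots> = \<delta> n * cmod ((\<Sum>k<m n. \<psi> (?c k) + complex_of_real (d2 * (?c k)\<^sup>2 / 2)) +
        (\<Sum>k<m n. \<psi> (?c' k) + complex_of_real (d2 * (?c' k)\<^sup>2 / 2)))"
      using g(1)[of n] by (simp add: norm_mult)
    also have "\<dots> \<le> \<delta> n * ((\<Sum>k<m n. \<eta> * (?c k)\<^sup>2) + (\<Sum>k<m n. \<eta> * (?c' k)\<^sup>2))"
      using g(1)[of n] by (intro mult_left_mono order.trans[OF norm_triangle_ineq] add_mono sum_norm_le \<psi> g(2)) auto
    also have "\<dots> = \<eta> * (LINT x|lborel. (f n x)\<^sup>2)"
      unfolding S by (simp add: sum_distrib_left[symmetric] algebra_simps)
    finally show ?thesis unfolding J_def grid_int_char[OF g(1)] .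
  qed
  have "cmod ((\<integral>\<omega>. cis (Y \<omega>) \<partial>M) - exp (complex_of_real (- (d2 * (LINT x|lborel. (f n x)\<^sup>2) / 2)))) \<le>
     sqrt (d2 * (LINT x|lborel. (h x - f n x)\<^sup>2)) + \<eta> * (LINT x|lborel. (f n x)\<^sup>2)" for n
    by (rule order.trans[OF norm_triangle_sub[of _ "(\<integral>\<omega>. cis (Y \<omega>) \<partial>M) - (\<integral>\<omega>. cis (J n \<omega>) \<partial>M)"]])
      (use YJ[of n] JE[of n] in \<open>simp add: add_mono\<close>)
  moreover have "(\<lambda>n. cmod ((\<integral>\<omega>. cis (Y \<omega>) \<partial>M) - exp (complex_of_real (- (d2 * (LINT x|lborel. (f n x)\<^sup>2) / 2))))) \<longlonglongrightarrow>
     cmod ((\<integral>\<omega>. cis (Y \<omega>) \<partial>M) - exp (complex_of_real (- (d2 * (LINT x|lborel. (h x)\<^sup>2) / 2))))"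
    by (intro tendsto_intros fh) auto
  moreover have "(\<lambda>n. sqrt (d2 * (LINT x|lborel. (h x - f n x)\<^sup>2)) + \<eta> * (LINT x|lborel. (f n x)\<^sup>2)) \<longlonglongrightarrow>
     sqrt (d2 * 0) + \<eta> * (LINT x|lborel. (h x)\<^sup>2)"
    by (intro tendsto_intros fh f0)
  ultimately show ?thesis using LIMSEQ_le by fastforce
qed

end

section \<open>Correlation with the kernel and stochastic Fubini\<close>

lemma lborel_integral_reflect:
  fixes f :: "real \<Rightarrow> 'a :: {banach, second_countable_topology}"
  shows "(LINT s|lborel. f (t - s)) = (LINT s|lborel. f s)"
  using lborel_integral_real_affine[of "-1" f t] by simp

lemma lborel_integrable_reflect:
  fixes f :: "real \<Rightarrow> 'a :: {banach, second_countable_topology}"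
  shows "integrable lborel (\<lambda>s. f (t - s)) \<longleftrightarrow> integrable lborel f"
  using lborel_integrable_real_affine_iff[of "-1" f t] by simp

text \<open>This is h_T when \<open>w\<close> is the combination of the weights along u and
  \<open>a\<close> is \<open>ahat\<close>.\<close>

definition correl :: "(real \<Rightarrow> real) \<Rightarrow> (real \<Rightarrow> real) \<Rightarrow> real \<Rightarrow> real" where
  "correl w a s = (LINT t|lborel. w t * a (t - s))"

locale correlation =
  fixes w a :: "real \<Rightarrow> real" and B T :: real
  assumes a: "integrable lborel a" and a2: "integrable lborel (\<lambda>t. (a t)\<^sup>2)"
    and w_meas: "w \<in> borel_measurable borel"
    and w_bound: "\<And>t. \<bar>w t\<bar> \<le> B * indicator {0..T} t"
begin

lemma a_meas: "a \<in> borel_measurable borel"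
  using a by auto

lemma sq_a: "sq_integrable lborel (\<lambda>s. a (t - s))"
proof (rule sq_integrableI)
  note [measurable] = a_meas
  show "(\<lambda>s. a (t - s)) \<in> borel_measurable lborel" by measurable
  show "integrable lborel (\<lambda>s. (a (t - s))\<^sup>2)"
    using a2 lborel_integrable_reflect[of "\<lambda>s. (a s)\<^sup>2" t] by simp
qed

sublocale K: bounded_kernel lborel "\<lambda>t s. a (t - s)" "LINT t|lborel. (a t)\<^sup>2" B T w
proof
  note [measurable] = a_meas
  show "(\<lambda>(t, x). a (t - x)) \<in> borel_measurable (lborel \<Otimes>\<^sub>M lborel)" by measurable
  show "(LINT x|lborel. (a (t - x))\<^sup>2) \<le> (LINT t|lborel. (a t)\<^sup>2)" for t
    using lborel_integral_reflect[of "\<lambda>s. (a s)\<^sup>2" t] by simp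
qed (rule sq_a w_meas w_bound)+

lemma K_Y: "K.Y = correl w a"
  by (simp add: K.Y_def[abs_def] correl_def[abs_def])

lemma sq_integrable_correl: "sq_integrable lborel (correl w a)"
  using K.sq_integrable_Y by (simp add: K_Y)

lemma integrable_w_a: "integrable lborel (\<lambda>t. w t * a (t - s))"
proof (rule Bochner_Integration.integrable_bound)
  note [measurable] = a_meas w_meas
  show "integrable lborel (\<lambda>t. \<bar>B\<bar> * a (t - s))"
    using a lborel_integrable_shift[of a "- s"] by simp
  show "(\<lambda>t. w t * a (t - s)) \<in> borel_measurable lborel" by measurable
  show "AE t in lborel. norm (w t * a (t - s)) \<le> norm (\<bar>B\<bar> * a (t - s))"
    using K.w_abs_le by (auto simp: abs_mult intro!: AE_I2 mult_right_mono)
qed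

text \<open>The L1 norm of \<open>a\<close> turns the bound on the weight into a uniform bound of
  the same order. For a weight of order 1 / sqrt T this confines the arguments of psi to a
  neighbourhood of 0.\<close>

lemma correl_bound: "\<bar>correl w a s\<bar> \<le> \<bar>B\<bar> * (LINT t|lborel. \<bar>a t\<bar>)"
proof -
  have ia: "integrable lborel (\<lambda>t. a (t - s))" using a lborel_integrable_shift[of a "- s"] by simp
  have "\<bar>correl w a s\<bar> \<le> (LINT t|lborel. \<bar>w t * a (t - s)\<bar>)"
    unfolding correl_def by (rule integral_abs_bound)
  also have "\<dots> \<le> (LINT t|lborel. \<bar>B\<bar> * \<bar>a (t - s)\<bar>)"
    using K.w_abs_le ia by (intro integral_mono integrable_abs integrable_w_a)
      (auto simp: abs_mult intro!: mult_right_mono)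
  also have "\<dots> = \<bar>B\<bar> * (LINT t|lborel. \<bar>a t\<bar>)"
    using lborel_integral_shift[of "\<lambda>t. \<bar>a t\<bar>" "- s"] by simp
  finally show ?thesis .
qed

text \<open>The weight is merely bounded and measurable, so continuity has to come from the kernel:
  translations of \<open>a\<close> are continuous in L1.\<close>

lemma continuous_correl: "continuous_on UNIV (correl w a)"
proof (rule continuous_at_imp_continuous_on, rule ballI)
  fix s
  show "isCont (correl w a) s"
    unfolding isCont_def tendsto_at_iff_sequentially o_def
  proof (intro allI impI)
    fix x :: "nat \<Rightarrow> real" assume "\<forall>i. x i \<in> UNIV - {s}" and x: "x \<longlonglongrightarrow> s"
    have x': "(\<lambda>n. s - x n) \<longlonglongrightarrow> 0" using tendsto_diff[OF tendsto_const[of s] x] by simp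
    have ia: "integrable lborel (\<lambda>t. a (t - r))" for r using a lborel_integrable_shift[of a "- r"] by simp
    have "(\<lambda>n. \<bar>B\<bar> * (LINT t|lborel. \<bar>a (t + (s - x n)) - a t\<bar>)) \<longlonglongrightarrow> \<bar>B\<bar> * 0"
      by (intro tendsto_mult tendsto_const L1_translation[OF a x'])
    then have lim: "(\<lambda>n. \<bar>B\<bar> * (LINT t|lborel. \<bar>a (t + (s - x n)) - a t\<bar>)) \<longlonglongrightarrow> 0" by simp
    have "(\<lambda>n. correl w a (x n) - correl w a s) \<longlonglongrightarrow> 0"
    proof (rule Lim_null_comparison[OF _ lim], intro always_eventually allI)
      fix n
      have "correl w a (x n) - correl w a s = (LINT t|lborel. w t * (a (t - x n) - a (t - s)))"
        unfolding correl_def using integrable_w_a[of "x n"] integrable_w_a[of s] by (simp add: right_diff_distrib)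
      also have "norm \<dots> \<le> (LINT t|lborel. \<bar>w t * (a (t - x n) - a (t - s))\<bar>)"
        using integral_abs_bound[of lborel "\<lambda>t. w t * (a (t - x n) - a (t - s))"] by simp
      also have "\<dots> \<le> (LINT t|lborel. \<bar>B\<bar> * \<bar>a (t - x n) - a (t - s)\<bar>)"
      proof (rule integral_mono)
        show "integrable lborel (\<lambda>t. \<bar>w t * (a (t - x n) - a (t - s))\<bar>)"
          using integrable_w_a[of "x n"] integrable_w_a[of s] by (simp add: right_diff_distrib)
        show "integrable lborel (\<lambda>t. \<bar>B\<bar> * \<bar>a (t - x n) - a (t - s)\<bar>)"
          using ia by auto
        show "\<bar>w t * (a (t - x n) - a (t - s))\<bar> \<le> \<bar>B\<bar> * \<bar>a (t - x n) - a (t - s)\<bar>" for t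
          using K.w_abs_le[of t] by (auto simp: abs_mult intro!: mult_right_mono)
      qed
      also have "\<dots> = \<bar>B\<bar> * (LINT t|lborel. \<bar>a (t - x n) - a (t - s)\<bar>)" by simp
      also have "(LINT t|lborel. \<bar>a (t - x n) - a (t - s)\<bar>) = (LINT t|lborel. \<bar>a (t + (s - x n)) - a t\<bar>)"
        using lborel_integral_shift[of "\<lambda>t. \<bar>a (t - x n) - a (t - s)\<bar>" s] by (simp add: algebra_simps)
      finally show "norm (correl w a (x n) - correl w a s) \<le> \<bar>B\<bar> * (LINT t|lborel. \<bar>a (t + (s - x n)) - a t\<bar>)" .
    qed
    then show "(\<lambda>n. correl w a (x n)) \<longlonglongrightarrow> correl w a s" by (simp only: LIM_zero_iff)
  qed
qed

lemma integrable_correl_kernel: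
  "integrable (lborel \<Otimes>\<^sub>M lborel) (\<lambda>(t, s). cis (l * s) * complex_of_real (w t * a (t - s)))"
proof (rule lborel_pair.Fubini_integrable)
  note [measurable] = a_meas w_meas
  show "(\<lambda>(t, s). cis (l * s) * complex_of_real (w t * a (t - s))) \<in> borel_measurable (lborel \<Otimes>\<^sub>M lborel)"
    by measurable
  have i: "integrable lborel (\<lambda>s. a (t - s))" for t
    using lborel_integrable_reflect[of a t] a by simp
  have "(LINT s|lborel. norm (cis (l * s) * complex_of_real (w t * a (t - s)))) = \<bar>w t\<bar> * (LINT s|lborel. \<bar>a s\<bar>)" for t
    using lborel_integral_reflect[of "\<lambda>s. \<bar>a s\<bar>" t] by (simp add: norm_mult abs_mult)
  then show "integrable lborel (\<lambda>t. LINT s|lborel. norm (case (t, s) of (t, s) \<Rightarrow> cis (l * s) * complex_of_real (w t * a (t - s))))"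
    using K.integrable_w by simp
  show "AE t in lborel. integrable lborel (\<lambda>s. case (t, s) of (t, s) \<Rightarrow> cis (l * s) * complex_of_real (w t * a (t - s)))"
    using i by (auto intro!: AE_I2 integrable_cis_mult simp del: of_real_mult)
qed

lemma integrable_correl: "integrable lborel (correl w a)"
proof -
  have "integrable lborel (\<lambda>s. LINT t|lborel. complex_of_real (w t * a (t - s)))"
    using lborel_pair.integrable_snd[OF integrable_correl_kernel[of 0]] by simp
  then have "integrable lborel (\<lambda>s. complex_of_real (correl w a s))"
    by (simp add: correl_def[abs_def] del: of_real_mult)
  then show ?thesis by (simp only: complex_of_real_integrable_eq)
qed

text \<open>The substitution r = t - s splits the character into exp(i l t) exp(- i l r). The second
  factor has the sign of \<open>fourier\<close>, so the kernel contributes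
  \<open>fourier a l\<close> without conjugation.\<close>

lemma ft_correl: "ft (correl w a) l = ft w l * fourier a l"
proof -
  have "ft (correl w a) l = (LINT s|lborel. (LINT t|lborel. cis (l * s) * complex_of_real (w t * a (t - s))))"
    by (simp add: ft_def correl_def del: of_real_mult)
  also have "\<dots> = (LINT t|lborel. (LINT s|lborel. cis (l * s) * complex_of_real (w t * a (t - s))))"
    using lborel_pair.Fubini_integral[OF integrable_correl_kernel[of l]] by simp
  also have "\<dots> = (LINT t|lborel. cis (l * t) * complex_of_real (w t) * fourier a l)"
  proof (intro Bochner_Integration.integral_cong refl)
    fix t
    have "(LINT s|lborel. cis (l * s) * complex_of_real (w t * a (t - s))) =
      (LINT r|lborel. cis (l * (t - r)) * complex_of_real (w t * a (t - (t - r))))"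
      by (rule lborel_integral_reflect[symmetric])
    also have "\<dots> = (LINT r|lborel. cis (l * t) * complex_of_real (w t) * (complex_of_real (a r) * cis (- l * r)))"
    proof (intro Bochner_Integration.integral_cong refl)
      fix r
      have "cis (l * (t - r)) = cis (l * t) * cis (- l * r)"
        by (simp add: cis_mult algebra_simps)
      then show "cis (l * (t - r)) * complex_of_real (w t * a (t - (t - r))) =
        cis (l * t) * complex_of_real (w t) * (complex_of_real (a r) * cis (- l * r))"
        by (simp add: algebra_simps)
    qed
    also have "\<dots> = cis (l * t) * complex_of_real (w t) * fourier a l"
      unfolding fourier_def by (rule integral_mult_right_zero)
    finally show "(LINT s|lborel. cis (l * s) * complex_of_real (w t * a (t - s))) =
      cis (l * t) * complex_of_real (w t) * fourier a l" .
  qed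
  also have "\<dots> = ft w l * fourier a l" unfolding ft_def by (rule integral_mult_left_zero)
  finally show ?thesis .
qed

lemma Plancherel_correl:
  "2 * pi * (LINT s|lborel. (correl w a s)\<^sup>2) = (LINT l|lborel. (cmod (ft w l))\<^sup>2 * (cmod (fourier a l))\<^sup>2)"
  using Plancherel(2)[OF integrable_correl sq_integrable_square[OF sq_integrable_correl]]
  by (simp add: ft_correl norm_mult power_mult_distrib)

end

lemma fourier_bound: "cmod (fourier a l) \<le> (LINT t|lborel. \<bar>a t\<bar>)"
  unfolding fourier_def using integral_norm_bound[of lborel "\<lambda>t. complex_of_real (a t) * cis (- l * t)"]
  by (simp add: norm_mult)

lemma continuous_fourier:
  assumes a: "integrable lborel a"
  shows "continuous_on UNIV (fourier a)"
proof (rule continuous_at_imp_continuous_on, rule ballI)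
  fix l
  have [measurable]: "a \<in> borel_measurable borel" using a by auto
  show "isCont (fourier a) l"
    unfolding isCont_def tendsto_at_iff_sequentially o_def
  proof (intro allI impI)
    fix x :: "nat \<Rightarrow> real" assume x: "x \<longlonglongrightarrow> l"
    show "(\<lambda>n. fourier a (x n)) \<longlonglongrightarrow> fourier a l"
      unfolding fourier_def
    proof (rule integral_dominated_convergence[where w="\<lambda>t. \<bar>a t\<bar>"])
      show "AE t in lborel. (\<lambda>n. complex_of_real (a t) * cis (- x n * t)) \<longlonglongrightarrow> complex_of_real (a t) * cis (- l * t)"
        unfolding cis_conv_exp by (intro AE_I2 tendsto_intros x)
    qed (use a in \<open>auto simp: norm_mult\<close>)
  qed
qed

locale linear_process = centered_levy M a b Lm L0 L1 + correlation w ahat B T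
  for M :: "'w measure" and a b Lm L0 L1 and w ahat :: "real \<Rightarrow> real" and B T :: real +
  fixes eps :: "real \<Rightarrow> 'w \<Rightarrow> real"
  assumes eps_meas: "(\<lambda>(t, \<omega>). eps t \<omega>) \<in> borel_measurable (lborel \<Otimes>\<^sub>M M)"
    and eps_int: "\<And>t. is_stoch_integral M (two_sided L0 L1) (\<lambda>s. ahat (t - s)) (eps t)"
begin

lemma shift_meas: "(\<lambda>s. ahat (t - s)) \<in> borel_measurable borel"
  using a_meas by measurable

lemma eps_cov: "expectation (\<lambda>\<omega>. eps t \<omega> * eps t' \<omega>) = d2 * (LINT s|lborel. ahat (t - s) * ahat (t' - s))"
  by (rule stoch_integral_isometry(3)[OF eps_int eps_int shift_meas shift_meas])

sublocale E: bounded_kernel M eps "d2 * (LINT t|lborel. (ahat t)\<^sup>2)" B T w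
proof
  show "(\<lambda>(t, x). eps t x) \<in> borel_measurable (lborel \<Otimes>\<^sub>M M)" by (rule eps_meas)
  show "sq_integrable M (eps t)" for t
    by (rule stoch_integral_isometry(1)[OF eps_int eps_int shift_meas shift_meas])
  show "expectation (\<lambda>\<omega>. (eps t \<omega>)\<^sup>2) \<le> d2 * (LINT t|lborel. (ahat t)\<^sup>2)" for t
    using eps_cov[of t t] lborel_integral_reflect[of "\<lambda>s. (ahat s)\<^sup>2" t] by (simp add: power2_eq_square)
qed (rule w_meas w_bound)+

text \<open>\<open>integral_Y_square\<close> is read for both kernels \<open>E\<close> and
  \<open>K\<close>: the two double integrals have the same form, and their Gram functions differ by
  the factor \<open>d2\<close>.\<close>

lemma Y_square: "expectation (\<lambda>\<omega>. (E.Y \<omega>)\<^sup>2) = d2 * (LINT s|lborel. (correl w ahat s)\<^sup>2)"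
proof -
  have "expectation (\<lambda>\<omega>. (E.Y \<omega>)\<^sup>2) =
    (LINT t|lborel. w t * (LINT t'|lborel. w t' * (d2 * (LINT s|lborel. ahat (t' - s) * ahat (t - s)))))"
    unfolding E.integral_Y_square eps_cov ..
  also have "\<dots> = (LINT t|lborel. d2 * (w t * (LINT t'|lborel. w t' * (LINT s|lborel. ahat (t' - s) * ahat (t - s)))))"
  proof (intro Bochner_Integration.integral_cong refl)
    fix t
    have inner: "(LINT t'|lborel. w t' * (d2 * (LINT s|lborel. ahat (t' - s) * ahat (t - s)))) =
      d2 * (LINT t'|lborel. w t' * (LINT s|lborel. ahat (t' - s) * ahat (t - s)))"
      by (subst integral_mult_right_zero[symmetric]) (simp only: mult.left_commute)
    show "w t * (LINT t'|lborel. w t' * (d2 * (LINT s|lborel. ahat (t' - s) * ahat (t - s)))) =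
      d2 * (w t * (LINT t'|lborel. w t' * (LINT s|lborel. ahat (t' - s) * ahat (t - s))))"
      unfolding inner by (simp only: mult.left_commute)
  qed
  also have "\<dots> = d2 * (LINT t|lborel. w t * (LINT t'|lborel. w t' * (LINT s|lborel. ahat (t' - s) * ahat (t - s))))"
    by (rule integral_mult_right_zero)
  finally show ?thesis unfolding K.integral_Y_square[unfolded K_Y] .
qed

text \<open>After expanding both squares, the mixed terms are matched by
  \<open>integral_Y_mult\<close> for the two kernels, with \<open>grid_isometry\<close> in between.
  This is the assumption \<open>iso\<close> of \<open>char_bound\<close>.\<close>

lemma Y_grid:
  assumes "\<delta> > 0"
  shows "expectation (\<lambda>\<omega>. (E.Y \<omega> - grid_int \<delta> c c' m \<omega>)\<^sup>2) =
    d2 * (LINT s|lborel. (correl w ahat s - grid_fun \<delta> c c' m s)\<^sup>2)"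
proof -
  let ?J = "grid_int \<delta> c c' m" and ?f = "grid_fun \<delta> c c' m" and ?h = "correl w ahat"
  note J = sq_integrable_grid_int[of \<delta> c c' m] and f = sq_integrable_grid_fun[of \<delta> c c' m]
  have ex: "(\<integral>x. (F x - G x)\<^sup>2 \<partial>P) = (\<integral>x. (F x)\<^sup>2 \<partial>P) - 2 * (\<integral>x. F x * G x \<partial>P) + (\<integral>x. (G x)\<^sup>2 \<partial>P)"
    if "sq_integrable P F" "sq_integrable P G" for P :: "'c measure" and F G
  proof -
    have "(\<integral>x. (F x - G x)\<^sup>2 \<partial>P) = (\<integral>x. (F x)\<^sup>2 - 2 * (F x * G x) + (G x)\<^sup>2 \<partial>P)"
      by (intro Bochner_Integration.integral_cong) (auto simp: power2_eq_square algebra_simps)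
    then show ?thesis
      using sq_integrable_square[OF that(1)] sq_integrable_square[OF that(2)] sq_integrable_mult[OF that] by simp
  qed
  have "expectation (\<lambda>\<omega>. E.Y \<omega> * ?J \<omega>) = (LINT t|lborel. w t * (d2 * (LINT s|lborel. ahat (t - s) * ?f s)))"
    unfolding E.integral_Y_mult[OF J] grid_isometry[OF eps_int shift_meas sq_a assms] ..
  also have "\<dots> = d2 * (LINT t|lborel. w t * (LINT s|lborel. ahat (t - s) * ?f s))"
    by (simp only: integral_mult_right_zero[symmetric] mult.left_commute)
  also have "\<dots> = d2 * (LINT s|lborel. ?h s * ?f s)"
    unfolding K.integral_Y_mult[OF f, unfolded K_Y] ..
  finally have YJ: "expectation (\<lambda>\<omega>. E.Y \<omega> * ?J \<omega>) = d2 * (LINT s|lborel. ?h s * ?f s)" .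
  show ?thesis
    unfolding ex[OF E.sq_integrable_Y J] ex[OF sq_integrable_correl f] YJ Y_square grid_int_square[OF assms]
    by (simp add: algebra_simps)
qed

lemma char_linear_process:
  assumes "\<And>x. \<bar>x\<bar> \<le> \<bar>B\<bar> * (LINT t|lborel. \<bar>ahat t\<bar>) \<Longrightarrow> cmod (\<psi> x + complex_of_real (d2 * x\<^sup>2 / 2)) \<le> \<eta> * x\<^sup>2"
  shows "cmod ((\<integral>\<omega>. cis (E.Y \<omega>) \<partial>M) - exp (complex_of_real (- (d2 * (LINT s|lborel. (correl w ahat s)\<^sup>2) / 2)))) \<le>
     \<eta> * (LINT s|lborel. (correl w ahat s)\<^sup>2)"
  by (rule char_bound[OF E.sq_integrable_Y continuous_correl correl_bound sq_integrable_correl Y_grid assms])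

text \<open>The constant 1 is square integrable on a probability space, which allows
  \<open>J = 1\<close> in \<open>integrable_w_k_mult\<close>. Pathwise integrals of linear
  combinations are split by means of it.\<close>

lemma AE_integrable_eps: "AE \<omega> in M. integrable lborel (\<lambda>t. w t * eps t \<omega>)"
proof -
  have "sq_integrable M (\<lambda>_. 1)" by (simp add: sq_integrable_def)
  from E.AE_integrable_snd[OF E.integrable_w_k_mult[OF this]] show ?thesis by simp
qed

end

section \<open>The central limit theorem\<close>

lemma cm_int_cmult: "cm_int N (\<lambda>x. k * h x) = complex_of_real k * cm_int N h"
  by (simp add: cm_int_def complex_eq_iff right_diff_distrib)

lemma ft_sum:
  assumes "\<And>i. i \<in> I \<Longrightarrow> integrable lborel (f i)"
  shows "ft (\<lambda>t. \<Sum>i\<in>I. u i * f i t) l = (\<Sum>i\<in>I. complex_of_real (u i) * ft (f i) l)"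
proof -
  have "ft (\<lambda>t. \<Sum>i\<in>I. u i * f i t) l = (LINT t|lborel. (\<Sum>i\<in>I. complex_of_real (u i) * (cis (l * t) * complex_of_real (f i t))))"
    unfolding ft_def by (simp add: sum_distrib_left mult_ac)
  also have "\<dots> = (\<Sum>i\<in>I. (LINT t|lborel. complex_of_real (u i) * (cis (l * t) * complex_of_real (f i t))))"
    using assms by (intro Bochner_Integration.integral_sum integrable_mult_right integrable_cis_mult)
  finally show ?thesis by (simp add: ft_def)
qed

locale regression = centered_levy M a b Lm L0 L1
  for M :: "'w measure" and a b Lm L0 L1 +
  fixes ahat :: "real \<Rightarrow> real" and eps :: "real \<Rightarrow> 'w \<Rightarrow> real"
    and gd :: "'q::finite \<Rightarrow> real \<Rightarrow> real ^ 'q \<Rightarrow> real" and \<alpha> :: "real ^ 'q"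
    and \<mu> :: "'q \<Rightarrow> 'q \<Rightarrow> nat \<Rightarrow> real measure" and c :: "'q \<Rightarrow> real"
  assumes ahat_L1: "integrable lborel ahat" and ahat_L2: "integrable lborel (\<lambda>t. (ahat t)\<^sup>2)"
    and eps_meas: "(\<lambda>(t, \<omega>). eps t \<omega>) \<in> borel_measurable (lborel \<Otimes>\<^sub>M M)"
    and eps_int: "\<And>t. is_stoch_integral M (two_sided L0 L1) (\<lambda>s. ahat (t - s)) (eps t)"
    and gd_meas: "\<And>i T. set_borel_measurable lborel {0..T} (\<lambda>t. gd i t \<alpha>)"
    and d_pos: "\<And>i T. T > 0 \<Longrightarrow> dT gd i T \<alpha> > 0"
    and mu_weak: "\<And>j l h. continuous_on UNIV h \<Longrightarrow> bounded (range h) \<Longrightarrow>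
          ((\<lambda>T. LINT x|lborel. complex_of_real (h x) * muT_dens gd j l T \<alpha> x) \<longlongrightarrow> cm_int (\<mu> j l) h) at_top"
    and b_bound: "\<And>i T t. T > 0 \<Longrightarrow> t \<in> {0..T} \<Longrightarrow> \<bar>bT gd i T t \<alpha>\<bar> \<le> c i / sqrt T"
begin

text \<open>
  The weights b_iT extended by zero, their linear combination along u, its bound, and the
  squared norm of h_T.
\<close>

definition wi :: "real \<Rightarrow> 'q \<Rightarrow> real \<Rightarrow> real" where
  "wi T i t = indicator {0..T} t * bT gd i T t \<alpha>"

definition wu :: "real ^ 'q \<Rightarrow> real \<Rightarrow> real \<Rightarrow> real" where
  "wu u T t = (\<Sum>i\<in>UNIV. u $ i * wi T i t)"

definition Bu :: "real ^ 'q \<Rightarrow> real \<Rightarrow> real" where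
  "Bu u T = (\<Sum>i\<in>UNIV. \<bar>u $ i\<bar> * c i) / sqrt T"

definition V :: "real ^ 'q \<Rightarrow> real \<Rightarrow> real" where
  "V u T = (LINT s|lborel. (correl (wu u T) ahat s)\<^sup>2)"

lemma wi_meas: "wi T i \<in> borel_measurable borel"
proof -
  have "(\<lambda>t. indicator {0..T} t *\<^sub>R gd i t \<alpha> / dT gd i T \<alpha>) \<in> borel_measurable borel"
    using gd_meas[of T i] unfolding set_borel_measurable_def by (intro borel_measurable_divide) auto
  then show ?thesis by (simp add: wi_def[abs_def] bT_def)
qed

lemma wu_meas: "wu u T \<in> borel_measurable borel"
  unfolding wu_def[abs_def] using wi_meas by measurable

text \<open>Makes single coordinates the case of a unit vector, so that statements about
  \<open>wu\<close> cover them.\<close>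

lemma wu_axis: "wu (axis i 1) T = wi T i"
  by (auto simp: wu_def axis_def if_distrib[where f="\<lambda>x. x * _"] cong: if_cong)

lemma wi_bound: "T > 0 \<Longrightarrow> \<bar>wi T i t\<bar> \<le> c i / sqrt T * indicator {0..T} t"
  using b_bound[of T t i] by (auto simp: wi_def indicator_def)

lemma wu_bound:
  assumes "T > 0"
  shows "\<bar>wu u T t\<bar> \<le> Bu u T * indicator {0..T} t"
proof -
  have "\<bar>wu u T t\<bar> \<le> (\<Sum>i\<in>UNIV. \<bar>u $ i * wi T i t\<bar>)" unfolding wu_def by (rule sum_abs)
  also have "\<dots> \<le> (\<Sum>i\<in>UNIV. \<bar>u $ i\<bar> * (c i / sqrt T * indicator {0..T} t))"
    using wi_bound[OF assms] by (intro sum_mono) (simp only: abs_mult mult_left_mono abs_ge_zero)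
  also have "\<dots> = Bu u T * indicator {0..T} t"
    by (simp add: Bu_def sum_divide_distrib sum_distrib_right mult.assoc)
  finally show ?thesis .
qed

lemma linear_process_wu: "T > 0 \<Longrightarrow> linear_process M a b Lm L0 L1 (wu u T) ahat (Bu u T) T eps"
  by unfold_locales (auto intro: ahat_L1 ahat_L2 wu_meas wu_bound eps_meas eps_int)

lemma zeta_nth: "zeta eps gd \<alpha> T \<omega> $ i = (LINT t|lborel. wi T i t * eps t \<omega>)"
  by (simp add: zeta_def set_lebesgue_integral_def wi_def mult_ac)

lemma zeta_measurable: "zeta eps gd \<alpha> T \<in> borel_measurable M"
proof -
  note [measurable] = wi_meas eps_meas
  have "(\<lambda>\<omega>. zeta eps gd \<alpha> T \<omega> $ i) \<in> borel_measurable M" for i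
    unfolding zeta_nth by measurable
  then show ?thesis
    by (subst borel_measurable_euclidean_space) (auto simp: Basis_vec_def inner_axis)
qed

lemma zeta_inner:
  assumes "T > 0"
  shows "AE \<omega> in M. u \<bullet> zeta eps gd \<alpha> T \<omega> = (LINT t|lborel. wu u T t * eps t \<omega>)"
proof -
  have "AE \<omega> in M. integrable lborel (\<lambda>t. wi T i t * eps t \<omega>)" for i
    using linear_process.AE_integrable_eps[OF linear_process_wu[OF assms, of "axis i 1"]] by (simp only: wu_axis)
  then have "AE \<omega> in M. \<forall>i\<in>UNIV. integrable lborel (\<lambda>t. wi T i t * eps t \<omega>)"
    by (intro AE_finite_allI) auto
  then show ?thesis
  proof eventually_elim
    case (elim \<omega>)
    have "u \<bullet> zeta eps gd \<alpha> T \<omega> = (\<Sum>i\<in>UNIV. (LINT t|lborel. u $ i * (wi T i t * eps t \<omega>)))"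
      by (simp add: inner_vec_def zeta_nth)
    also have "\<dots> = (LINT t|lborel. (\<Sum>i\<in>UNIV. u $ i * (wi T i t * eps t \<omega>)))"
      using elim by (intro Bochner_Integration.integral_sum[symmetric] integrable_mult_right) auto
    finally show ?case by (simp add: wu_def sum_distrib_right mult.assoc)
  qed
qed

lemma zeta_second_moment:
  assumes "T > 0"
  shows "integrable M (\<lambda>\<omega>. (zeta eps gd \<alpha> T \<omega> $ i)\<^sup>2)"
    "expectation (\<lambda>\<omega>. (zeta eps gd \<alpha> T \<omega> $ i)\<^sup>2) = d2 * V (axis i 1) T"
proof -
  interpret LP: linear_process M a b Lm L0 L1 "wu (axis i 1) T" ahat "Bu (axis i 1) T" T eps
    by (rule linear_process_wu[OF assms])
  have eq: "LP.E.Y \<omega> = zeta eps gd \<alpha> T \<omega> $ i" for \<omega>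
    unfolding LP.E.Y_def unfolding zeta_nth wu_axis ..
  show "integrable M (\<lambda>\<omega>. (zeta eps gd \<alpha> T \<omega> $ i)\<^sup>2)"
    using sq_integrable_square[OF LP.E.sq_integrable_Y] by (simp add: eq)
  show "expectation (\<lambda>\<omega>. (zeta eps gd \<alpha> T \<omega> $ i)\<^sup>2) = d2 * V (axis i 1) T"
    using LP.Y_square by (simp add: eq V_def)
qed

lemma zeta_char:
  assumes "T > 0"
    and "\<And>x. \<bar>x\<bar> \<le> \<bar>Bu u T\<bar> * (LINT t|lborel. \<bar>ahat t\<bar>) \<Longrightarrow> cmod (\<psi> x + complex_of_real (d2 * x\<^sup>2 / 2)) \<le> \<eta> * x\<^sup>2"
  shows "cmod ((\<integral>\<omega>. cis (u \<bullet> zeta eps gd \<alpha> T \<omega>) \<partial>M) - exp (complex_of_real (- (d2 * V u T / 2)))) \<le> \<eta> * V u T"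
proof -
  interpret LP: linear_process M a b Lm L0 L1 "wu u T" ahat "Bu u T" T eps
    by (rule linear_process_wu[OF assms(1)])
  have "AE \<omega> in M. cis (u \<bullet> zeta eps gd \<alpha> T \<omega>) = cis (LP.E.Y \<omega>)"
    using zeta_inner[OF assms(1), of u] by eventually_elim (simp add: LP.E.Y_def)
  then have "(\<integral>\<omega>. cis (u \<bullet> zeta eps gd \<alpha> T \<omega>) \<partial>M) = (\<integral>\<omega>. cis (LP.E.Y \<omega>) \<partial>M)"
    using zeta_measurable[of T] by (intro integral_cong_AE) auto
  then show ?thesis using LP.char_linear_process[OF assms(2)] by (simp add: V_def)
qed

lemma wi_square:
  assumes "T > 0"
  shows "integrable lborel (wi T i)" "integrable lborel (\<lambda>t. (wi T i t)\<^sup>2)" "(LINT t|lborel. (wi T i t)\<^sup>2) = 1"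
proof -
  interpret LP: linear_process M a b Lm L0 L1 "wu (axis i 1) T" ahat "Bu (axis i 1) T" T eps
    by (rule linear_process_wu[OF assms])
  show "integrable lborel (wi T i)" "integrable lborel (\<lambda>t. (wi T i t)\<^sup>2)"
    using LP.K.integrable_w LP.K.integrable_w_square by (simp_all only: wu_axis)
  \<comment> \<open>\<open>dT\<close> is a square root; its positivity forces the integral under the
    root to be positive, and squaring recovers it.\<close>
  have "0 < (LINT t:{0..T}|lborel. (gd i t \<alpha>)\<^sup>2)"
    using d_pos[OF assms, of i] by (simp add: dT_def)
  then have d: "(LINT t:{0..T}|lborel. (gd i t \<alpha>)\<^sup>2) = (dT gd i T \<alpha>)\<^sup>2" by (simp add: dT_def)
  have "(LINT t|lborel. (wi T i t)\<^sup>2) = (LINT t|lborel. indicator {0..T} t *\<^sub>R (gd i t \<alpha>)\<^sup>2 / (dT gd i T \<alpha>)\<^sup>2)"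
    by (intro Bochner_Integration.integral_cong) (auto simp: wi_def bT_def power_mult_distrib power_divide indicator_def)
  also have "\<dots> = (LINT t:{0..T}|lborel. (gd i t \<alpha>)\<^sup>2) / (dT gd i T \<alpha>)\<^sup>2"
    unfolding set_lebesgue_integral_def by simp
  also have "\<dots> = 1" unfolding d using d_pos[OF assms, of i] by simp
  finally show "(LINT t|lborel. (wi T i t)\<^sup>2) = 1" .
qed

lemma gT_eq: "T > 0 \<Longrightarrow> gT gd i T \<alpha> x = complex_of_real (dT gd i T \<alpha>) * ft (wi T i) x"
proof -
  assume T: "T > 0"
  have "complex_of_real (dT gd i T \<alpha>) * ft (wi T i) x =
    (LINT t|lborel. complex_of_real (dT gd i T \<alpha>) * (cis (x * t) * complex_of_real (wi T i t)))"
    unfolding ft_def by simp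
  also have "\<dots> = gT gd i T \<alpha> x"
    unfolding gT_def set_lebesgue_integral_def using d_pos[OF T, of i]
    by (intro Bochner_Integration.integral_cong) (auto simp: wi_def bT_def indicator_def)
  finally show ?thesis by simp
qed

text \<open>By Plancherel the squared norm of \<open>gT\<close> is 2 pi times the square of
  \<open>dT\<close>, because \<open>wi\<close> has unit norm. The factors \<open>dT\<close> cancel
  and the normalization leaves 2 pi.\<close>

lemma muT_dens_eq:
  assumes "T > 0"
  shows "muT_dens gd j l T \<alpha> x = ft (wi T j) x * cnj (ft (wi T l) x) / complex_of_real (2 * pi)"
proof -
  have nrm: "(LINT y|lborel. (cmod (gT gd i T \<alpha> y))\<^sup>2) = (dT gd i T \<alpha>)\<^sup>2 * (2 * pi)" for i
  proof -
    have "(LINT y|lborel. (cmod (gT gd i T \<alpha> y))\<^sup>2) = (LINT y|lborel. (dT gd i T \<alpha>)\<^sup>2 * (cmod (ft (wi T i) y))\<^sup>2)"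
      by (simp add: gT_eq[OF assms] norm_mult power_mult_distrib)
    also have "\<dots> = (dT gd i T \<alpha>)\<^sup>2 * (2 * pi)"
      using Plancherel(2)[OF wi_square(1,2)[OF assms, of i]] by (simp add: wi_square(3)[OF assms])
    finally show ?thesis .
  qed
  have "(LINT y|lborel. (cmod (gT gd j T \<alpha> y))\<^sup>2) * (LINT y|lborel. (cmod (gT gd l T \<alpha> y))\<^sup>2) =
    (2 * pi * dT gd j T \<alpha> * dT gd l T \<alpha>)\<^sup>2"
    unfolding nrm by (simp add: power2_eq_square)
  then have "sqrt ((LINT y|lborel. (cmod (gT gd j T \<alpha> y))\<^sup>2) * (LINT y|lborel. (cmod (gT gd l T \<alpha> y))\<^sup>2)) =
    2 * pi * dT gd j T \<alpha> * dT gd l T \<alpha>"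
    using d_pos[OF assms, of j] d_pos[OF assms, of l] by simp
  then show ?thesis
    unfolding muT_dens_def gT_eq[OF assms] using d_pos[OF assms, of j] d_pos[OF assms, of l]
    by (simp add: field_simps)
qed

abbreviation "F2 \<equiv> \<lambda>x. (cmod (fourier ahat x))\<^sup>2"

text \<open>Admits |a|^2 as a test function for the weak convergence; both properties rest on
  \<open>ahat\<close> being in L1.\<close>

lemma F2_cont: "continuous_on UNIV F2" "bounded (range F2)"
proof -
  show "continuous_on UNIV F2"
    by (intro continuous_intros continuous_fourier[OF ahat_L1])
  have "norm (F2 x) \<le> (LINT t|lborel. \<bar>ahat t\<bar>)\<^sup>2" for x
    using power_mono[OF fourier_bound[of ahat x], of 2] by simp
  then show "bounded (range F2)"
    using boundedI[of "range F2" "(LINT t|lborel. \<bar>ahat t\<bar>)\<^sup>2"] by blast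
qed

text \<open>Plancherel turns \<open>V\<close> into the integral of |ft wu|^2 |a|^2 / (2 pi), and
  expanding |ft wu|^2 along u produces the densities in the form of
  \<open>muT_dens_eq\<close>.\<close>

lemma V_eq:
  assumes "T > 0"
  shows "complex_of_real (V u T) = (\<Sum>j\<in>UNIV. \<Sum>l\<in>UNIV. complex_of_real (u $ j * u $ l) *
     (LINT x|lborel. complex_of_real (F2 x) * muT_dens gd j l T \<alpha> x))"
proof -
  interpret LP: linear_process M a b Lm L0 L1 "wu u T" ahat "Bu u T" T eps
    by (rule linear_process_wu[OF assms])
  have [measurable]: "wi T i \<in> borel_measurable borel" for i by (rule wi_meas)
  have [measurable]: "fourier ahat \<in> borel_measurable borel"
    by (rule borel_measurable_continuous_onI[OF continuous_fourier[OF ahat_L1]])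
  have [measurable]: "cnj \<in> borel_measurable borel"
    by (intro borel_measurable_continuous_onI continuous_intros)
  let ?m = "\<lambda>j l x. complex_of_real (F2 x) * muT_dens gd j l T \<alpha> x"
  \<comment> \<open>Each density is a product of two transforms in L2, dominated by the sum of their
    squared moduli, while |a|^2 is bounded.\<close>
  have int: "integrable lborel (?m j l)" for j l
  proof (rule Bochner_Integration.integrable_bound)
    let ?A = "(LINT t|lborel. \<bar>ahat t\<bar>)\<^sup>2"
    show "integrable lborel (\<lambda>x. ?A * ((cmod (ft (wi T j) x))\<^sup>2 + (cmod (ft (wi T l) x))\<^sup>2))"
      using Plancherel(1)[OF wi_square(1,2)[OF assms, of j]] Plancherel(1)[OF wi_square(1,2)[OF assms, of l]]
      by (intro integrable_mult_right Bochner_Integration.integrable_add)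
    show "?m j l \<in> borel_measurable lborel"
      unfolding muT_dens_eq[OF assms] by measurable
    have "norm (?m j l x) \<le> norm (?A * ((cmod (ft (wi T j) x))\<^sup>2 + (cmod (ft (wi T l) x))\<^sup>2))" for x
    proof -
      let ?p = "cmod (ft (wi T j) x)" and ?q = "cmod (ft (wi T l) x)"
      have "norm (?m j l x) = F2 x * (?p * ?q / (2 * pi))"
        unfolding muT_dens_eq[OF assms] by (simp add: norm_mult norm_divide norm_power)
      also have "\<dots> \<le> ?A * (?p\<^sup>2 + ?q\<^sup>2)"
      proof (rule mult_mono)
        show "F2 x \<le> ?A" using power_mono[OF fourier_bound[of ahat x], of 2] by simp
        have "2 * ?p * ?q \<le> ?p\<^sup>2 + ?q\<^sup>2" by (rule sum_squares_bound)
        moreover have "?p * ?q / (2 * pi) \<le> 2 * ?p * ?q"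
        proof -
          have "?p * ?q / (2 * pi) \<le> ?p * ?q / 1" using pi_ge_two by (intro divide_left_mono) auto
          also have "\<dots> \<le> 2 * ?p * ?q" by simp
          finally show ?thesis .
        qed
        ultimately show "?p * ?q / (2 * pi) \<le> ?p\<^sup>2 + ?q\<^sup>2" by linarith
      qed auto
      finally show ?thesis by simp
    qed
    then show "AE x in lborel. norm (?m j l x) \<le> norm (?A * ((cmod (ft (wi T j) x))\<^sup>2 + (cmod (ft (wi T l) x))\<^sup>2))"
      by simp
  qed
  have ftw: "ft (wu u T) x = (\<Sum>i\<in>UNIV. complex_of_real (u $ i) * ft (wi T i) x)" for x
    unfolding wu_def[abs_def] by (rule ft_sum) (rule wi_square(1)[OF assms])
  have pt: "complex_of_real ((cmod (ft (wu u T) x))\<^sup>2 * F2 x) / complex_of_real (2 * pi) =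
     (\<Sum>j\<in>UNIV. \<Sum>l\<in>UNIV. complex_of_real (u $ j * u $ l) * ?m j l x)" for x
  proof -
    have "complex_of_real ((cmod (ft (wu u T) x))\<^sup>2) = ft (wu u T) x * cnj (ft (wu u T) x)"
      by (rule complex_norm_square)
    also have "\<dots> = (\<Sum>j\<in>UNIV. \<Sum>l\<in>UNIV. (complex_of_real (u $ j) * ft (wi T j) x) * (complex_of_real (u $ l) * cnj (ft (wi T l) x)))"
      unfolding ftw by (simp add: sum_product)
    finally have e: "complex_of_real ((cmod (ft (wu u T) x))\<^sup>2) = \<dots>" .
    show ?thesis
      unfolding of_real_mult[of "(cmod (ft (wu u T) x))\<^sup>2"] e sum_distrib_right sum_divide_distrib muT_dens_eq[OF assms]
      by (intro sum.cong refl) (simp add: field_simps)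
  qed
  have "complex_of_real (V u T) = complex_of_real (2 * pi * V u T) / complex_of_real (2 * pi)" by simp
  also have "\<dots> = (LINT x|lborel. complex_of_real ((cmod (ft (wu u T) x))\<^sup>2 * F2 x) / complex_of_real (2 * pi))"
    unfolding V_def LP.Plancherel_correl by (simp only: integral_divide_zero integral_complex_of_real)
  also have "\<dots> = (LINT x|lborel. (\<Sum>j\<in>UNIV. \<Sum>l\<in>UNIV. complex_of_real (u $ j * u $ l) * ?m j l x))"
    by (simp only: pt)
  also have "\<dots> = (\<Sum>j\<in>UNIV. \<Sum>l\<in>UNIV. complex_of_real (u $ j * u $ l) * (LINT x|lborel. ?m j l x))"
    using int by (simp only: Bochner_Integration.integral_sum Bochner_Integration.integrable_sum
      integrable_mult_right integral_mult_right_zero)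
  finally show ?thesis .
qed

text \<open>The limit of \<open>V u T\<close>. Taking the real part gives a real number at once;
  \<open>R_eq\<close> shows that nothing is lost.\<close>

definition R :: "real ^ 'q \<Rightarrow> real" where
  "R u = Re (\<Sum>j\<in>UNIV. \<Sum>l\<in>UNIV. complex_of_real (u $ j * u $ l) * cm_int (\<mu> j l) F2)"

text \<open>The limiting form is a limit of the squared norms \<open>V\<close> and so inherits being
  real and nonnegative, as \<open>gaussian_law_exists\<close> demands.\<close>

lemma V_tendsto: "(V u \<longlongrightarrow> R u) at_top"
  and R_nonneg: "0 \<le> R u"
  and R_eq: "(\<Sum>j\<in>UNIV. \<Sum>l\<in>UNIV. complex_of_real (u $ j * u $ l) * cm_int (\<mu> j l) F2) = complex_of_real (R u)"
proof -
  let ?Q = "\<Sum>j\<in>UNIV. \<Sum>l\<in>UNIV. complex_of_real (u $ j * u $ l) * cm_int (\<mu> j l) F2"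
  have "((\<lambda>T. \<Sum>j\<in>UNIV. \<Sum>l\<in>UNIV. complex_of_real (u $ j * u $ l) *
     (LINT x|lborel. complex_of_real (F2 x) * muT_dens gd j l T \<alpha> x)) \<longlongrightarrow> ?Q) at_top"
    by (intro tendsto_sum tendsto_mult tendsto_const mu_weak F2_cont)
  moreover have "\<forall>\<^sub>F T in at_top. (\<Sum>j\<in>UNIV. \<Sum>l\<in>UNIV. complex_of_real (u $ j * u $ l) *
     (LINT x|lborel. complex_of_real (F2 x) * muT_dens gd j l T \<alpha> x)) = complex_of_real (V u T)"
    using eventually_gt_at_top[of "0::real"] by eventually_elim (simp only: V_eq)
  ultimately have lim: "((\<lambda>T. complex_of_real (V u T)) \<longlongrightarrow> ?Q) at_top"
    by (rule Lim_transform_eventually)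
  show V: "(V u \<longlongrightarrow> R u) at_top"
    using tendsto_Re[OF lim] by (simp add: R_def)
  show "0 \<le> R u"
    by (rule tendsto_lowerbound[OF V]) (auto simp: V_def)
  have "((\<lambda>T. complex_of_real (V u T)) \<longlongrightarrow> complex_of_real (R u)) at_top"
    using V by (rule tendsto_of_real)
  from tendsto_unique[OF _ lim this] show "?Q = complex_of_real (R u)" by simp
qed

lemma char_tendsto:
  "((\<lambda>T. \<integral>\<omega>. cis (u \<bullet> zeta eps gd \<alpha> T \<omega>) \<partial>M) \<longlongrightarrow> exp (complex_of_real (- (d2 * R u / 2)))) at_top"
proof -
  let ?\<phi> = "\<lambda>T. \<integral>\<omega>. cis (u \<bullet> zeta eps gd \<alpha> T \<omega>) \<partial>M"
  have "((\<lambda>T. ?\<phi> T - exp (complex_of_real (- (d2 * V u T / 2)))) \<longlongrightarrow> 0) at_top"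
  proof (rule tendstoI)
    fix e :: real assume "e > 0"
    \<comment> \<open>\<open>V u T\<close> is eventually below \<open>R u + 1\<close>, so the error
      eta V is at most e / 2; the added 1 keeps the divisor positive.\<close>
    define \<eta> where "\<eta> = e / 2 / (R u + 1)"
    have R1: "R u + 1 > 0" using R_nonneg[of u] by linarith
    then have half: "\<eta> * (R u + 1) = e / 2"
      unfolding \<eta>_def by (intro nonzero_eq_divide_eq[THEN iffD1] refl) simp
    have "\<eta> > 0" using \<open>e > 0\<close> R1 by (simp add: \<eta>_def)
    moreover have "\<eta> * (R u + 1) < e" using \<open>e > 0\<close> half by linarith
    ultimately have \<eta>: "\<eta> > 0" "\<eta> * (R u + 1) < e" .
    obtain \<delta> where \<delta>: "\<delta> > 0" "\<And>x. \<bar>x\<bar> \<le> \<delta> \<Longrightarrow> cmod (\<psi> x + complex_of_real (d2 * x\<^sup>2 / 2)) \<le> \<eta> * x\<^sup>2"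
      using exponent_approx[OF \<eta>(1)] by blast
    \<comment> \<open>The numerator of \<open>Bu\<close> is free of T, so the uniform bound on h_T
      eventually falls below delta.\<close>
    have "((\<lambda>T. Bu u T) \<longlongrightarrow> 0) at_top"
      unfolding Bu_def
      by (rule tendsto_divide_0[OF tendsto_const filterlim_at_top_imp_at_infinity[OF sqrt_at_top]])
    then have "((\<lambda>T. \<bar>Bu u T\<bar> * (LINT t|lborel. \<bar>ahat t\<bar>)) \<longlongrightarrow> \<bar>0\<bar> * (LINT t|lborel. \<bar>ahat t\<bar>)) at_top"
      by (intro tendsto_mult tendsto_rabs tendsto_const)
    then have "((\<lambda>T. \<bar>Bu u T\<bar> * (LINT t|lborel. \<bar>ahat t\<bar>)) \<longlongrightarrow> 0) at_top" by simp
    then have "\<forall>\<^sub>F T in at_top. \<bar>Bu u T\<bar> * (LINT t|lborel. \<bar>ahat t\<bar>) < \<delta>"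
      using \<delta>(1) by (rule order_tendstoD)
    moreover have "\<forall>\<^sub>F T in at_top. V u T < R u + 1"
      using V_tendsto by (rule order_tendstoD) simp
    moreover have "\<forall>\<^sub>F T in at_top. T > (0::real)" by (rule eventually_gt_at_top)
    ultimately show "\<forall>\<^sub>F T in at_top. dist (?\<phi> T - exp (complex_of_real (- (d2 * V u T / 2)))) 0 < e"
    proof eventually_elim
      case (elim T)
      have "cmod (?\<phi> T - exp (complex_of_real (- (d2 * V u T / 2)))) \<le> \<eta> * V u T"
        using elim by (intro zeta_char \<delta>(2)) auto
      also have "\<dots> \<le> \<eta> * (R u + 1)" using elim \<eta>(1) by (intro mult_left_mono) auto
      also have "\<dots> < e" by (rule \<eta>(2))
      finally show ?case by simp
    qed
  qed
  moreover have "((\<lambda>T. exp (complex_of_real (- (d2 * V u T / 2)))) \<longlongrightarrow> exp (complex_of_real (- (d2 * R u / 2)))) at_top"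
    by (intro tendsto_intros V_tendsto) auto
  ultimately show ?thesis using tendsto_add by fastforce
qed

text \<open>The second moment of a coordinate is \<open>d2 * V\<close> at a unit vector;
  \<open>V\<close> converges, so it is eventually below its limit plus 1.\<close>

lemma tight:
  "\<forall>\<^sub>F T in at_top. integrable M (\<lambda>\<omega>. (norm (zeta eps gd \<alpha> T \<omega>))\<^sup>2) \<and>
     expectation (\<lambda>\<omega>. (norm (zeta eps gd \<alpha> T \<omega>))\<^sup>2) \<le> (\<Sum>i\<in>UNIV. d2 * (R (axis i 1) + 1))"
proof -
  have "\<forall>\<^sub>F T in at_top. \<forall>i\<in>UNIV. V (axis i 1) T < R (axis i 1) + 1"
    using V_tendsto by (intro eventually_ball_finite ballI) (auto intro!: order_tendstoD)
  moreover have "\<forall>\<^sub>F T in at_top. T > (0::real)" by (rule eventually_gt_at_top)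
  ultimately show ?thesis
  proof eventually_elim
    case (elim T)
    have eq: "(norm (zeta eps gd \<alpha> T \<omega>))\<^sup>2 = (\<Sum>i\<in>UNIV. (zeta eps gd \<alpha> T \<omega> $ i)\<^sup>2)" for \<omega>
      unfolding power2_norm_eq_inner inner_vec_def by (simp add: power2_eq_square)
    have "expectation (\<lambda>\<omega>. (norm (zeta eps gd \<alpha> T \<omega>))\<^sup>2) = (\<Sum>i\<in>UNIV. d2 * V (axis i 1) T)"
      unfolding eq using zeta_second_moment[of T] elim by (simp add: Bochner_Integration.integral_sum)
    also have "\<dots> \<le> (\<Sum>i\<in>UNIV. d2 * (R (axis i 1) + 1))"
      using elim d2_nonneg by (intro sum_mono mult_left_mono) (auto intro: less_imp_le)
    finally show ?case
      unfolding eq using zeta_second_moment(1)[of T] elim by (auto intro!: Bochner_Integration.integrable_sum)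
  qed
qed

theorem zeta_clt:
  "\<exists>N. gaussian_law (\<lambda>j l. complex_of_real (2 * pi) * cm_int (\<mu> j l) (spec_dens d2 ahat)) N \<and>
    conv_in_distr M (zeta eps gd \<alpha>) N"
proof -
  let ?Sig = "\<lambda>j l. complex_of_real (2 * pi) * cm_int (\<mu> j l) (spec_dens d2 ahat)"
  \<comment> \<open>The factor 1 / (2 pi) in \<open>spec_dens\<close> cancels against the 2 pi of
    the covariance, leaving \<open>d2\<close> times the integrals of |a|^2.\<close>
  have "spec_dens d2 ahat = (\<lambda>x. d2 / (2 * pi) * F2 x)" by (simp add: spec_dens_def[abs_def])
  then have "?Sig j l = complex_of_real (2 * pi) * (complex_of_real (d2 / (2 * pi)) * cm_int (\<mu> j l) F2)" for j l
    by (simp only: cm_int_cmult)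
  then have Sig: "?Sig j l = complex_of_real d2 * cm_int (\<mu> j l) F2" for j l by simp
  have Q: "(\<Sum>j\<in>UNIV. \<Sum>l\<in>UNIV. complex_of_real (u $ j * u $ l) * ?Sig j l) = complex_of_real (d2 * R u)" for u
  proof -
    have "(\<Sum>j\<in>UNIV. \<Sum>l\<in>UNIV. complex_of_real (u $ j * u $ l) * ?Sig j l) =
      complex_of_real d2 * (\<Sum>j\<in>UNIV. \<Sum>l\<in>UNIV. complex_of_real (u $ j * u $ l) * cm_int (\<mu> j l) F2)"
      unfolding Sig by (simp add: sum_distrib_left mult_ac)
    also have "\<dots> = complex_of_real d2 * complex_of_real (R u)" by (simp only: R_eq)
    finally show ?thesis unfolding of_real_mult[of d2 "R u"] .
  qed
  have "\<exists>N. gaussian_law ?Sig N"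
    using Q R_nonneg d2_nonneg by (intro gaussian_law_exists exI[of _ "d2 * R _"]) auto
  then obtain N where N: "gaussian_law ?Sig N" by blast
  then have N': "prob_space N" "sets N = sets borel" by (auto simp: gaussian_law_def)
  have "(\<integral>x. cis (u \<bullet> x) \<partial>N) = exp (- (1/2) * complex_of_real (d2 * R u))" for u
    using N unfolding gaussian_law_def Q by blast
  then have char: "(\<integral>x. cis (u \<bullet> x) \<partial>N) = exp (complex_of_real (- (d2 * R u / 2)))" for u by simp
  have "conv_in_distr M (zeta eps gd \<alpha>) N"
    by (rule Levy_continuity_vec[OF prob_space_axioms N' zeta_measurable _ tight])
      (simp only: char char_tendsto)
  then show ?thesis using N by blast
qed

end

theorem theoremB1:
  fixes M :: "'w measure"
    and a b :: real and Lm :: "real measure"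
    and L0 L1 :: "real \<Rightarrow> 'w \<Rightarrow> real"
    and ahat :: "real \<Rightarrow> real"
    and eps :: "real \<Rightarrow> 'w \<Rightarrow> real"
    and g :: "real \<Rightarrow> real ^ 'q::finite \<Rightarrow> real"
    and gd :: "'q \<Rightarrow> real \<Rightarrow> real ^ 'q \<Rightarrow> real"
    and A :: "(real ^ 'q) set" and \<alpha> :: "real ^ 'q"
    and \<mu> :: "'q \<Rightarrow> 'q \<Rightarrow> nat \<Rightarrow> real measure"
    and c :: "'q \<Rightarrow> real"
  assumes M: "prob_space M"
    and L: "two_sided_levy M a b Lm L0 L1"
    \<comment> \<open>(A1)\<close>
    and ahat_meas: "ahat \<in> borel_measurable borel"
    and ahat_causal: "\<forall>t<0. ahat t = 0"
    and ahat_L1: "integrable lborel ahat"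
    and ahat_L2: "integrable lborel (\<lambda>t. (ahat t)\<^sup>2)"
    and L1_sq: "integrable M (\<lambda>\<omega>. (L0 1 \<omega>)\<^sup>2)"
    and L1_mean: "integrable M (L0 1)" "(\<integral>\<omega>. L0 1 \<omega> \<partial>M) = 0"
    and Pi_exp: "\<exists>p>0. (\<integral>\<^sup>+u. ennreal (exp (p * u) * indicator {u. \<bar>u\<bar> \<ge> 1} u) \<partial>Lm) < \<infinity>"
    \<comment> \<open>the linear process epsilon(t) = int ahat(t - s) dL(s), a jointly measurable version\<close>
    and eps_meas: "(\<lambda>(t, \<omega>). eps t \<omega>) \<in> borel_measurable (lborel \<Otimes>\<^sub>M M)"
    and eps_def: "\<forall>t. is_stoch_integral M (two_sided L0 L1) (\<lambda>s. ahat (t - s)) (eps t)"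
    \<comment> \<open>regression function\<close>
    and A: "open A" "convex A" "\<alpha> \<in> A"
    and g_diff: "\<forall>t\<ge>0. \<forall>\<beta>\<in>A. (g t has_derivative (\<lambda>h. \<Sum>i\<in>UNIV. h $ i * gd i t \<beta>)) (at \<beta>)"
    and gd_cont: "\<forall>t\<ge>0. \<forall>i. continuous_on A (gd i t)"
    and gd_loc_L2: "\<forall>i. \<forall>\<beta>\<in>A. \<forall>T. set_borel_measurable lborel {0..T} (\<lambda>t. gd i t \<beta>)
                       \<and> set_integrable lborel {0..T} (\<lambda>t. (gd i t \<beta>)\<^sup>2)"
    and d_pos: "\<forall>i. \<forall>\<beta>\<in>A. \<forall>T>0. dT gd i T \<beta> > 0"
    \<comment> \<open>condition 1: weak convergence to a positive definite matrix measure\<close>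
    and mu_rep: "\<forall>j l. cmeasure_rep (\<mu> j l)"
    and mu_weak: "\<forall>j l. \<forall>h :: real \<Rightarrow> real. continuous_on UNIV h \<and> bounded (range h) \<longrightarrow>
          ((\<lambda>T. LINT x|lborel. complex_of_real (h x) * muT_dens gd j l T \<alpha> x)
             \<longlongrightarrow> cm_int (\<mu> j l) h) at_top"
    and mu_nonneg: "\<forall>B \<in> sets lebesgue. \<forall>z :: 'q \<Rightarrow> complex.
          Im (\<Sum>j\<in>UNIV. \<Sum>l\<in>UNIV. cnj (z j) * cm_val (\<mu> j l) B * z l) = 0
        \<and> Re (\<Sum>j\<in>UNIV. \<Sum>l\<in>UNIV. cnj (z j) * cm_val (\<mu> j l) B * z l) \<ge> 0"
    and mu_posdef: "\<forall>z :: 'q \<Rightarrow> complex. z \<noteq> (\<lambda>_. 0) \<longrightarrow>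
          Re (\<Sum>j\<in>UNIV. \<Sum>l\<in>UNIV. cnj (z j) * cm_val (\<mu> j l) UNIV * z l) > 0"
    \<comment> \<open>condition 2\<close>
    and b_bound: "\<forall>i. \<forall>T>0. \<forall>t\<in>{0..T}. \<bar>bT gd i T t \<alpha>\<bar> \<le> c i / sqrt T"
  shows "\<exists>N. gaussian_law
              (\<lambda>j l. complex_of_real (2 * pi) *
                 cm_int (\<mu> j l) (spec_dens (\<integral>\<omega>. (L0 1 \<omega>)\<^sup>2 \<partial>M) ahat)) N
           \<and> conv_in_distr M (zeta eps gd \<alpha>) N"
proof -
  interpret prob_space M by (rule M)
  interpret regression M a b Lm L0 L1 ahat eps gd \<alpha> \<mu> c
    by unfold_locales (use assms in auto)
  show ?thesis using zeta_clt by (simp only: d2_def)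
qed

end
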